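(* There is an algorithm that solves Makespan Minimization on Uniform Machines in time $p_{\max}^{O(d)} n^{O(1)}$, where $p_{\max}=\max_j p_j$ is the maximum processing time and $d=|\{p_1,\dotsc,p_n\}|$ is the number of distinct processing times.
   Context: Makespan Minimization on Uniform Machines: the input consists of integers $n\ge m\ge 1$, job processing times $p_1,\dotsc,p_n\in\mathbb{N}$ and machine speeds $s_1,\dotsc,s_m\in\mathbb{N}$, with each processing time given explicitly (natural encoding). The task is to find an assignment $\sigma:\{1,\dotsc,n\}\to\{1,\dotsc,m\}$ minimizing the makespan $\max_{i=1,\dotsc,m}\sum_{j:\sigma(j)=i} p_j/s_i$. *)

theory Defs
  imports Complex_Main "HOL-Library.FuncSet"
begin

text \<open>Jobs are \<open>1, \<dots>, n\<close> and machines are \<open>1, \<dots>, m\<close>; the values of \<open>p\<close> and \<open>s\<close> outside these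
  ranges are irrelevant. Natural numbers are positive here, as is needed for dividing by a speed.\<close>

definition uniform_instance ::
  "nat \<Rightarrow> nat \<Rightarrow> (nat \<Rightarrow> nat) \<Rightarrow> (nat \<Rightarrow> nat) \<Rightarrow> bool" where
  "uniform_instance n m p s \<longleftrightarrow>
     1 \<le> m \<and> m \<le> n \<and> (\<forall>j\<in>{1..n}. 1 \<le> p j) \<and> (\<forall>i\<in>{1..m}. 1 \<le> s i)"

definition makespan ::
  "nat \<Rightarrow> nat \<Rightarrow> (nat \<Rightarrow> nat) \<Rightarrow> (nat \<Rightarrow> nat) \<Rightarrow> (nat \<Rightarrow> nat) \<Rightarrow> real" where
  "makespan n m p s \<sigma> =
     (MAX i\<in>{1..m}. \<Sum>j\<in>{j\<in>{1..n}. \<sigma> j = i}. real (p j) / real (s i))"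

definition optimal_assignment ::
  "nat \<Rightarrow> nat \<Rightarrow> (nat \<Rightarrow> nat) \<Rightarrow> (nat \<Rightarrow> nat) \<Rightarrow> (nat \<Rightarrow> nat) \<Rightarrow> bool" where
  "optimal_assignment n m p s \<sigma> \<longleftrightarrow>
     \<sigma> \<in> {1..n} \<rightarrow> {1..m} \<and>
     (\<forall>\<tau>\<in>{1..n} \<rightarrow> {1..m}. makespan n m p s \<sigma> \<le> makespan n m p s \<tau>)"

definition p_max :: "nat \<Rightarrow> (nat \<Rightarrow> nat) \<Rightarrow> nat" where
  "p_max n p = Max (p ` {1..n})"

definition num_types :: "nat \<Rightarrow> (nat \<Rightarrow> nat) \<Rightarrow> nat" where
  "num_types n p = card (p ` {1..n})"

text \<open>An algorithm is a structured program for a random access machine with unit-cost instructions.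
  A program names finitely many registers, each holding a natural number, and finitely many
  unbounded arrays, which provide indirect addressing. The only arithmetic is addition and
  subtraction: unit-cost multiplication of unbounded numbers would make the machine unrealistically
  powerful, whereas here numbers gain at most one bit per operation, so that running time is
  polynomially related to bit complexity. Unit cost is essential, since the running time
  is to be bounded independently of the size of the machine speeds.\<close>

record state =
  reg :: "string \<Rightarrow> nat"
  arr :: "string \<Rightarrow> nat \<Rightarrow> nat"

datatype aexp =
    Const nat
  | Reg string
  | Get string aexp
  | Plus aexp aexp
  | Minus aexp aexp

datatype bexp =
    Less aexp aexp
  | Not bexp
  | And bexp bexp

datatype com =
    Skip
  | Assign string aexp
  | Put string aexp aexp
  | Seq com com
  | If bexp com com
  | While bexp com

primrec aval :: "aexp \<Rightarrow> state \<Rightarrow> nat" where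
  "aval (Const k) st = k"
| "aval (Reg x) st = reg st x"
| "aval (Get A e) st = arr st A (aval e st)"
| "aval (Plus e1 e2) st = aval e1 st + aval e2 st"
| "aval (Minus e1 e2) st = aval e1 st - aval e2 st"

primrec bval :: "bexp \<Rightarrow> state \<Rightarrow> bool" where
  "bval (Less e1 e2) st \<longleftrightarrow> aval e1 st < aval e2 st"
| "bval (Not b) st \<longleftrightarrow> \<not> bval b st"
| "bval (And b1 b2) st \<longleftrightarrow> bval b1 st \<and> bval b2 st"

primrec acost :: "aexp \<Rightarrow> nat" where
  "acost (Const k) = 1"
| "acost (Reg x) = 1"
| "acost (Get A e) = acost e + 1"
| "acost (Plus e1 e2) = acost e1 + acost e2 + 1"
| "acost (Minus e1 e2) = acost e1 + acost e2 + 1"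

primrec bcost :: "bexp \<Rightarrow> nat" where
  "bcost (Less e1 e2) = acost e1 + acost e2 + 1"
| "bcost (Not b) = bcost b + 1"
| "bcost (And b1 b2) = bcost b1 + bcost b2 + 1"

text \<open>\<open>exec c st t st'\<close>: started in \<open>st\<close>, the program \<open>c\<close> halts in \<open>st'\<close> after \<open>t\<close> steps.\<close>

inductive exec :: "com \<Rightarrow> state \<Rightarrow> nat \<Rightarrow> state \<Rightarrow> bool" where
  Skip: "exec Skip st 1 st"
| Assign: "exec (Assign x e) st (acost e + 1) (st\<lparr>reg := (reg st)(x := aval e st)\<rparr>)"
| Put: "exec (Put A i e) st (acost i + acost e + 1)
    (st\<lparr>arr := (arr st)(A := (arr st A)(aval i st := aval e st))\<rparr>)"
| Seq: "\<lbrakk>exec c1 st t1 st1; exec c2 st1 t2 st2\<rbrakk> \<Longrightarrow> exec (Seq c1 c2) st (t1 + t2) st2"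
| IfTrue: "\<lbrakk>bval b st; exec c1 st t st'\<rbrakk> \<Longrightarrow> exec (If b c1 c2) st (bcost b + t + 1) st'"
| IfFalse: "\<lbrakk>\<not> bval b st; exec c2 st t st'\<rbrakk> \<Longrightarrow> exec (If b c1 c2) st (bcost b + t + 1) st'"
| WhileFalse: "\<not> bval b st \<Longrightarrow> exec (While b c) st (bcost b + 1) st"
| WhileTrue: "\<lbrakk>bval b st; exec c st t1 st1; exec (While b c) st1 t2 st2\<rbrakk>
    \<Longrightarrow> exec (While b c) st (bcost b + t1 + t2 + 1) st2"

inductive_cases exec_SkipE: "exec Skip st t st'"
inductive_cases exec_AssignE: "exec (Assign x e) st t st'"
inductive_cases exec_PutE: "exec (Put A i e) st t st'"
inductive_cases exec_SeqE: "exec (Seq c1 c2) st t st'"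
inductive_cases exec_IfE: "exec (If b c1 c2) st t st'"
inductive_cases exec_WhileE: "exec (While b c) st t st'"

lemma exec_deterministic:
  assumes "exec c st t st'" and "exec c st u su"
  shows "u = t \<and> su = st'"
  using assms
proof (induction arbitrary: u su rule: exec.induct)
  case (Skip st)
  then show ?case by - (erule exec_SkipE, simp_all)
next
  case (Assign x e st)
  then show ?case by - (erule exec_AssignE, simp_all)
next
  case (Put A i e st)
  then show ?case by - (erule exec_PutE, simp_all)
next
  case (Seq c1 st t1 st1 c2 t2 st2)
  from Seq.prems Seq.IH show ?case by - (erule exec_SeqE, blast)
next
  case (IfTrue b st c1 t st' c2)
  from IfTrue.prems IfTrue.hyps(1) obtain v where v: "exec c1 st v su" "u = Suc (bcost b + v)"
    by - (erule exec_IfE, blast+)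
  from IfTrue.IH[OF v(1)] v(2) show ?case by simp
next
  case (IfFalse b st c2 t st' c1)
  from IfFalse.prems IfFalse.hyps(1) obtain v where v: "exec c2 st v su" "u = Suc (bcost b + v)"
    by - (erule exec_IfE, blast+)
  from IfFalse.IH[OF v(1)] v(2) show ?case by simp
next
  case (WhileFalse b st c)
  from WhileFalse.prems WhileFalse.hyps show ?case by - (erule exec_WhileE, simp_all)
next
  case (WhileTrue b st c t1 st1 t2 st2)
  from WhileTrue.prems WhileTrue.hyps(1) obtain v1 sv1 v2
    where v: "exec c st v1 sv1" "exec (While b c) sv1 v2 su" "u = Suc (bcost b + v1 + v2)"
    by - (erule exec_WhileE, blast+)
  from WhileTrue.IH(1)[OF v(1)] have v1: "v1 = t1" "sv1 = st1" by simp_all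
  from WhileTrue.IH(2)[OF v(2)[unfolded v1]] v(3) v1 show ?case by simp
qed

text \<open>The input is given explicitly in memory, which is zero elsewhere.\<close>

definition input_state :: "nat \<Rightarrow> nat \<Rightarrow> (nat \<Rightarrow> nat) \<Rightarrow> (nat \<Rightarrow> nat) \<Rightarrow> state" where
  "input_state n m p s =
     \<lparr>reg = (\<lambda>_. 0)(''n'' := n, ''m'' := m),
      arr = (\<lambda>_ _. 0)
        (''p'' := (\<lambda>j. if j \<in> {1..n} then p j else 0),
         ''s'' := (\<lambda>i. if i \<in> {1..m} then s i else 0))\<rparr>"

definition output_assignment :: "state \<Rightarrow> nat \<Rightarrow> nat" where
  "output_assignment st = arr st ''sigma''"

end

theory Submission
  imports Defs
begin

text \<open>The optimal makespan is \<open>L / s i0\<close> for a load \<open>L\<close> and a machine \<open>i0\<close>, so it suffices to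
  decide for every such guess whether the jobs fit into the resulting integral capacities. If a
  machine has capacity at least \<open>h = 4 * pm ^ 3\<close>, where \<open>pm\<close> is the maximum processing time, it is
  replaced by machines of capacity \<open>a * (2 * pm\<^sup>2)\<close> and one smaller rest, for a further guess
  \<open>a \<le> pm\<close>. This loses nothing: after filling idle time with unit jobs and exchanging \<open>a\<close> jobs of
  size \<open>l\<close> for \<open>l\<close> jobs of size \<open>a\<close> between machines, some size \<open>a\<close> can be made frequent on all
  large machines, and bundles of \<open>a\<close> equal jobs together with single jobs of size \<open>a\<close> fill parts
  whose capacity is a multiple of \<open>a\<close>.

  Now there are fewer than \<open>h\<close> kinds of machines, each holding few jobs. The machines are
  processed in an order in which every initial segment contains every kind in about the right
  proportion. By the Steinitz lemma, applied to each kind, the contents of the machines can be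
  permuted so that after \<open>k\<close> of \<open>M\<close> machines the vector of placed jobs is within \<open>pm ^ O(1)\<close> of
  \<open>k / M\<close> times the vector of all jobs in each coordinate. A dynamic program therefore only needs
  \<open>pm ^ O(d)\<close> vectors per machine.\<close>

section \<open>Ordering vectors with small prefix sums\<close>

text \<open>The time may depend neither on the size of the speeds nor on \<open>n ^ d\<close>, where
  d is the number of job sizes. Yet vectors are stored as numbers in a base \<open>B > n\<close>, so
  one layer of the table spans more than \<open>n ^ d\<close> addresses. Therefore only the
  \<open>len\<close> cells of the current box are visited, cells are relied on to be zero until
  first written instead of being cleared, and products are computed by repeated addition, with a
  factor as counter that is known to be small. Large numbers then occur only as operands and
  addresses, which cost one step. The Steinitz lemma is used in dimension \<open>pm\<close> instead
  of d: its constant enters only the width \<open>E\<close> of a box, and \<open>(E + 1) ^ d\<close>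
  remains \<open>pm ^ O(d)\<close>. It is applied within one kind since only machines of equal
  capacity can exchange their contents freely. The threshold is \<open>h = 2 * pm * q\<close> with
  \<open>q = 2 * pm\<^sup>2\<close>. A part has capacity \<open>a * q\<close>; the bound on
  \<open>q\<close> makes a part dominate the jobs that do not complete a bundle, and the factor
  \<open>2 * pm\<close> makes a machine to be cut at least twice as large as a part.\<close>

lemma linear_dependence:
  fixes f :: "'i \<Rightarrow> 'v \<Rightarrow> real"
  assumes "finite V" "finite F" "card V < card F"
  shows "\<exists>h. (\<exists>i\<in>F. h i \<noteq> 0) \<and> (\<forall>v\<in>V. (\<Sum>i\<in>F. h i * f i v) = 0)"
  using assms
proof (induction V arbitrary: F f rule: finite_induct)
  case empty
  then have "F \<noteq> {}" by auto
  then show ?case by (intro exI[of _ "\<lambda>_. 1"]) auto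
next
  case (insert v V)
  show ?case
  proof (cases "\<forall>i\<in>F. f i v = 0")
    case True
    from insert.IH[of F f] insert.prems insert.hyps obtain h where
      "\<exists>i\<in>F. h i \<noteq> 0" "\<forall>v\<in>V. (\<Sum>i\<in>F. h i * f i v) = 0" by auto
    with True show ?thesis by (intro exI[of _ h]) auto
  next
    case False
    then obtain j where j: "j \<in> F" "f j v \<noteq> 0" by auto
    \<comment> \<open>Gaussian elimination: the pivot \<open>j\<close> clears coordinate
      \<open>v\<close> from every other vector.\<close>
    define g where "g i u = f i u - f i v / f j v * f j u" for i u
    have "card V < card (F - {j})" using insert.prems insert.hyps j by simp
    with insert.IH[of "F - {j}" g] insert.prems obtain h where
      h: "\<exists>i\<in>F-{j}. h i \<noteq> 0" "\<forall>u\<in>V. (\<Sum>i\<in>F-{j}. h i * g i u) = 0" by auto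
    define k where "k = (\<Sum>i\<in>F-{j}. h i * (f i v / f j v))"
    define h' where "h' = h(j := - k)"
    have split: "(\<Sum>i\<in>F. h' i * f i u) = (\<Sum>i\<in>F-{j}. h i * f i u) - k * f j u" for u
    proof -
      have "(\<Sum>i\<in>F. h' i * f i u) = h' j * f j u + (\<Sum>i\<in>F-{j}. h' i * f i u)"
        using insert.prems j by (simp add: sum.remove)
      also have "(\<Sum>i\<in>F-{j}. h' i * f i u) = (\<Sum>i\<in>F-{j}. h i * f i u)"
        by (intro sum.cong) (auto simp: h'_def)
      finally show ?thesis by (simp add: h'_def)
    qed
    have gsum: "(\<Sum>i\<in>F-{j}. h i * g i u) = (\<Sum>i\<in>F-{j}. h i * f i u) - k * f j u" for u
      by (simp add: g_def k_def right_diff_distrib sum_subtractf sum_distrib_right mult.assoc)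
    have "(\<Sum>i\<in>F. h' i * f i u) = 0" if "u \<in> insert v V" for u
    proof (cases "u = v")
      case True
      have "k * f j v = (\<Sum>i\<in>F-{j}. h i * f i v)"
        using j by (simp add: k_def sum_distrib_right)
      then show ?thesis using True split by simp
    next
      case False
      then show ?thesis using that h(2) split gsum by auto
    qed
    moreover have "\<exists>i\<in>F. h' i \<noteq> 0" using h(1) by (auto simp: h'_def)
    ultimately show ?thesis by blast
  qed
qed

text \<open>The polytope of the Grinberg-Sevastyanov proof of the Steinitz lemma: fractional subsets
  of total weight \<open>c\<close> whose weighted vector sum vanishes.\<close>

definition steinitz_weights ::
  "'i set \<Rightarrow> 'v set \<Rightarrow> ('i \<Rightarrow> 'v \<Rightarrow> real) \<Rightarrow> real \<Rightarrow> ('i \<Rightarrow> real) \<Rightarrow> bool" where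
  "steinitz_weights A V f c \<mu> \<longleftrightarrow>
     (\<forall>i\<in>A. 0 \<le> \<mu> i \<and> \<mu> i \<le> 1) \<and> sum \<mu> A = c \<and> (\<forall>v\<in>V. (\<Sum>i\<in>A. \<mu> i * f i v) = 0)"

text \<open>A vertex of the polytope has at most one fractional coordinate for each of its
  \<open>card V + 1\<close> equations. In place of a vertex, a point with the fewest fractional
  coordinates is taken.\<close>

lemma steinitz_weights_few_fractional:
  assumes fin: "finite A" "finite V" and ex: "steinitz_weights A V f c \<mu>0"
  shows "\<exists>\<mu>. steinitz_weights A V f c \<mu> \<and> card {i\<in>A. 0 < \<mu> i \<and> \<mu> i < 1} \<le> card V + 1"
proof -
  define frac where "frac \<mu> = {i\<in>A. 0 < \<mu> i \<and> \<mu> i < (1::real)}" for \<mu>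
  obtain \<mu> where \<mu>: "steinitz_weights A V f c \<mu>"
    and min: "\<And>\<nu>. steinitz_weights A V f c \<nu> \<Longrightarrow> card (frac \<mu>) \<le> card (frac \<nu>)"
    using ex exists_least_iff[of "\<lambda>k. \<exists>\<nu>. steinitz_weights A V f c \<nu> \<and> card (frac \<nu>) = k"]
    by (metis (mono_tags, lifting) linorder_not_le)
  have "card (frac \<mu>) \<le> card V + 1"
  proof (rule ccontr)
    assume "\<not> ?thesis"
    let ?F = "frac \<mu>"
    have finF: "finite ?F" using fin by (simp add: frac_def)
    have FA: "?F \<subseteq> A" by (auto simp: frac_def)
    \<comment> \<open>\<open>None\<close> is an extra coordinate with constant entry 1, so that a
      dependence also preserves the total weight.\<close>
    define g :: "'a \<Rightarrow> 'b option \<Rightarrow> real" where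
      "g i w = (case w of None \<Rightarrow> 1 | Some v \<Rightarrow> f i v)" for i w
    have "card (insert None (Some ` V)) = card V + 1"
      using fin by (subst card_insert_disjoint) (auto simp: card_image)
    with \<open>\<not> ?thesis\<close> linear_dependence[of "insert None (Some ` V)" ?F g] fin finF obtain h where
      h: "\<exists>i\<in>?F. h i \<noteq> 0" "\<forall>w\<in>insert None (Some ` V). (\<Sum>i\<in>?F. h i * g i w) = 0" by auto
    have hs: "sum h ?F = 0" using h(2) by (simp add: g_def)
    have hf: "(\<Sum>i\<in>?F. h i * f i v) = 0" if "v \<in> V" for v
      using h(2) that by (simp add: g_def)
    define S where "S = {i\<in>?F. h i \<noteq> 0}"
    \<comment> \<open>\<open>r i\<close> is the distance along \<open>h\<close> at which coordinate
      \<open>i\<close> reaches 0 or 1. Stopping at the smallest one makes some coordinate integral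
      and keeps the others between 0 and 1.\<close>
    define r where "r i = (if h i > 0 then (1 - \<mu> i) / h i else \<mu> i / - h i)" for i
    have S: "finite S" "S \<noteq> {}" using finF h(1) by (auto simp: S_def)
    define t where "t = Min (r ` S)"
    have "t \<in> r ` S" unfolding t_def using S by (intro Min_in) auto
    then obtain i0 where i0: "i0 \<in> S" "t = r i0" by auto
    have tmin: "t \<le> r i" if "i \<in> S" for i unfolding t_def using S that by simp
    have tpos: "0 < t" using i0 by (auto simp: S_def r_def frac_def divide_simps)
    define \<nu> where "\<nu> i = (if i \<in> ?F then \<mu> i + t * h i else \<mu> i)" for i
    have bnd: "0 \<le> \<nu> i \<and> \<nu> i \<le> 1" if "i \<in> A" for i
    proof (cases "i \<in> S")
      case True
      then have "h i \<noteq> 0" "i \<in> ?F" "0 < \<mu> i" "\<mu> i < 1" by (auto simp: S_def frac_def)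
      consider "h i > 0" | "h i < 0" using \<open>h i \<noteq> 0\<close> by linarith
      then show ?thesis
      proof cases
        case 1
        then have "t * h i \<le> 1 - \<mu> i" using tmin[OF True] by (simp add: r_def field_simps)
        moreover have "0 \<le> t * h i" using 1 tpos by simp
        ultimately show ?thesis using \<open>0 < \<mu> i\<close> \<open>i \<in> ?F\<close> by (simp add: \<nu>_def)
      next
        case 2
        then have "t \<le> \<mu> i / - h i" using tmin[OF True] by (simp add: r_def)
        then have "t * (- h i) \<le> \<mu> i" using 2 by (subst (asm) pos_le_divide_eq) auto
        moreover have "t * h i \<le> 0" using 2 tpos by (simp add: mult_le_0_iff)
        ultimately show ?thesis using \<open>\<mu> i < 1\<close> \<open>i \<in> ?F\<close> by (simp add: \<nu>_def)
      qed
    next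
      case False
      then have "\<nu> i = \<mu> i" by (auto simp: \<nu>_def S_def)
      then show ?thesis using \<mu> that by (auto simp: steinitz_weights_def)
    qed
    have sumsplit: "(\<Sum>i\<in>A. \<nu> i * z i) = (\<Sum>i\<in>A. \<mu> i * z i) + t * (\<Sum>i\<in>?F. h i * z i)" for z
    proof -
      have "(\<Sum>i\<in>A. \<nu> i * z i) = (\<Sum>i\<in>A. \<mu> i * z i + (if i \<in> ?F then t * h i * z i else 0))"
        by (intro sum.cong) (auto simp: \<nu>_def algebra_simps)
      also have "\<dots> = (\<Sum>i\<in>A. \<mu> i * z i) + (\<Sum>i\<in>A \<inter> ?F. t * h i * z i)"
        using fin by (simp add: sum.distrib sum.inter_restrict)
      also have "A \<inter> ?F = ?F" using FA by auto
      finally show ?thesis by (simp add: sum_distrib_left mult.assoc)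
    qed
    have "steinitz_weights A V f c \<nu>"
      unfolding steinitz_weights_def
      using bnd sumsplit[of "\<lambda>_. 1"] sumsplit hs hf \<mu> by (auto simp: steinitz_weights_def)
    then have "card ?F \<le> card (frac \<nu>)" by (rule min)
    moreover have "frac \<nu> \<subset> ?F"
    proof -
      have "frac \<nu> \<subseteq> ?F" by (auto simp: frac_def \<nu>_def split: if_splits)
      moreover have "\<nu> i0 = 0 \<or> \<nu> i0 = 1" using i0 by (auto simp: \<nu>_def S_def r_def)
      then have "i0 \<notin> frac \<nu>" by (auto simp: frac_def)
      moreover have "i0 \<in> ?F" using i0 by (auto simp: S_def)
      ultimately show ?thesis by auto
    qed
    then have "card (frac \<nu>) < card ?F" using finF by (rule psubset_card_mono[rotated])
    ultimately show False by simp
  qed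
  with \<mu> show ?thesis by (auto simp: frac_def)
qed

text \<open>Scaling lowers the total weight to \<open>k - card V\<close>. If a point with at most
  \<open>card V + 1\<close> fractional entries had no entry 0, all its other entries would be 1 and
  its total would be too large. An element of weight 0 can be removed.\<close>

lemma steinitz_weights_remove:
  assumes fin: "finite A" "finite V" and kA: "card A = Suc k" and k: "card V \<le> k"
    and \<mu>: "steinitz_weights A V f (real (Suc k) - real (card V)) \<mu>"
  shows "\<exists>i\<in>A. \<exists>\<nu>. steinitz_weights (A - {i}) V f (real k - real (card V)) \<nu>"
proof -
  let ?d = "card V"
  define s where "s = (real k - ?d) / (real (Suc k) - ?d)"
  have s: "0 \<le> s" "s \<le> 1" "s * (real (Suc k) - ?d) = real k - ?d" using k by (auto simp: s_def divide_simps)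
  have "steinitz_weights A V f (real k - ?d) (\<lambda>i. s * \<mu> i)"
    using \<mu> s unfolding steinitz_weights_def
    by (auto simp: mult.assoc sum_distrib_left[symmetric] mult_le_one)
  from steinitz_weights_few_fractional[OF fin this] obtain \<nu> where
    \<nu>: "steinitz_weights A V f (real k - ?d) \<nu>" and fr: "card {i\<in>A. 0 < \<nu> i \<and> \<nu> i < 1} \<le> ?d + 1" by auto
  let ?F = "{i\<in>A. 0 < \<nu> i \<and> \<nu> i < 1}"
  have "\<exists>i\<in>A. \<nu> i = 0"
  proof (rule ccontr)
    assume nz: "\<not> ?thesis"
    then have pos: "0 < \<nu> i \<and> \<nu> i \<le> 1" if "i \<in> A" for i
      using \<nu> that by (force simp: steinitz_weights_def)
    have one: "\<nu> i = 1" if "i \<in> A - ?F" for i using pos[of i] that by force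
    have "sum \<nu> A = sum \<nu> (A - ?F) + sum \<nu> ?F"
      using fin by (intro sum.subset_diff) auto
    also have "sum \<nu> (A - ?F) = sum (\<lambda>_. 1) (A - ?F)" using one by (rule sum.cong[OF refl])
    also have "\<dots> = real (card (A - ?F))" by simp
    also have "card (A - ?F) = Suc k - card ?F" using fin kA by (subst card_Diff_subset) auto
    finally have eq: "real k - ?d = real (Suc k - card ?F) + sum \<nu> ?F"
      using \<nu> by (simp add: steinitz_weights_def)
    have leF: "card ?F \<le> Suc k" using card_mono[of A ?F] fin kA by auto
    show False
    proof (cases "?F = {}")
      case True
      then have "card ?F = 0" "sum \<nu> ?F = 0" by (simp_all only: card.empty sum.empty)
      then show False using eq by simp
    next
      case False
      then have "sum \<nu> ?F > 0" using fin by (intro sum_pos) auto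
      then show False using eq fr leF by linarith
    qed
  qed
  then obtain i where i: "i \<in> A" "\<nu> i = 0" by auto
  have "steinitz_weights (A - {i}) V f (real k - ?d) \<nu>"
    using \<nu> i fin unfolding steinitz_weights_def by (auto simp: sum_diff1)
  with i show ?thesis by auto
qed

text \<open>Subtracting the weighted sum changes nothing, and the complementary weights
  \<open>1 - \<mu> i\<close> have total only \<open>card V\<close>.\<close>

lemma steinitz_prefix_bound:
  fixes f :: "'i \<Rightarrow> 'v \<Rightarrow> real" and D :: real
  assumes fin: "finite B" "finite V" and "steinitz_weights B V f (real (card B) - real (card V)) \<mu>"
    and b: "\<forall>i\<in>B. \<forall>v\<in>V. \<bar>f i v\<bar> \<le> D" and v: "v \<in> V"
  shows "\<bar>\<Sum>i\<in>B. f i v\<bar> \<le> card V * D"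
proof -
  have m: "0 \<le> \<mu> i \<and> \<mu> i \<le> 1" if "i \<in> B" for i using assms(3) that by (auto simp: steinitz_weights_def)
  have "(\<Sum>i\<in>B. f i v) = (\<Sum>i\<in>B. (1 - \<mu> i) * f i v)"
    using assms(3) v by (simp add: steinitz_weights_def left_diff_distrib sum_subtractf)
  also have "\<bar>\<dots>\<bar> \<le> (\<Sum>i\<in>B. \<bar>(1 - \<mu> i) * f i v\<bar>)" by (rule sum_abs)
  also have "\<dots> \<le> (\<Sum>i\<in>B. (1 - \<mu> i) * D)"
    using m b v by (intro sum_mono) (auto simp: abs_mult intro!: mult_mono)
  also have "\<dots> = (\<Sum>i\<in>B. 1 - \<mu> i) * D" by (simp add: sum_distrib_right)
  also have "(\<Sum>i\<in>B. 1 - \<mu> i) = card V"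
    using assms(3) by (simp add: steinitz_weights_def sum_subtractf)
  finally show ?thesis .
qed

text \<open>The order is built from its end: an element whose removal leaves a set that still
  carries weights goes last. Sets with fewer than \<open>card V\<close> elements satisfy the bound
  trivially.\<close>

lemma steinitz_order_from_weights:
  fixes f :: "'i \<Rightarrow> 'v \<Rightarrow> real" and D :: real
  assumes "finite A" "finite V"
    and "\<forall>i\<in>A. \<forall>v\<in>V. \<bar>f i v\<bar> \<le> D" and D: "0 \<le> D"
    and "card V \<le> card A \<Longrightarrow> \<exists>\<mu>. steinitz_weights A V f (real (card A) - real (card V)) \<mu>"
  shows "\<exists>xs. distinct xs \<and> set xs = A \<and>
    (\<forall>k. \<forall>v\<in>V. \<bar>\<Sum>i\<in>set (take k xs). f i v\<bar> \<le> card V * D)"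
  using assms(1-3,5)
proof (induction "card A" arbitrary: A)
  case 0
  with D show ?case by (auto intro!: exI[of _ "[]"])
next
  case (Suc k)
  have bound: "\<bar>\<Sum>i\<in>A. f i v\<bar> \<le> card V * D" if v: "v \<in> V" for v
  proof (cases "card V \<le> card A")
    case True
    with Suc.prems(4) obtain \<mu> where "steinitz_weights A V f (real (card A) - real (card V)) \<mu>" by auto
    from steinitz_prefix_bound[OF Suc.prems(1,2) this Suc.prems(3) v] show ?thesis .
  next
    case False
    have "\<bar>\<Sum>i\<in>A. f i v\<bar> \<le> (\<Sum>i\<in>A. \<bar>f i v\<bar>)" by (rule sum_abs)
    also have "\<dots> \<le> of_nat (card A) * D" using Suc.prems(3) v by (intro sum_bounded_above) auto
    also have "\<dots> \<le> card V * D" using False D by (intro mult_right_mono) auto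
    finally show ?thesis .
  qed
  have "\<exists>i\<in>A. card V \<le> k \<longrightarrow> (\<exists>\<nu>. steinitz_weights (A - {i}) V f (real k - real (card V)) \<nu>)"
  proof (cases "card V \<le> k")
    case True
    with Suc.prems(4) Suc.hyps(2) obtain \<mu> where
      "steinitz_weights A V f (real (Suc k) - real (card V)) \<mu>" by auto
    from steinitz_weights_remove[OF Suc.prems(1,2) Suc.hyps(2)[symmetric] True this] show ?thesis by auto
  next
    case False
    have "A \<noteq> {}" using Suc.hyps(2) by auto
    with False show ?thesis by blast
  qed
  then obtain i where i: "i \<in> A"
    "card V \<le> k \<Longrightarrow> \<exists>\<nu>. steinitz_weights (A - {i}) V f (real k - real (card V)) \<nu>" by auto
  have c: "k = card (A - {i})" using i Suc.hyps(2) Suc.prems(1) by simp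
  from Suc.hyps(1)[OF c] Suc.prems i c obtain xs where xs: "distinct xs" "set xs = A - {i}"
    "\<forall>k. \<forall>v\<in>V. \<bar>\<Sum>i\<in>set (take k xs). f i v\<bar> \<le> card V * D" by auto
  have "\<bar>\<Sum>i\<in>set (take j (xs @ [i])). f i v\<bar> \<le> card V * D" if "v \<in> V" for j v
  proof (cases "j \<le> length xs")
    case True
    then show ?thesis using xs(3) that by simp
  next
    case False
    then have "set (take j (xs @ [i])) = A" using xs(2) i by (cases "j - length xs") auto
    then show ?thesis using bound that by simp
  qed
  then show ?case using xs i by (intro exI[of _ "xs @ [i]"]) auto
qed

text \<open>The Steinitz lemma. As the vectors sum to zero, constant weights start the
  construction.\<close>

lemma steinitz_order:
  fixes f :: "'i \<Rightarrow> 'v \<Rightarrow> real" and D :: real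
  assumes "finite A" "finite V"
    and "\<forall>i\<in>A. \<forall>v\<in>V. \<bar>f i v\<bar> \<le> D" and D: "0 \<le> D"
    and zero: "\<forall>v\<in>V. (\<Sum>i\<in>A. f i v) = 0"
  shows "\<exists>xs. distinct xs \<and> set xs = A \<and>
    (\<forall>k. \<forall>v\<in>V. \<bar>\<Sum>i\<in>set (take k xs). f i v\<bar> \<le> card V * D)"
proof (rule steinitz_order_from_weights[OF assms(1-4)])
  assume le: "card V \<le> card A"
  let ?l = "(real (card A) - real (card V)) / real (card A)"
  have "steinitz_weights A V f (real (card A) - real (card V)) (\<lambda>_. ?l)"
  proof (cases "A = {}")
    case True
    then show ?thesis using le by (simp add: steinitz_weights_def)
  next
    case False
    then have "card A > 0" using assms(1) by auto
    moreover have "(\<Sum>i\<in>A. ?l * f i v) = 0" if "v \<in> V" for v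
      using zero that by (simp add: sum_distrib_left[symmetric] del: times_divide_eq_left)
    ultimately show ?thesis using le by (auto simp: steinitz_weights_def divide_simps)
  qed
  then show "\<exists>\<mu>. steinitz_weights A V f (real (card A) - real (card V)) \<mu>" by blast
qed

section \<open>Splitting fast machines\<close>

text \<open>A vector \<open>x\<close> stands for a multiset of jobs, with \<open>x v\<close> jobs of
  size \<open>v\<close>.\<close>

definition load :: "nat \<Rightarrow> (nat \<Rightarrow> nat) \<Rightarrow> nat" where
  "load P x = (\<Sum>v=1..P. v * x v)"

lemma load_add: "load P (\<lambda>v. x v + y v) = load P x + load P y"
  by (simp add: load_def sum.distrib distrib_left)

lemma load_mono: "(\<And>v. x v \<le> y v) \<Longrightarrow> load P x \<le> load P y"
  unfolding load_def by (intro sum_mono mult_le_mono) auto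

lemma load_remove: "a \<in> {1..P} \<Longrightarrow> load P x = a * x a + (\<Sum>v\<in>{1..P}-{a}. v * x v)"
  unfolding load_def by (simp add: sum.remove)

lemma mult_le_load: "a \<in> {1..P} \<Longrightarrow> a * x a \<le> load P x"
  by (simp add: load_remove)

text \<open>Take the largest attainable weight up to \<open>q\<close>: an item that is left over no
  longer fits, so the gap is smaller than \<open>P\<close>.\<close>

lemma fill_almost:
  fixes b :: "'v \<Rightarrow> nat" and wt :: "'v \<Rightarrow> nat"
  assumes fin: "finite V" and wP: "\<And>v. v \<in> V \<Longrightarrow> 0 < wt v \<and> wt v \<le> P"
  shows "\<exists>k. (\<forall>v. k v \<le> b v) \<and> (\<Sum>v\<in>V. wt v * k v) \<le> q \<and>
    (q < (\<Sum>v\<in>V. wt v * k v) + P \<or> (\<forall>v\<in>V. k v = b v))"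
proof -
  define B where "B k = (\<Sum>v\<in>V. wt v * k v)" for k
  define ok where "ok c \<longleftrightarrow> (\<exists>k. (\<forall>v. k v \<le> b v) \<and> B k = c \<and> c \<le> q)" for c
  have "ok 0" by (auto simp: ok_def B_def intro!: exI[of _ "\<lambda>_. 0"])
  moreover have "\<forall>c. ok c \<longrightarrow> c \<le> q" by (auto simp: ok_def)
  ultimately have "ok (Greatest ok)" "\<forall>c'. ok c' \<longrightarrow> c' \<le> Greatest ok"
    using GreatestI_nat[of ok 0 q] Greatest_le_nat[of ok _ q] by auto
  then obtain c where c: "ok c" "\<forall>c'. ok c' \<longrightarrow> c' \<le> c" by blast
  then obtain k where k: "\<forall>v. k v \<le> b v" "B k = c" "c \<le> q" by (auto simp: ok_def)
  have "q < B k + P" if v: "v \<in> V" "k v \<noteq> b v" for v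
  proof (rule ccontr)
    assume "\<not> q < B k + P"
    define k' where "k' = k(v := k v + 1)"
    have "B k' = wt v * (k v + 1) + (\<Sum>u\<in>V-{v}. wt u * k' u)"
      using fin v by (simp add: B_def sum.remove k'_def)
    also have "(\<Sum>u\<in>V-{v}. wt u * k' u) = (\<Sum>u\<in>V-{v}. wt u * k u)"
      by (intro sum.cong) (auto simp: k'_def)
    finally have B': "B k' = B k + wt v"
      using fin v by (simp add: B_def sum.remove)
    have "\<forall>u. k' u \<le> b u" using k(1) v by (auto simp: k'_def le_neq_implies_less Suc_leI)
    moreover have "B k' \<le> q" using B' wP[OF v(1)] \<open>\<not> q < B k + P\<close> by linarith
    ultimately have "ok (B k')" by (auto simp: ok_def)
    then have "B k' \<le> c" using c(2) by blast
    then show False using B' k(2) wP[OF v(1)] by simp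
  qed
  then show ?thesis using k by (intro exI[of _ k]) (auto simp: B_def)
qed

text \<open>Since \<open>a\<close> jobs of size \<open>v\<close> weigh as much as \<open>v\<close> jobs of size \<open>a\<close>, a part of load exactly
  \<open>a * q\<close> can be assembled from such bundles and completed by jobs of size \<open>a\<close>. The last
  inequality keeps jobs of size \<open>a\<close> frequent enough to go on.\<close>

lemma split_off_part:
  fixes P a q c :: nat
  assumes a: "a \<in> {1..P}" and q: "2 * P\<^sup>2 \<le> q" and c: "load P x = c" "2 * P * q \<le> c"
    and xa: "P * c \<le> x a * (a * q)"
  shows "\<exists>z. (\<forall>v. z v \<le> x v) \<and> load P z = a * q \<and> P * (c - a * q) \<le> (x a - z a) * (a * q)"
proof -
  \<comment> \<open>The hypothesis \<open>xa\<close> says that \<open>x a\<close> is at least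
    \<open>P\<close> times the number \<open>c / (a * q)\<close> of parts. As long as bundles
    remain, a part consumes at most \<open>P\<close> jobs of size \<open>a\<close>.\<close>
  let ?V = "{1..P} - {a}"
  have P: "1 \<le> P" "a \<le> P" "1 \<le> a" using a by auto
  have P2: "P \<le> P\<^sup>2" "1 \<le> P\<^sup>2" using P by (auto simp: power2_eq_square)
  have "\<exists>k. (\<forall>v. k v \<le> x v div a) \<and> (\<Sum>v\<in>?V. v * k v) \<le> q \<and>
      (q < (\<Sum>v\<in>?V. v * k v) + P \<or> (\<forall>v\<in>?V. k v = x v div a))"
    by (rule fill_almost) auto
  then obtain k where k: "\<forall>v. k v \<le> x v div a" "(\<Sum>v\<in>?V. v * k v) \<le> q"
    and kq: "q < (\<Sum>v\<in>?V. v * k v) + P \<or> (\<forall>v\<in>?V. k v = x v div a)"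
    by blast
  define B where "B = (\<Sum>v\<in>?V. v * k v)"
  have B: "B \<le> q" using k by (simp add: B_def)
  define z where "z v = (if v = a then q - B else if v \<in> {1..P} then a * k v else 0)" for v
  have "load P z = a * (q - B) + (\<Sum>v\<in>?V. v * (a * k v))"
    unfolding load_remove[OF a] by (simp add: z_def)
  also have "(\<Sum>v\<in>?V. v * (a * k v)) = a * B" by (simp add: B_def sum_distrib_left mult.left_commute)
  finally have lz: "load P z = a * q" using B by (simp add: distrib_left[symmetric])
  have aqc: "2 * (a * q) \<le> c"
  proof -
    have "2 * (a * q) \<le> 2 * P * q" using P by simp
    then show ?thesis using c by linarith
  qed
  have zle: "z v \<le> x v" if "v \<noteq> a" for v
  proof -
    have "a * k v \<le> a * (x v div a)" using k(1) by simp
    also have "\<dots> \<le> x v" by simp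
    finally show ?thesis using that by (simp add: z_def)
  qed
  have "q - B \<le> x a \<and> P * (c - a * q) \<le> (x a - (q - B)) * (a * q)"
  proof (cases "q < B + P")
    case True
    have "a * q > 0" using P q P2 by auto
    have "2 * P * (a * q) \<le> P * c" using aqc mult_le_mono2[OF aqc, of P] by (simp add: ac_simps)
    then have "2 * P * (a * q) \<le> x a * (a * q)" using xa by linarith
    then have "2 * P \<le> x a" using \<open>a * q > 0\<close> by simp
    moreover have "q - B \<le> P" using True by linarith
    moreover have "P * (c - a * q) \<le> (x a - P) * (a * q)"
      using xa by (simp add: diff_mult_distrib2 diff_mult_distrib)
    moreover have "(x a - P) * (a * q) \<le> (x a - (q - B)) * (a * q)"
      using \<open>q - B \<le> P\<close> by (intro mult_right_mono) auto
    ultimately show ?thesis by linarith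
  next
    case False
    \<comment> \<open>All bundles are used up. Every size other than \<open>a\<close> keeps fewer
      than \<open>a\<close> jobs, so the rest consists of jobs of size \<open>a\<close> except for
      load \<open>R\<close>, which is at most \<open>a * P\<^sup>2\<close>.\<close>
    then have kx: "\<forall>v\<in>?V. k v = x v div a" using kq by (auto simp: B_def)
    define R where "R = (\<Sum>v\<in>?V. v * (x v mod a))"
    have "R \<le> (\<Sum>v\<in>?V. P * a)" unfolding R_def
      using P by (intro sum_mono mult_le_mono) (auto simp: less_imp_le)
    also have "\<dots> \<le> P * (P * a)" using a by simp
    finally have R: "R \<le> a * P\<^sup>2" by (simp add: power2_eq_square ac_simps)
    have "(\<Sum>v\<in>?V. v * x v) = (\<Sum>v\<in>?V. v * (a * k v) + v * (x v mod a))"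
      using kx by (intro sum.cong) (auto simp: distrib_left[symmetric])
    also have "\<dots> = a * B + R"
      by (simp add: sum.distrib B_def R_def sum_distrib_left mult.left_commute)
    finally have cc: "c = a * x a + a * B + R" using c load_remove[OF a, of x] by simp
    have "P\<^sup>2 \<le> q" using q by linarith
    then have "a * P\<^sup>2 \<le> a * q" by simp
    then have Rq: "R \<le> a * q" using R by linarith
    have "a * (q - B) = a * q - a * B" by (simp add: diff_mult_distrib2)
    then have "a * (q - B) \<le> a * x a" using cc aqc Rq by linarith
    then have le: "q - B \<le> x a" using P by simp
    define e where "e = x a - (q - B)"
    have "a * e = a * x a - a * (q - B)" unfolding e_def by (rule diff_mult_distrib2)
    also have "a * (q - B) = a * q - a * B" by (rule diff_mult_distrib2)
    finally have "a * e = a * x a - (a * q - a * B)" .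
    moreover have "a * B \<le> a * q" using B by simp
    ultimately have ae: "a * e + R = c - a * q" using cc aqc Rq by linarith
    define d where "d = c - a * q"
    have d: "a * q \<le> d" using aqc by (simp add: d_def)
    \<comment> \<open>Origin of the bound on \<open>q\<close>: as \<open>d\<close> is at least
      \<open>a * q\<close>, the factor \<open>2 * P\<^sup>2\<close> leaves room for both the
      required \<open>P * d\<close> and the load \<open>R\<close> of the incomplete bundles.\<close>
    have "P * d + P\<^sup>2 * (a * q) \<le> P\<^sup>2 * d + P\<^sup>2 * d"
      using d P2 by (intro add_mono mult_right_mono mult_left_mono) auto
    also have "\<dots> = (2 * P\<^sup>2) * d" by simp
    also have "\<dots> \<le> q * d" using q by (rule mult_right_mono) simp
    also have "\<dots> = q * (a * e) + q * R" using ae[symmetric] by (simp only: d_def distrib_left)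
    also have "q * R \<le> q * (a * P\<^sup>2)" using R by simp
    finally have "P * d \<le> e * (a * q)" by (simp add: ac_simps)
    then show ?thesis using le by (simp add: e_def d_def)
  qed
  then show ?thesis using lz zle by (intro exI[of _ z]) (auto simp: z_def)
qed

text \<open>A part is cut off only while the capacity is at least \<open>h\<close>, the range in
  which \<open>split_off_part\<close> applies. The guards on \<open>b\<close> make the recursion
  terminate.\<close>

function parts :: "nat \<Rightarrow> nat \<Rightarrow> nat \<Rightarrow> nat list" where
  "parts h b c = (if h \<le> c \<and> 0 < b \<and> b \<le> c then b # parts h b (c - b) else [c])"
  by pat_completeness auto
termination by (relation "measure (\<lambda>(h, b, c). c)") auto

declare parts.simps [simp del]

lemma sum_list_parts: "sum_list (parts h b c) = c"
  by (induction h b c rule: parts.induct) (subst parts.simps, auto)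

lemma parts_less: "0 < b \<Longrightarrow> b < h \<Longrightarrow> \<kappa> \<in> set (parts h b c) \<Longrightarrow> \<kappa> < h"
proof (induction h b c rule: parts.induct)
  case (1 h b c)
  then show ?case using parts.simps[of h b c] by (auto split: if_splits)
qed

lemma length_parts: "length (parts h b c) \<le> c + 1"
  by (induction h b c rule: parts.induct) (subst parts.simps, auto)

text \<open>\<open>split_off_part\<close> is iterated; its last conclusion is the hypothesis
  \<open>xa\<close> for the remaining vector.\<close>

lemma split_into_parts:
  assumes a: "a \<in> {1..P}" and q: "2 * P\<^sup>2 \<le> q" and c: "load P x = c"
    and xa: "2 * P * q \<le> c \<Longrightarrow> P * c \<le> x a * (a * q)"
  shows "\<exists>zs. map (load P) zs = parts (2 * P * q) (a * q) c \<and> (\<forall>v. (\<Sum>z\<leftarrow>zs. z v) = x v)"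
  using c xa
proof (induction c arbitrary: x rule: less_induct)
  case (less c)
  have "0 < P" "0 < P\<^sup>2" using a by auto
  then have "0 < q" using q by linarith
  then have pos: "0 < q" "0 < a * q" using a by auto
  show ?case
  proof (cases "2 * P * q \<le> c")
    case True
    from split_off_part[OF a q less.prems(1) True less.prems(2)[OF True]] obtain z where
      z: "\<And>v. z v \<le> x v" "load P z = a * q" "P * (c - a * q) \<le> (x a - z a) * (a * q)" by blast
    define y where "y v = x v - z v" for v
    have x: "x = (\<lambda>v. z v + y v)" using z(1) by (auto simp: y_def)
    have ly: "load P y = c - a * q" "a * q \<le> c"
      using less.prems(1) z(2) unfolding x load_add by auto
    have "c - a * q < c" using ly(2) pos by linarith
    from less.IH[OF this ly(1)] z(3) obtain zs where
      zs: "map (load P) zs = parts (2 * P * q) (a * q) (c - a * q)" "\<And>v. (\<Sum>z\<leftarrow>zs. z v) = y v"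
      by (auto simp: y_def)
    have "parts (2 * P * q) (a * q) c = a * q # parts (2 * P * q) (a * q) (c - a * q)"
      using True ly(2) pos by (subst parts.simps) simp
    then show ?thesis using zs z by (intro exI[of _ "z # zs"]) (simp add: y_def)
  next
    case False
    then show ?thesis using less.prems(1) by (intro exI[of _ "[x]"]) (subst parts.simps, simp)
  qed
qed

text \<open>The deficiency \<open>df\<close> is reduced by trading \<open>a\<close> jobs of some size \<open>l\<close> on a machine that
  lacks jobs of size \<open>a\<close> for \<open>l\<close> jobs of size \<open>a\<close> on a machine that is rich in them.\<close>

lemma redistribute_frequent:
  fixes x :: "nat \<Rightarrow> nat \<Rightarrow> nat" and c :: "nat \<Rightarrow> nat"
  assumes fin: "finite I" and P: "1 \<le> P"
    and lx: "\<And>i. i \<in> I \<Longrightarrow> load P (x i) = c i" and big: "\<And>i. i \<in> I \<Longrightarrow> 4 * P ^ 3 \<le> c i"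
  shows "\<exists>a\<in>{1..P}. \<exists>y. (\<forall>i\<in>I. load P (y i) = c i) \<and> (\<forall>v. (\<Sum>i\<in>I. y i v) = (\<Sum>i\<in>I. x i v)) \<and>
    (\<forall>i\<in>I. c i \<le> 2 * P * (a * y i a))"
proof -
  \<comment> \<open>Pigeonhole: some size carries at least a fraction \<open>1 / P\<close> of the
    total load.\<close>
  have "\<exists>a\<in>{1..P}. (\<Sum>i\<in>I. c i) \<le> P * (\<Sum>i\<in>I. a * x i a)"
  proof (rule ccontr)
    assume "\<not> ?thesis"
    then have lt: "P * (\<Sum>i\<in>I. a * x i a) < (\<Sum>i\<in>I. c i)" if "a \<in> {1..P}" for a
      using that by (auto simp: not_le)
    have "P * (\<Sum>i\<in>I. c i) = P * (\<Sum>i\<in>I. \<Sum>v=1..P. v * x i v)"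
      using lx by (simp add: load_def)
    also have "\<dots> = (\<Sum>v=1..P. P * (\<Sum>i\<in>I. v * x i v))"
      by (subst sum.swap) (simp add: sum_distrib_left)
    also have "\<dots> < (\<Sum>v=1..P. \<Sum>i\<in>I. c i)"
      using lt P by (intro sum_strict_mono) auto
    also have "\<dots> = P * (\<Sum>i\<in>I. c i)" by simp
    finally show False by simp
  qed
  then obtain a where a: "a \<in> {1..P}" and ca: "(\<Sum>i\<in>I. c i) \<le> P * (\<Sum>i\<in>I. a * x i a)" by blast
  define ok where "ok y \<longleftrightarrow> (\<forall>i\<in>I. load P (y i) = c i) \<and> (\<forall>v. (\<Sum>i\<in>I. y i v) = (\<Sum>i\<in>I. x i v))" for y
  \<comment> \<open>Truncated subtraction: a surplus of size \<open>a\<close> on one machine cannot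
    hide a lack on another.\<close>
  define df where "df y = (\<Sum>i\<in>I. c i - 2 * P * (a * y i a))" for y :: "nat \<Rightarrow> nat \<Rightarrow> nat"
  have "ok x" using lx by (simp add: ok_def)
  then obtain y where y: "ok y" and min: "\<And>z. ok z \<Longrightarrow> df y \<le> df z"
    using exists_least_iff[of "\<lambda>k. \<exists>y. ok y \<and> df y = k"] by (metis linorder_not_le)
  have "c j \<le> 2 * P * (a * y j a)" if j: "j \<in> I" for j
  proof (rule ccontr)
    assume lack: "\<not> ?thesis"
    have "P * (\<Sum>i\<in>I. a * x i a) = P * (a * (\<Sum>i\<in>I. y i a))"
      using y by (simp only: ok_def sum_distrib_left)
    also have "\<dots> = (\<Sum>i\<in>I. P * (a * y i a))" by (simp only: sum_distrib_left)
    finally have le: "(\<Sum>i\<in>I. c i) \<le> (\<Sum>i\<in>I. P * (a * y i a))" using ca by simp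
    \<comment> \<open>By averaging, some machine is richer than required by a factor 2. This slack
      pays for the \<open>l\<close> jobs of size \<open>a\<close> that it gives away.\<close>
    have "\<exists>i\<in>I. c i \<le> P * (a * y i a)"
    proof (rule ccontr)
      assume "\<not> ?thesis"
      then have "(\<Sum>i\<in>I. P * (a * y i a)) < (\<Sum>i\<in>I. c i)"
        using j fin by (intro sum_strict_mono) (auto simp: not_le)
      then show False using le by simp
    qed
    then obtain i where i: "i \<in> I" "c i \<le> P * (a * y i a)" by blast
    have ij: "i \<noteq> j" using lack i by auto
    have P3: "P ^ 3 = P * (P * P)" by (simp add: power3_eq_cube)
    have aP: "1 \<le> a" "a \<le> P" using a by auto
    \<comment> \<open>Otherwise the sizes other than \<open>a\<close> contribute at most
      \<open>P ^ 3\<close> to the load of \<open>j\<close>, while size \<open>a\<close> contributes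
      less than half of \<open>c j\<close>. This contradicts
      \<open>4 * P ^ 3 \<le> c j\<close>.\<close>
    have "\<exists>l\<in>{1..P}-{a}. a \<le> y j l"
    proof (rule ccontr)
      assume "\<not> ?thesis"
      then have "y j v < a" if "v \<in> {1..P}-{a}" for v
        using that by (meson not_le)
      then have "v \<le> P \<and> y j v \<le> P" if "v \<in> {1..P}-{a}" for v
        using aP that by (metis DiffD1 atLeastAtMost_iff less_imp_le order.trans)
      then have "(\<Sum>v\<in>{1..P}-{a}. v * y j v) \<le> (\<Sum>v\<in>{1..P}-{a}. P * P)"
        by (intro sum_mono mult_le_mono) blast+
      also have "\<dots> \<le> P * (P * P)" using a by simp
      finally have "c j \<le> a * y j a + P ^ 3"
        using y j load_remove[OF a, of "y j"] by (simp add: ok_def P3)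
      moreover have "a * y j a \<le> P * (a * y j a)" using P by simp
      ultimately show False using lack big[OF j] by linarith
    qed
    then obtain l where l: "l \<in> {1..P}" "l \<noteq> a" "a \<le> y j l" by blast
    have lP: "1 \<le> l" "l \<le> P" using l by auto
    have "P * (a * l) \<le> P ^ 3" unfolding P3 using lP aP by (intro mult_le_mono) auto
    then have lc: "4 * (P * (a * l)) \<le> c i" using big[OF i(1)] by linarith
    then have "P * (a * l) \<le> P * (a * y i a)" using i(2) by linarith
    then have ly: "l \<le> y i a" using P aP by simp
    define z where "z = y(j := (y j)(l := y j l - a, a := y j a + l),
                           i := (y i)(l := y i l + a, a := y i a - l))"
    have two: "(\<Sum>u\<in>I. g u) = g i + g j + (\<Sum>u\<in>I-{i}-{j}. g u)" for g :: "nat \<Rightarrow> nat"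
      using fin i j ij by (simp add: sum.remove[of I i] sum.remove[of "I - {i}" j])
    have twol: "load P w = a * w a + l * w l + (\<Sum>v\<in>{1..P}-{a}-{l}. v * w v)" for w
      using a l sum.remove[of "{1..P} - {a}" l "\<lambda>v. v * w v"] by (simp add: load_remove[OF a])
    have loads: "load P (z u) = load P (y u)" for u
    proof -
      have "load P (z j) = load P (y j)"
      proof -
        have "(\<Sum>v\<in>{1..P}-{a}-{l}. v * z j v) = (\<Sum>v\<in>{1..P}-{a}-{l}. v * y j v)"
          using ij by (intro sum.cong) (auto simp: z_def)
        moreover have "a * (y j a + l) + l * (y j l - a) = a * y j a + l * y j l"
          using l(3) by (simp add: distrib_left diff_mult_distrib2 mult.commute[of l a])
        ultimately show ?thesis unfolding twol using ij l by (simp add: z_def)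
      qed
      moreover have "load P (z i) = load P (y i)"
      proof -
        have "(\<Sum>v\<in>{1..P}-{a}-{l}. v * z i v) = (\<Sum>v\<in>{1..P}-{a}-{l}. v * y i v)"
          using ij by (intro sum.cong) (auto simp: z_def)
        moreover have "a * (y i a - l) + l * (y i l + a) = a * y i a + l * y i l"
          using ly by (simp add: distrib_left diff_mult_distrib2 mult.commute[of l a])
        ultimately show ?thesis unfolding twol using ij l by (simp add: z_def)
      qed
      moreover have "z u = y u" if "u \<noteq> i" "u \<noteq> j" using that by (simp add: z_def)
      ultimately show ?thesis by metis
    qed
    have sums: "(\<Sum>u\<in>I. z u v) = (\<Sum>u\<in>I. y u v)" for v
    proof -
      have "(\<Sum>u\<in>I-{i}-{j}. z u v) = (\<Sum>u\<in>I-{i}-{j}. y u v)"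
        by (intro sum.cong) (auto simp: z_def)
      moreover have "z i v + z j v = y i v + y j v"
        using ij l ly by (auto simp: z_def)
      ultimately show ?thesis unfolding two by simp
    qed
    have "ok z" using y loads sums by (simp add: ok_def)
    then have "df y \<le> df z" by (rule min)
    moreover have "df z < df y"
    proof -
      have "(\<Sum>u\<in>I-{i}-{j}. c u - 2 * P * (a * z u a)) = (\<Sum>u\<in>I-{i}-{j}. c u - 2 * P * (a * y u a))"
        by (intro sum.cong) (auto simp: z_def)
      moreover have "c i - 2 * P * (a * z i a) = 0"
      proof -
        have "a * z i a = a * y i a - a * l" using ij l by (simp add: z_def diff_mult_distrib2)
        then have "P * (a * z i a) = P * (a * y i a) - P * (a * l)" by (simp add: diff_mult_distrib2)
        then have "c i \<le> 2 * (P * (a * z i a))" using i(2) lc by linarith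
        then show ?thesis by simp
      qed
      moreover have "c j - 2 * P * (a * z j a) < c j - 2 * P * (a * y j a)"
      proof -
        have "P * (a * y j a) < P * (a * z j a)" using ij l lP aP P by (simp add: z_def)
        then have "2 * P * (a * y j a) < 2 * P * (a * z j a)" by simp
        then show ?thesis using lack by linarith
      qed
      ultimately show ?thesis unfolding df_def two by simp
    qed
    ultimately show False by simp
  qed
  with y a show ?thesis unfolding ok_def by blast
qed

text \<open>The second component remembers the real machine; the reconstruction of an assignment
  reads it off.\<close>

definition virtual_machines :: "nat \<Rightarrow> nat \<Rightarrow> (nat \<Rightarrow> nat) \<Rightarrow> nat \<Rightarrow> (nat \<times> nat) list" where
  "virtual_machines h b c m = concat (map (\<lambda>i. map (\<lambda>\<kappa>. (\<kappa>, i)) (parts h b (c i))) [1..<m+1])"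

lemma virtual_machines_Suc:
  "virtual_machines h b c (Suc m) =
     virtual_machines h b c m @ map (\<lambda>\<kappa>. (\<kappa>, Suc m)) (parts h b (c (Suc m)))"
  by (simp add: virtual_machines_def)

lemma virtual_machines_0: "virtual_machines h b c 0 = []"
  by (simp add: virtual_machines_def)

lemma virtual_machines_sum:
  "(\<Sum>y\<leftarrow>filter (\<lambda>y. snd y = i) (virtual_machines h b c m). fst y) = (if i \<in> {1..m} then c i else 0)"
proof (induction m)
  case (Suc m)
  have "filter (\<lambda>y. snd y = i) (map (\<lambda>\<kappa>. (\<kappa>, j)) ks) = (if i = j then map (\<lambda>\<kappa>. (\<kappa>, j)) ks else [])" for j and ks :: "nat list"
    by (induction ks) auto
  then show ?case using Suc by (auto simp: virtual_machines_Suc sum_list_parts o_def)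
qed (simp add: virtual_machines_0)

lemma virtual_machines_less:
  "0 < b \<Longrightarrow> b < h \<Longrightarrow> y \<in> set (virtual_machines h b c m) \<Longrightarrow> fst y < h \<and> snd y \<in> {1..m}"
  by (auto simp: virtual_machines_def dest: parts_less)

lemma length_virtual_machines:
  assumes "\<And>i. i \<in> {1..m} \<Longrightarrow> c i \<le> B"
  shows "length (virtual_machines h b c m) \<le> m * (B + 1)"
  using assms
proof (induction m)
  case (Suc m)
  then have "length (virtual_machines h b c m) \<le> m * (B + 1)" by simp
  moreover have "length (parts h b (c (Suc m))) \<le> B + 1"
    using length_parts[of h b "c (Suc m)"] Suc.prems[of "Suc m"] by simp
  ultimately show ?case by (simp add: virtual_machines_Suc)
qed (simp add: virtual_machines_0)

lemma length_virtual_machines_pos: "1 \<le> m \<Longrightarrow> 1 \<le> length (virtual_machines h b c m)"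
proof (cases m)
  case (Suc k)
  then show ?thesis by (subst Suc, unfold virtual_machines_Suc, subst parts.simps) auto
qed simp

lemma sum_list_reduce:
  fixes ws :: "nat list"
  assumes "A \<le> sum_list ws"
  shows "\<exists>us. length us = length ws \<and> (\<forall>j<length ws. us ! j \<le> ws ! j) \<and> sum_list us = A"
  using assms
proof (induction ws arbitrary: A)
  case (Cons w ws)
  have "A - w \<le> sum_list ws" using Cons.prems by simp
  from Cons.IH[OF this] obtain us where
    us: "length us = length ws" "\<forall>j<length ws. us ! j \<le> ws ! j" "sum_list us = A - w" by blast
  then show ?case
    by (intro exI[of _ "min A w # us"]) (auto simp: nth_Cons split: nat.splits)
qed auto

text \<open>Discards filler jobs again. The coordinates are independent, so each one is an instance
  of \<open>sum_list_reduce\<close>.\<close>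

lemma reduce_vectors:
  fixes zs :: "('v \<Rightarrow> nat) list"
  assumes "\<And>v. N v \<le> (\<Sum>z\<leftarrow>zs. z v)"
  shows "\<exists>ys. length ys = length zs \<and> (\<forall>j<length zs. \<forall>v. (ys ! j) v \<le> (zs ! j) v) \<and> (\<forall>v. (\<Sum>y\<leftarrow>ys. y v) = N v)"
proof -
  have "\<forall>v. \<exists>us. length us = length zs \<and> (\<forall>j<length zs. us ! j \<le> (zs ! j) v) \<and> sum_list us = N v"
    using sum_list_reduce[OF assms] by simp
  then obtain us where us: "\<And>v. length (us v) = length zs"
    "\<And>v j. j < length zs \<Longrightarrow> us v ! j \<le> (zs ! j) v" "\<And>v. sum_list (us v) = N v" by metis
  define ys where "ys = map (\<lambda>j v. us v ! j) [0..<length zs]"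
  have "map (\<lambda>y. y v) ys = us v" for v
    by (intro nth_equalityI) (auto simp: ys_def us(1))
  then show ?thesis using us by (intro exI[of _ ys]) (auto simp: ys_def)
qed

lemma virtual_packing_exact:
  assumes "\<And>i. i \<in> {1..m} \<Longrightarrow> \<exists>zs. map (load P) zs = parts h b (c i) \<and> (\<forall>v. (\<Sum>z\<leftarrow>zs. z v) = x i v)"
  shows "\<exists>zs. map (load P) zs = map fst (virtual_machines h b c m) \<and>
    (\<forall>v. (\<Sum>z\<leftarrow>zs. z v) = (\<Sum>i=1..m. x i v))"
  using assms
proof (induction m)
  case (Suc m)
  then obtain zs where zs: "map (load P) zs = map fst (virtual_machines h b c m)"
    "\<And>v. (\<Sum>z\<leftarrow>zs. z v) = (\<Sum>i=1..m. x i v)" by fastforce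
  from Suc.prems[of "Suc m"] obtain ys where
    ys: "map (load P) ys = parts h b (c (Suc m))" "\<And>v. (\<Sum>z\<leftarrow>ys. z v) = x (Suc m) v" by auto
  show ?case using zs ys
    by (intro exI[of _ "zs @ ys"]) (auto simp: virtual_machines_Suc o_def)
qed (simp add: virtual_machines_0)

text \<open>Completeness of the splitting. Exact loads are kept while machines are filled,
  rebalanced and cut; removing the filler jobs at the end turns equality with the capacities into an
  inequality.\<close>

lemma virtual_packing:
  fixes x :: "nat \<Rightarrow> nat \<Rightarrow> nat"
  assumes P: "1 \<le> P" and lx: "\<And>i. i \<in> {1..m} \<Longrightarrow> load P (x i) \<le> c i"
  shows "\<exists>a\<in>{1..P}. \<exists>zs. length zs = length (virtual_machines (4 * P ^ 3) (a * (2 * P\<^sup>2)) c m) \<and>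
    (\<forall>u<length zs. load P (zs ! u) \<le> fst (virtual_machines (4 * P ^ 3) (a * (2 * P\<^sup>2)) c m ! u)) \<and>
    (\<forall>v. (\<Sum>z\<leftarrow>zs. z v) = (\<Sum>i=1..m. x i v))"
proof -
  define X where "X i = (x i)(1 := x i 1 + (c i - load P (x i)))" for i
  have one: "1 \<in> {1..P}" using P by simp
  have LX: "load P (X i) = c i" if "i \<in> {1..m}" for i
  proof -
    have "(\<Sum>v\<in>{1..P}-{1}. v * X i v) = (\<Sum>v\<in>{1..P}-{1}. v * x i v)"
      by (intro sum.cong) (auto simp: X_def)
    then show ?thesis using lx[OF that] load_remove[OF one, of "x i"] load_remove[OF one, of "X i"]
      by (simp add: X_def)
  qed
  define I where "I = {i\<in>{1..m}. 4 * P ^ 3 \<le> c i}"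
  have "\<exists>a\<in>{1..P}. \<exists>y. (\<forall>i\<in>I. load P (y i) = c i) \<and> (\<forall>v. (\<Sum>i\<in>I. y i v) = (\<Sum>i\<in>I. X i v)) \<and>
    (\<forall>i\<in>I. c i \<le> 2 * P * (a * y i a))"
    by (rule redistribute_frequent) (use P LX in \<open>auto simp: I_def\<close>)
  then obtain a y where a: "a \<in> {1..P}" and y: "\<And>i. i \<in> I \<Longrightarrow> load P (y i) = c i"
    "\<And>v. (\<Sum>i\<in>I. y i v) = (\<Sum>i\<in>I. X i v)" "\<And>i. i \<in> I \<Longrightarrow> c i \<le> 2 * P * (a * y i a)" by blast
  define Y where "Y i = (if i \<in> I then y i else X i)" for i
  have sumY: "(\<Sum>i=1..m. Y i v) = (\<Sum>i=1..m. X i v)" for v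
  proof -
    have IA: "I \<subseteq> {1..m}" "finite {1..m}" by (auto simp: I_def)
    have "(\<Sum>i=1..m. Y i v) = (\<Sum>i\<in>{1..m}-I. Y i v) + (\<Sum>i\<in>I. Y i v)"
      using IA by (rule sum.subset_diff)
    also have "(\<Sum>i\<in>{1..m}-I. Y i v) = (\<Sum>i\<in>{1..m}-I. X i v)"
      by (intro sum.cong) (auto simp: Y_def)
    also have "(\<Sum>i\<in>I. Y i v) = (\<Sum>i\<in>I. X i v)" using y(2)[of v] by (simp add: Y_def)
    also have "(\<Sum>i\<in>{1..m}-I. X i v) + (\<Sum>i\<in>I. X i v) = (\<Sum>i=1..m. X i v)"
      using IA by (rule sum.subset_diff[symmetric])
    finally show ?thesis .
  qed
  \<comment> \<open>With \<open>q = 2 * P\<^sup>2\<close> the threshold \<open>2 * P * q\<close> of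
    \<open>split_off_part\<close> equals the one of \<open>redistribute_frequent\<close>.\<close>
  have h: "2 * P * (2 * P\<^sup>2) = 4 * P ^ 3" by (simp add: power2_eq_square power3_eq_cube)
  have pieces: "\<exists>zs. map (load P) zs = parts (2 * P * (2 * P\<^sup>2)) (a * (2 * P\<^sup>2)) (c i) \<and> (\<forall>v. (\<Sum>z\<leftarrow>zs. z v) = Y i v)"
    if i: "i \<in> {1..m}" for i
  proof (rule split_into_parts[OF a])
    show "load P (Y i) = c i" using LX[OF i] y(1) by (simp add: Y_def)
    assume "2 * P * (2 * P\<^sup>2) \<le> c i"
    then have "i \<in> I" using i h by (simp add: I_def)
    then have "P * c i \<le> P * (2 * P * (a * Y i a))" using y(3) by (simp add: Y_def)
    then show "P * c i \<le> Y i a * (a * (2 * P\<^sup>2))" by (simp add: power2_eq_square ac_simps)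
  qed simp
  have "\<exists>zs. map (load P) zs = map fst (virtual_machines (4 * P ^ 3) (a * (2 * P\<^sup>2)) c m) \<and>
    (\<forall>v. (\<Sum>z\<leftarrow>zs. z v) = (\<Sum>i=1..m. Y i v))"
    unfolding h[symmetric] by (rule virtual_packing_exact, rule pieces)
  then obtain zs where zs: "map (load P) zs = map fst (virtual_machines (4 * P ^ 3) (a * (2 * P\<^sup>2)) c m)"
    "\<And>v. (\<Sum>z\<leftarrow>zs. z v) = (\<Sum>i=1..m. Y i v)" by blast
  have "(\<Sum>i=1..m. x i v) \<le> (\<Sum>z\<leftarrow>zs. z v)" for v
    unfolding zs(2) sumY by (intro sum_mono) (auto simp: X_def)
  from reduce_vectors[OF this] obtain ys where ys: "length ys = length zs"
    "\<And>j v. j < length zs \<Longrightarrow> (ys ! j) v \<le> (zs ! j) v" "\<forall>v. (\<Sum>y\<leftarrow>ys. y v) = (\<Sum>i=1..m. x i v)" by blast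
  have len: "length zs = length (virtual_machines (4 * P ^ 3) (a * (2 * P\<^sup>2)) c m)"
    using arg_cong[OF zs(1), of length] by simp
  have "load P (ys ! u) \<le> fst (virtual_machines (4 * P ^ 3) (a * (2 * P\<^sup>2)) c m ! u)" if u: "u < length zs" for u
  proof -
    have "load P (ys ! u) \<le> load P (zs ! u)" using ys(2)[OF u] by (rule load_mono)
    also have "\<dots> = map (load P) zs ! u" using u by simp
    also have "\<dots> = fst (virtual_machines (4 * P ^ 3) (a * (2 * P\<^sup>2)) c m ! u)"
      unfolding zs(1) using u len by simp
    finally show ?thesis .
  qed
  then show ?thesis using a ys len by (intro bexI[OF _ a] exI[of _ ys]) auto
qed

section \<open>Interleaving the machines\<close>

definition kind :: "nat list \<Rightarrow> nat \<Rightarrow> nat set" where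
  "kind K \<kappa> = {u. u < length K \<and> K ! u = \<kappa>}"

definition rank :: "nat list \<Rightarrow> nat \<Rightarrow> nat" where
  "rank K u = card {w \<in> kind K (K ! u). w \<le> u}"

text \<open>The ideal position of the r-th of \<open>m\<close> equal machines among
  \<open>length K\<close> machines is \<open>r * length K / m\<close>; it is rounded down.\<close>

definition slot :: "nat list \<Rightarrow> nat \<Rightarrow> nat" where
  "slot K u = rank K u * length K div card (kind K (K ! u))"

text \<open>A bucket sort by \<open>slot\<close>. Slots lie between 0 and \<open>length K\<close>
  inclusive, hence the extra bucket.\<close>

definition spread_order :: "nat list \<Rightarrow> nat list" where
  "spread_order K = concat (map (\<lambda>t. filter (\<lambda>u. slot K u = t) [0..<length K]) [0..<length K + 1])"

lemma finite_kind [simp]: "finite (kind K \<kappa>)"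
  by (simp add: kind_def)

lemma card_less_filter:
  fixes A :: "nat set"
  assumes "finite A"
  shows "bij_betw (\<lambda>u. card {w\<in>A. w \<le> u}) A {1..card A}"
proof -
  let ?r = "\<lambda>u. card {w\<in>A. w \<le> u}"
  have mono: "?r u < ?r w" if "u < w" "w \<in> A" for u w
  proof (rule psubset_card_mono)
    show "{v\<in>A. v \<le> u} \<subset> {v\<in>A. v \<le> w}"
    proof (rule psubsetI)
      have "w \<in> {v\<in>A. v \<le> w} - {v\<in>A. v \<le> u}" using that by simp
      then show "{v\<in>A. v \<le> u} \<noteq> {v\<in>A. v \<le> w}" by blast
    qed (use that in auto)
  qed (use assms in simp)
  have inj: "inj_on ?r A" by (rule linorder_inj_onI) (use mono in \<open>auto simp: less_imp_neq\<close>)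
  have "?r ` A \<subseteq> {1..card A}"
  proof
    fix k assume "k \<in> ?r ` A"
    then obtain u where u: "u \<in> A" "k = ?r u" by blast
    have "{u} \<subseteq> {w\<in>A. w \<le> u}" using u by auto
    from card_mono[OF _ this] assms have "1 \<le> ?r u" by simp
    moreover have "?r u \<le> card A" using assms by (intro card_mono) auto
    ultimately show "k \<in> {1..card A}" using u by simp
  qed
  moreover have "card (?r ` A) = card {1..card A}" using inj by (simp add: card_image)
  ultimately have "?r ` A = {1..card A}" by (intro card_subset_eq) auto
  with inj show ?thesis by (simp add: bij_betw_def)
qed

lemma rank_bij: "bij_betw (rank K) (kind K \<kappa>) {1..card (kind K \<kappa>)}"
proof -
  have "bij_betw (rank K) (kind K \<kappa>) {1..card (kind K \<kappa>)} \<longleftrightarrow>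
    bij_betw (\<lambda>u. card {w\<in>kind K \<kappa>. w \<le> u}) (kind K \<kappa>) {1..card (kind K \<kappa>)}"
    by (intro bij_betw_cong) (auto simp: rank_def kind_def)
  then show ?thesis using card_less_filter[of "kind K \<kappa>"] by simp
qed

lemma slot_le:
  assumes "u < length K"
  shows "slot K u \<le> length K"
proof -
  have u: "u \<in> kind K (K ! u)" using assms by (simp add: kind_def)
  then have "rank K u \<le> card (kind K (K ! u))" using rank_bij[of K "K ! u"] by (auto simp: bij_betw_def)
  then have "slot K u \<le> card (kind K (K ! u)) * length K div card (kind K (K ! u))"
    unfolding slot_def by (intro div_le_mono mult_right_mono) auto
  also have "\<dots> = length K" using u by (auto simp: card_gt_0_iff)
  finally show ?thesis .
qed

lemma sorted_concat_filter:
  fixes f :: "nat \<Rightarrow> nat"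
  shows "sorted (map f (concat (map (\<lambda>t. filter (\<lambda>u. f u = t) xs) [0..<n])))"
proof (induction n)
  case (Suc n)
  have "sorted (map f (filter (\<lambda>u. f u = n) xs))"
    by (induction xs) auto
  with Suc show ?case by (auto simp: sorted_append)
qed simp

lemma distinct_concat_filter:
  fixes f :: "nat \<Rightarrow> nat"
  shows "distinct xs \<Longrightarrow> distinct (concat (map (\<lambda>t. filter (\<lambda>u. f u = t) xs) [0..<n]))"
  by (induction n) auto

lemma sorted_spread_order: "sorted (map (slot K) (spread_order K))"
  unfolding spread_order_def by (rule sorted_concat_filter)

lemma distinct_spread_order: "distinct (spread_order K)"
  unfolding spread_order_def by (rule distinct_concat_filter) simp

lemma set_spread_order: "set (spread_order K) = {..<length K}"
  using slot_le by (auto simp: spread_order_def not_less intro: le_antisym)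

lemma length_spread_order: "length (spread_order K) = length K"
  using distinct_card[OF distinct_spread_order, of K] by (simp add: set_spread_order)

section \<open>Proportionality of initial segments\<close>

definition seen :: "nat list \<Rightarrow> nat \<Rightarrow> nat \<Rightarrow> nat" where
  "seen K k \<kappa> = card {u \<in> set (take k (spread_order K)). K ! u = \<kappa>}"

lemma set_take_spread: "set (take k (spread_order K)) \<subseteq> {..<length K}"
  using set_take_subset[of k "spread_order K"] set_spread_order by blast

lemma seen_0: "seen K 0 \<kappa> = 0"
  by (simp add: seen_def)

lemma seen_Suc:
  assumes "k < length K"
  shows "seen K (Suc k) \<kappa> = seen K k \<kappa> + (if K ! (spread_order K ! k) = \<kappa> then 1 else 0)"
proof -
  let ?s = "spread_order K"
  have k: "k < length ?s" using assms by (simp add: length_spread_order)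
  have t: "take (Suc k) ?s = take k ?s @ [?s ! k]" using k by (rule take_Suc_conv_app_nth)
  have "distinct (take (Suc k) ?s)" by (intro distinct_take distinct_spread_order)
  then have "?s ! k \<notin> set (take k ?s)" unfolding t by simp
  moreover have "{u \<in> set (take (Suc k) ?s). K ! u = \<kappa>} =
    (if K ! (?s ! k) = \<kappa> then insert (?s ! k) {u \<in> set (take k ?s). K ! u = \<kappa>}
     else {u \<in> set (take k ?s). K ! u = \<kappa>})" unfolding t by auto
  ultimately show ?thesis by (simp add: seen_def)
qed

lemma seen_length: "seen K (length K) \<kappa> = card (kind K \<kappa>)"
  using length_spread_order[of K] set_spread_order[of K] by (simp add: seen_def kind_def)

lemma seen_le: "seen K k \<kappa> \<le> card (kind K \<kappa>)"
  unfolding seen_def using set_take_spread by (intro card_mono) (auto simp: kind_def)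

lemma seen_less: "k < length K \<Longrightarrow> K ! (spread_order K ! k) = \<kappa> \<Longrightarrow> seen K k \<kappa> < card (kind K \<kappa>)"
  using seen_Suc[of k K \<kappa>] seen_le[of K "Suc k" \<kappa>] by simp

lemma sum_seen:
  assumes "finite S" "set K \<subseteq> S" "k \<le> length K"
  shows "(\<Sum>\<kappa>\<in>S. seen K k \<kappa>) = k"
  using assms(3)
proof (induction k)
  case (Suc k)
  have "spread_order K ! k \<in> set (spread_order K)" using Suc.prems by (simp add: length_spread_order)
  then have "K ! (spread_order K ! k) \<in> S" using set_spread_order assms(2) by (auto dest: nth_mem)
  then show ?case using Suc assms(1) by (simp add: seen_Suc sum.distrib)
qed (simp add: seen_0)

text \<open>These \<open>r\<close> form an initial segment of \<open>{1..m}\<close>, so its last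
  element and the one after it bracket \<open>t * m / M\<close>.\<close>

lemma card_rank_less:
  assumes "0 < M"
  shows "t * m \<le> (card {r\<in>{1..m}. r * M < t * m} + 1) * M \<or> m = card {r\<in>{1..m}. r * M < t * m}"
    and "card {r\<in>{1..m}. r * M < t * m} * M \<le> t * (m::nat)"
proof -
  let ?S = "{r\<in>{1..m}. r * M < t * m}"
  have fin: "finite ?S" by simp
  have down: "?S = {1..card ?S}"
  proof (cases "?S = {}")
    case False
    define x where "x = Max ?S"
    have x: "x \<in> ?S" unfolding x_def using fin False by (rule Max_in)
    have "?S = {1..x}"
    proof
      show "?S \<subseteq> {1..x}" using fin by (auto simp: x_def)
      show "{1..x} \<subseteq> ?S"
      proof
        fix r assume r: "r \<in> {1..x}"
        then have "r * M \<le> x * M" by simp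
        also have "\<dots> < t * m" using x by simp
        finally show "r \<in> ?S" using r x by auto
      qed
    qed
    then show ?thesis by simp
  qed simp
  have "card ?S + 1 \<notin> ?S" by (subst down) simp
  then have a: "m < card ?S + 1 \<or> t * m \<le> (card ?S + 1) * M" by auto
  have "card ?S \<le> card {1..m}" by (intro card_mono) auto
  then have "card ?S \<le> m" by simp
  with a show "t * m \<le> (card ?S + 1) * M \<or> m = card ?S" by linarith
  show "card ?S * M \<le> t * m"
  proof (cases "card ?S = 0")
    case False
    then have "card ?S \<in> {1..card ?S}" unfolding atLeastAtMost_iff by linarith
    then have "card ?S \<in> ?S" by (rule subsetD[OF equalityD2[OF down]])
    then show ?thesis by simp
  next
    case True
    then show ?thesis by (simp only: mult_0 le0)
  qed
qed

text \<open>Let \<open>t\<close> be the slot of the next machine. The first \<open>k\<close>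
  machines contain every machine with slot below \<open>t\<close> and none with slot above
  \<open>t\<close>, so all kinds are compared with the same time \<open>t\<close>.\<close>

lemma seen_spread:
  assumes k: "k \<le> length K"
  shows "\<exists>t. \<forall>\<kappa>. \<bar>int (seen K k \<kappa>) * int (length K) - int t * int (card (kind K \<kappa>))\<bar> \<le> int (length K)"
proof (cases "k = length K")
  case True
  then show ?thesis by (intro exI[of _ "length K"]) (auto simp: seen_length)
next
  case False
  let ?s = "spread_order K"
  let ?M = "length K"
  define t where "t = slot K (?s ! k)"
  have kl: "k < length ?s" using k False by (simp add: length_spread_order)
  have M: "0 < ?M" using k False by linarith
  have before: "slot K u \<le> t" if "u \<in> set (take k ?s)" for u
  proof -
    from that obtain j where j: "j < k" "u = ?s ! j" by (auto simp: in_set_conv_nth)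
    then show ?thesis using sorted_nth_mono[OF sorted_spread_order[of K], of j k] kl by (simp add: t_def)
  qed
  have after: "u \<in> set (take k ?s)" if u: "u < ?M" "slot K u < t" for u
  proof -
    have "u \<in> set ?s" using u by (simp add: set_spread_order)
    then obtain j where j: "j < length ?s" "u = ?s ! j" by (auto simp: in_set_conv_nth)
    have "j < k"
    proof (rule ccontr)
      assume "\<not> j < k"
      then have "t \<le> slot K u"
        using sorted_nth_mono[OF sorted_spread_order[of K], of k j] j by (simp add: t_def)
      then show False using u by simp
    qed
    then show ?thesis using j by (auto simp: in_set_conv_nth intro!: exI[of _ j])
  qed
  have "\<bar>int (seen K k \<kappa>) * int ?M - int t * int (card (kind K \<kappa>))\<bar> \<le> int ?M" for \<kappa>
  proof -
    let ?m = "card (kind K \<kappa>)"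
    have bc: "card {u\<in>kind K \<kappa>. slot K u < t'} = card {r\<in>{1..?m}. r * ?M < t' * ?m}" for t'
    proof -
      have "bij_betw (rank K) {u\<in>kind K \<kappa>. rank K u * ?M < t' * ?m} {r\<in>{1..?m}. r * ?M < t' * ?m}"
        using rank_bij[of K \<kappa>] unfolding bij_betw_def inj_on_def by auto
      moreover have "{u\<in>kind K \<kappa>. rank K u * ?M < t' * ?m} = {u\<in>kind K \<kappa>. slot K u < t'}"
      proof (rule Collect_cong, rule conj_cong[OF refl])
        fix u assume u: "u \<in> kind K \<kappa>"
        then have "0 < ?m" by (auto simp: card_gt_0_iff)
        moreover have "K ! u = \<kappa>" using u by (simp add: kind_def)
        ultimately show "rank K u * ?M < t' * ?m \<longleftrightarrow> slot K u < t'"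
          by (simp add: slot_def div_less_iff_less_mult)
      qed
      ultimately show ?thesis by (auto dest: bij_betw_same_card)
    qed
    let ?A = "card {u\<in>kind K \<kappa>. slot K u < t}" and ?B = "card {u\<in>kind K \<kappa>. slot K u < t + 1}"
    have A: "?A \<le> seen K k \<kappa>"
      unfolding seen_def using after by (intro card_mono) (auto simp: kind_def)
    have B: "seen K k \<kappa> \<le> ?B"
      unfolding seen_def using before set_take_spread[of k K]
      by (intro card_mono) (auto simp: kind_def less_Suc_eq_le)
    have "t * ?m \<le> (?A + 1) * ?M \<or> ?m = ?A" unfolding bc by (rule card_rank_less(1)[OF M])
    moreover have "(?A + 1) * ?M \<le> (seen K k \<kappa> + 1) * ?M" using A by simp
    ultimately have lo: "t * ?m \<le> (seen K k \<kappa> + 1) * ?M \<or> ?m = seen K k \<kappa>"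
      using A seen_le[of K k \<kappa>] by linarith
    have "?B * ?M \<le> (t + 1) * ?m" unfolding bc by (rule card_rank_less(2)[OF M])
    moreover have "seen K k \<kappa> * ?M \<le> ?B * ?M" using B by simp
    ultimately have hi: "seen K k \<kappa> * ?M \<le> (t + 1) * ?m" by linarith
    have mM: "?m \<le> ?M" using card_mono[of "{..<?M}" "kind K \<kappa>"] by (auto simp: kind_def)
    have "t \<le> ?M" using slot_le[of "?s ! k" K] nth_mem[OF kl] by (simp add: t_def set_spread_order)
    then have "t * ?m \<le> ?M * ?m" by simp
    then have "t * ?m \<le> ?m * ?M" by (simp only: mult.commute)
    then have "t * ?m \<le> seen K k \<kappa> * ?M + ?M"
      using lo by (elim disjE) (simp, metis trans_le_add1)
    moreover have "seen K k \<kappa> * ?M \<le> t * ?m + ?M" using hi mM by simp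
    ultimately have "int (t * ?m) \<le> int (seen K k \<kappa> * ?M + ?M)"
      "int (seen K k \<kappa> * ?M) \<le> int (t * ?m + ?M)" by linarith+
    then show ?thesis by simp
  qed
  then show ?thesis by blast
qed

text \<open>Summing the estimate of \<open>seen_spread\<close> over the \<open>h\<close> possible
  kinds shows that the common time \<open>t\<close> differs from \<open>k\<close> by at most
  \<open>h\<close>.\<close>

lemma seen_proportional:
  assumes k: "k \<le> length K" and h: "set K \<subseteq> {..<h}"
  shows "\<bar>int (seen K k \<kappa>) * int (length K) - int k * int (card (kind K \<kappa>))\<bar>
    \<le> int (length K) + int h * int (card (kind K \<kappa>))"
proof (cases "K = []")
  case True
  then show ?thesis using k by simp
next
  case False
  let ?M = "int (length K)"
  let ?m = "\<lambda>\<kappa>. int (card (kind K \<kappa>))"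
  from seen_spread[OF k] obtain t where
    t: "\<And>\<kappa>. \<bar>int (seen K k \<kappa>) * ?M - int t * ?m \<kappa>\<bar> \<le> ?M" by blast
  have s1: "(\<Sum>\<kappa><h. int (seen K k \<kappa>)) = int k"
    using sum_seen[of "{..<h}" K k] h k by (simp flip: of_nat_sum)
  have s2: "(\<Sum>\<kappa><h. ?m \<kappa>) = ?M"
    using sum_seen[of "{..<h}" K "length K"] h by (simp add: seen_length flip: of_nat_sum)
  have "(\<Sum>\<kappa><h. int (seen K k \<kappa>) * ?M - int t * ?m \<kappa>) = (int k - int t) * ?M"
    by (simp add: sum_subtractf flip: sum_distrib_right sum_distrib_left) (simp add: s1 s2 left_diff_distrib)
  moreover have "\<bar>\<Sum>\<kappa><h. int (seen K k \<kappa>) * ?M - int t * ?m \<kappa>\<bar> \<le> (\<Sum>\<kappa><h. ?M)"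
    by (rule order.trans[OF sum_abs sum_mono]) (rule t)
  ultimately have "\<bar>int k - int t\<bar> * ?M \<le> int h * ?M" by (simp add: abs_mult)
  then have kt: "\<bar>int k - int t\<bar> \<le> int h" using False by simp
  have "\<bar>(int t - int k) * ?m \<kappa>\<bar> \<le> int h * ?m \<kappa>"
    using kt by (simp add: abs_mult abs_minus_commute mult_right_mono)
  then have "\<bar>int t * ?m \<kappa> - int k * ?m \<kappa>\<bar> \<le> int h * ?m \<kappa>" by (simp add: left_diff_distrib)
  then show ?thesis using t[of \<kappa>] by linarith
qed

text \<open>Within a kind, the Steinitz order keeps partial sums near multiples of the mean, and
  \<open>seen_proportional\<close> controls how many vectors of the kind have been taken. In the
  factor \<open>P + 2\<close>, the summand \<open>P\<close> is the Steinitz dimension; rounding of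
  slots and the passage from slots to positions add one each.\<close>

lemma spread_prefix_bound:
  fixes z :: "nat \<Rightarrow> nat \<Rightarrow> nat"
  assumes h: "set K \<subseteq> {..<h}" and lz: "\<And>u. u < length K \<Longrightarrow> load P (z u) \<le> K ! u"
  shows "\<exists>w. (\<forall>k<length K. load P (w k) \<le> K ! (spread_order K ! k)) \<and>
    (\<forall>v. (\<Sum>j<length K. w j v) = (\<Sum>u<length K. z u v)) \<and>
    (\<forall>k\<le>length K. \<forall>v\<in>{1..P}. \<bar>real (\<Sum>j<k. w j v) * length K - real k * (\<Sum>u<length K. z u v)\<bar>
       \<le> (real P + 2) * h\<^sup>2 * length K)"
proof (cases "K = []")
  case True
  then show ?thesis by auto
next
  case False
  let ?M = "length K"
  let ?m = "\<lambda>\<kappa>. card (kind K \<kappa>)"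
  define X where "X \<kappa> v = (\<Sum>u\<in>kind K \<kappa>. z u v)" for \<kappa> v
  define f where "f \<kappa> u v = real (z u v) - real (X \<kappa> v) / ?m \<kappa>" for \<kappa> u v
  have zh: "z u v \<le> h" if "u < ?M" "v \<in> {1..P}" for u v
  proof -
    have "z u v \<le> v * z u v" using that by simp
    also have "\<dots> \<le> load P (z u)" using that(2) by (rule mult_le_load)
    also have "\<dots> \<le> h" using lz[OF that(1)] h nth_mem[OF that(1)] by fastforce
    finally show ?thesis .
  qed
  have Xh: "X \<kappa> v \<le> ?m \<kappa> * h" if "v \<in> {1..P}" for \<kappa> v
    using sum_bounded_above[of "kind K \<kappa>" "\<lambda>u. z u v" h] zh that by (simp add: X_def kind_def)
  have "\<exists>xs. distinct xs \<and> set xs = kind K \<kappa> \<and>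
    (\<forall>k. \<forall>v\<in>{1..P}. \<bar>\<Sum>u\<in>set (take k xs). f \<kappa> u v\<bar> \<le> card {1..P} * real h)" for \<kappa>
  proof (rule steinitz_order)
    show "\<forall>u\<in>kind K \<kappa>. \<forall>v\<in>{1..P}. \<bar>f \<kappa> u v\<bar> \<le> real h"
    proof (intro ballI)
      fix u v assume u: "u \<in> kind K \<kappa>" and v: "v \<in> {1..P}"
      have "real (X \<kappa> v) \<le> real (?m \<kappa>) * real h"
        using Xh[OF v, of \<kappa>] by (metis of_nat_le_iff of_nat_mult)
      then have "real (X \<kappa> v) / ?m \<kappa> \<le> h" by (cases "?m \<kappa> = 0") (auto simp: divide_simps mult.commute)
      moreover have "0 \<le> real (X \<kappa> v) / ?m \<kappa>" by simp
      moreover have "z u v \<le> h" using zh u v by (simp add: kind_def)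
      then have "real (z u v) \<le> h" by simp
      ultimately show "\<bar>f \<kappa> u v\<bar> \<le> real h" unfolding f_def by linarith
    qed
    show "\<forall>v\<in>{1..P}. (\<Sum>u\<in>kind K \<kappa>. f \<kappa> u v) = 0"
    proof
      fix v assume v: "v \<in> {1..P}"
      have "real (X \<kappa> v) = 0" if "?m \<kappa> = 0" using Xh[OF v, of \<kappa>] that by simp
      then show "(\<Sum>u\<in>kind K \<kappa>. f \<kappa> u v) = 0"
        by (auto simp: f_def sum_subtractf X_def)
    qed
  qed auto
  then obtain xs where xs: "\<And>\<kappa>. distinct (xs \<kappa>)" "\<And>\<kappa>. set (xs \<kappa>) = kind K \<kappa>"
    "\<And>\<kappa> k v. v \<in> {1..P} \<Longrightarrow> \<bar>\<Sum>u\<in>set (take k (xs \<kappa>)). f \<kappa> u v\<bar> \<le> real P * h"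
    by (simp only: card_atLeastAtMost) (metis diff_Suc_1 diff_add_inverse2)
  have lxs: "length (xs \<kappa>) = ?m \<kappa>" for \<kappa>
    using distinct_card[OF xs(1)[of \<kappa>]] xs(2) by simp
  define \<kappa>s where "\<kappa>s k = K ! (spread_order K ! k)" for k
  define w where "w k = z (xs (\<kappa>s k) ! seen K k (\<kappa>s k))" for k
  have so: "spread_order K ! k < ?M" if "k < ?M" for k
    using nth_mem[of k "spread_order K"] that by (simp add: set_spread_order length_spread_order)
  have \<kappa>h: "\<kappa>s k < h" if "k < ?M" for k
    using nth_mem[OF so[OF that]] h by (auto simp: \<kappa>s_def)
  have lw: "load P (w k) \<le> \<kappa>s k" if k: "k < ?M" for k
  proof -
    have "seen K k (\<kappa>s k) < ?m (\<kappa>s k)" using seen_less[OF k] by (simp add: \<kappa>s_def)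
    then have "xs (\<kappa>s k) ! seen K k (\<kappa>s k) \<in> kind K (\<kappa>s k)"
      using nth_mem[of _ "xs (\<kappa>s k)"] lxs xs(2) by auto
    then show ?thesis using lz[of "xs (\<kappa>s k) ! seen K k (\<kappa>s k)"] by (simp add: w_def kind_def)
  qed
  have prefix: "(\<Sum>j<k. w j v) = (\<Sum>\<kappa><h. \<Sum>u\<in>set (take (seen K k \<kappa>) (xs \<kappa>)). z u v)"
    if "k \<le> ?M" for k v
    using that
  proof (induction k)
    case 0
    then show ?case by (simp add: seen_0)
  next
    case (Suc k)
    have step: "(\<Sum>u\<in>set (take (seen K (Suc k) \<kappa>) (xs \<kappa>)). z u v) =
      (\<Sum>u\<in>set (take (seen K k \<kappa>) (xs \<kappa>)). z u v) + (if \<kappa> = \<kappa>s k then w k v else 0)" for \<kappa>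
    proof (cases "\<kappa> = \<kappa>s k")
      case True
      let ?s = "seen K k \<kappa>"
      have s: "?s < length (xs \<kappa>)" using seen_less[of k K \<kappa>] Suc.prems True lxs by (simp add: \<kappa>s_def)
      have t: "take (Suc ?s) (xs \<kappa>) = take ?s (xs \<kappa>) @ [xs \<kappa> ! ?s]"
        using s by (rule take_Suc_conv_app_nth)
      have "distinct (take (Suc ?s) (xs \<kappa>))" by (intro distinct_take xs(1))
      then have "xs \<kappa> ! ?s \<notin> set (take ?s (xs \<kappa>))" unfolding t by simp
      moreover have "seen K (Suc k) \<kappa> = Suc ?s" using True Suc.prems by (simp add: seen_Suc \<kappa>s_def)
      ultimately have "(\<Sum>u\<in>set (take (seen K (Suc k) \<kappa>) (xs \<kappa>)). z u v) =
        (\<Sum>u\<in>set (take ?s (xs \<kappa>)). z u v) + z (xs \<kappa> ! ?s) v" by (simp add: t)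
      then show ?thesis using True by (simp add: w_def)
    next
      case False
      then show ?thesis using Suc.prems by (simp add: seen_Suc \<kappa>s_def)
    qed
    have "\<kappa>s k < h" using \<kappa>h Suc.prems by simp
    then show ?case using Suc by (simp add: step sum.distrib)
  qed
  have Xsum: "(\<Sum>\<kappa><h. X \<kappa> v) = (\<Sum>u<?M. z u v)" for v
  proof -
    have "(\<Sum>u<?M. z u v) = (\<Sum>\<kappa><h. \<Sum>u\<in>{u\<in>{..<?M}. K ! u = \<kappa>}. z u v)"
      using h by (intro sum.group[symmetric]) (auto dest: nth_mem)
    then show ?thesis by (simp add: X_def kind_def)
  qed
  have total: "(\<Sum>j<?M. w j v) = (\<Sum>u<?M. z u v)" for v
    unfolding prefix[OF order.refl] seen_length Xsum[symmetric]
    by (intro sum.cong) (auto simp: X_def lxs[symmetric] xs(2))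
  have "\<bar>real (\<Sum>j<k. w j v) * ?M - real k * (\<Sum>u<?M. z u v)\<bar> \<le> (real P + 2) * h\<^sup>2 * ?M"
    if k: "k \<le> ?M" and v: "v \<in> {1..P}" for k v
  proof -
    define d where "d \<kappa> = real (\<Sum>u\<in>set (take (seen K k \<kappa>) (xs \<kappa>)). z u v) * ?M - real k * X \<kappa> v" for \<kappa>
    have d: "\<bar>d \<kappa>\<bar> \<le> (real P + 1) * h * ?M + h * X \<kappa> v" for \<kappa>
    proof (cases "?m \<kappa> = 0")
      case True
      then have "kind K \<kappa> = {}" by simp
      moreover have "xs \<kappa> = []" using lxs[of \<kappa>] True by simp
      ultimately show ?thesis by (simp add: d_def X_def)
    next
      case False
      let ?T = "set (take (seen K k \<kappa>) (xs \<kappa>))"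
      have cT: "card ?T = seen K k \<kappa>"
        using distinct_card[OF distinct_take[OF xs(1), of "seen K k \<kappa>" \<kappa>]] seen_le[of K k \<kappa>] lxs by simp
      define g where "g = real (X \<kappa> v) / ?m \<kappa>"
      have g: "0 \<le> g" "g \<le> h" "g * ?m \<kappa> = X \<kappa> v"
      proof -
        have "real (X \<kappa> v) \<le> real (?m \<kappa>) * real h"
          using Xh[OF v, of \<kappa>] by (metis of_nat_le_iff of_nat_mult)
        then show "g \<le> h" using False by (simp add: g_def divide_simps mult.commute)
      qed (use False in \<open>auto simp: g_def\<close>)
      define F where "F = (\<Sum>u\<in>?T. f \<kappa> u v)"
      have F: "\<bar>F\<bar> \<le> real P * h" unfolding F_def by (rule xs(3)[OF v])
      have zF: "real (\<Sum>u\<in>?T. z u v) = F + seen K k \<kappa> * g"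
        by (simp add: F_def f_def sum_subtractf cT g_def)
      have "real_of_int \<bar>int (seen K k \<kappa>) * int ?M - int k * int (?m \<kappa>)\<bar> \<le> real_of_int (int ?M + int h * int (?m \<kappa>))"
        using seen_proportional[OF k h, of \<kappa>] by (simp only: of_int_le_iff)
      then have S: "\<bar>real (seen K k \<kappa>) * ?M - real k * ?m \<kappa>\<bar> \<le> ?M + real h * ?m \<kappa>" by simp
      \<comment> \<open>The error splits into the deviation from the mean within the kind and the
        error in the number of machines of the kind.\<close>
      have "d \<kappa> = F * ?M + (real (seen K k \<kappa>) * ?M - real k * ?m \<kappa>) * g"
        unfolding d_def zF g(3)[symmetric] by (simp add: algebra_simps)
      then have "\<bar>d \<kappa>\<bar> \<le> \<bar>F\<bar> * ?M + \<bar>real (seen K k \<kappa>) * ?M - real k * ?m \<kappa>\<bar> * g"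
        using g by (metis abs_mult abs_of_nat abs_of_nonneg abs_triangle_ineq)
      also have "\<dots> \<le> (real P * h) * ?M + (?M + real h * ?m \<kappa>) * g"
        using F S g by (intro add_mono mult_right_mono) auto
      also have "\<dots> = real P * h * ?M + ?M * g + h * (g * ?m \<kappa>)" by (simp add: algebra_simps)
      also have "\<dots> \<le> real P * h * ?M + ?M * h + h * (g * ?m \<kappa>)"
        using mult_left_mono[OF g(2), of "real ?M"] by simp
      finally show ?thesis unfolding g(3) by (simp add: algebra_simps)
    qed
    have "real (\<Sum>j<k. w j v) * ?M - real k * (\<Sum>u<?M. z u v) = (\<Sum>\<kappa><h. d \<kappa>)"
      unfolding prefix[OF k] Xsum[symmetric]
      by (simp add: d_def sum_subtractf sum_distrib_left sum_distrib_right)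
    also have "\<bar>\<dots>\<bar> \<le> (\<Sum>\<kappa><h. (real P + 1) * h * ?M + h * X \<kappa> v)"
      by (rule order.trans[OF sum_abs sum_mono]) (rule d)
    also have "\<dots> = h * ((real P + 1) * h * ?M) + h * (\<Sum>\<kappa><h. X \<kappa> v)"
      by (simp add: sum.distrib sum_distrib_left)
    also have "\<dots> \<le> h * ((real P + 1) * h * ?M) + h * (?M * h)"
    proof -
      have "(\<Sum>u<?M. z u v) \<le> ?M * h"
        using sum_bounded_above[of "{..<?M}" "\<lambda>u. z u v" h] zh v by simp
      then have "real (\<Sum>\<kappa><h. X \<kappa> v) \<le> real (?M * h)" unfolding Xsum by (simp only: of_nat_le_iff)
      then have "real h * (\<Sum>\<kappa><h. X \<kappa> v) \<le> h * real (?M * h)" by (rule mult_left_mono) simp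
      then show ?thesis by simp
    qed
    also have "\<dots> = (real P + 2) * h\<^sup>2 * ?M" by (simp add: algebra_simps power2_eq_square)
    finally show ?thesis .
  qed
  then show ?thesis using lw total by (intro exI[of _ w]) (auto simp: \<kappa>s_def)
qed

section \<open>Encoding of vectors\<close>

text \<open>Only sizes in \<open>V\<close> receive a digit, so there are \<open>B ^ card V\<close>
  codes instead of \<open>B ^ pm\<close>.\<close>

primrec radix :: "nat set \<Rightarrow> nat \<Rightarrow> nat \<Rightarrow> nat" where
  "radix V B 0 = 1"
| "radix V B (Suc v) = (if Suc v \<in> V then radix V B v * B else radix V B v)"

primrec digits :: "nat set \<Rightarrow> nat \<Rightarrow> nat \<Rightarrow> nat \<Rightarrow> nat \<Rightarrow> nat" where
  "digits V B 0 e = (\<lambda>_. 0)"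
| "digits V B (Suc v) e =
     (if Suc v \<in> V then (digits V B v (e mod radix V B v))(Suc v := e div radix V B v) else digits V B v e)"

primrec code :: "nat set \<Rightarrow> nat \<Rightarrow> nat \<Rightarrow> (nat \<Rightarrow> nat) \<Rightarrow> nat" where
  "code V B 0 x = 0"
| "code V B (Suc v) x = code V B v x + (if Suc v \<in> V then x (Suc v) * radix V B v else 0)"

lemma radix_pos: "0 < B \<Longrightarrow> 0 < radix V B v"
  by (induction v) auto

lemma radix_mono: "0 < B \<Longrightarrow> v \<le> w \<Longrightarrow> radix V B v \<le> radix V B w"
  by (induction w) (auto simp: le_Suc_eq intro: trans_le_add1 order.trans)

lemma radix_eq_power: "radix V B v = B ^ card (V \<inter> {1..v})"
proof (induction v)
  case (Suc v)
  have "V \<inter> {1..Suc v} = (if Suc v \<in> V then insert (Suc v) (V \<inter> {1..v}) else V \<inter> {1..v})"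
    by (auto simp: le_Suc_eq)
  then show ?case using Suc by simp
qed simp

text \<open>Linearity holds for entries of any size; a bound by the base matters only for decoding,
  as in \<open>code_inj\<close>.\<close>

lemma code_add: "code V B v (\<lambda>u. x u + y u) = code V B v x + code V B v y"
  by (induction v) (auto simp: distrib_right)

lemma code_zero: "code V B v (\<lambda>_. 0) = 0"
  by (induction v) auto

lemma code_sum: "finite A \<Longrightarrow> code V B v (\<lambda>u. \<Sum>j\<in>A. f j u) = (\<Sum>j\<in>A. code V B v (f j))"
  by (induction A rule: finite_induct) (auto simp: code_zero code_add)

lemma code_unit:
  assumes "u \<in> V" "1 \<le> u" "u \<le> v"
  shows "code V B v ((\<lambda>_. 0)(u := c)) = c * radix V B (u - 1)"
  using assms
proof (induction v)
  case (Suc v)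
  show ?case
  proof (cases "u = Suc v")
    case True
    have "code V B w ((\<lambda>_. 0)(Suc v := c)) = 0" if "w \<le> v" for w
      using that by (induction w) auto
    from this[of v] show ?thesis using True Suc.prems by (simp add: fun_upd_def)
  next
    case False
    then show ?thesis using Suc by auto
  qed
qed simp

lemma code_cong: "(\<And>u. u \<in> V \<Longrightarrow> 1 \<le> u \<Longrightarrow> u \<le> v \<Longrightarrow> x u = y u) \<Longrightarrow> code V B v x = code V B v y"
  by (induction v) auto

lemma code_less:
  assumes "0 < B" "\<And>u. u \<in> V \<Longrightarrow> u \<in> {1..v} \<Longrightarrow> x u < B"
  shows "code V B v x < radix V B v"
  using assms(2)
proof (induction v)
  case (Suc v)
  then have IH: "code V B v x < radix V B v" by simp
  show ?case
  proof (cases "Suc v \<in> V")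
    case True
    then have "x (Suc v) + 1 \<le> B" using Suc.prems[of "Suc v"] by simp
    then have "(x (Suc v) + 1) * radix V B v \<le> B * radix V B v" by (rule mult_right_mono) simp
    then show ?thesis using IH True by (simp add: mult.commute)
  qed (use IH in simp)
qed (use assms in simp)

lemma code_inj:
  assumes "0 < B" "\<And>u. u \<in> V \<Longrightarrow> u \<in> {1..v} \<Longrightarrow> x u < B" "\<And>u. u \<in> V \<Longrightarrow> u \<in> {1..v} \<Longrightarrow> y u < B"
    and "code V B v x = code V B v y" and "u \<in> V" "u \<in> {1..v}"
  shows "x u = y u"
  using assms(2-)
proof (induction v)
  case (Suc v)
  have x: "code V B v x < radix V B v" using Suc.prems(1) assms(1) by (intro code_less) auto
  have y: "code V B v y < radix V B v" using Suc.prems(2) assms(1) by (intro code_less) auto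
  show ?case
  proof (cases "Suc v \<in> V")
    case True
    then have eq: "code V B v x + x (Suc v) * radix V B v = code V B v y + y (Suc v) * radix V B v"
      using Suc.prems(3) by simp
    have "code V B v x = code V B v y" using arg_cong[OF eq, of "\<lambda>t. t mod radix V B v"] x y by simp
    moreover have "x (Suc v) = y (Suc v)" using arg_cong[OF eq, of "\<lambda>t. t div radix V B v"] x y by simp
    ultimately show ?thesis using Suc by (cases "u = Suc v") auto
  next
    case False
    then show ?thesis using Suc by (cases "u = Suc v") auto
  qed
qed simp

lemma digits_support: "u \<notin> V \<or> u \<notin> {1..v} \<Longrightarrow> digits V B v e u = 0"
  by (induction v arbitrary: e) auto

lemma digits_less: "0 < B \<Longrightarrow> e < radix V B v \<Longrightarrow> digits V B v e u < B"
proof (induction v arbitrary: e)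
  case (Suc v)
  then show ?case using radix_pos[of B V v]
    by (auto simp: less_mult_imp_div_less mult.commute split: if_splits)
qed simp

lemma digits_code:
  assumes "0 < B" "\<And>u. x u < B" "\<And>u. u \<notin> V \<or> u \<notin> {1..v} \<Longrightarrow> x u = 0"
  shows "digits V B v (code V B v x) = x"
  using assms(2,3)
proof (induction v arbitrary: x)
  case (Suc v)
  show ?case
  proof (cases "Suc v \<in> V")
    case True
    have c: "code V B v x < radix V B v" using Suc.prems assms(1) by (intro code_less) auto
    have "code V B v x = code V B v (x(Suc v := 0))" by (intro code_cong) auto
    then have "digits V B v (code V B v x) = digits V B v (code V B v (x(Suc v := 0)))" by simp
    also have "\<dots> = x(Suc v := 0)" using Suc.prems assms(1) by (intro Suc.IH) auto
    finally show ?thesis using True c by simp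
  next
    case False
    then have "digits V B v (code V B v x) = x" using Suc.prems by (intro Suc.IH) (auto simp: le_Suc_eq)
    then show ?thesis using False by simp
  qed
qed auto

lemma digits_extend:
  assumes "0 < B" "e < radix V B v" "v \<le> w"
  shows "digits V B w e = digits V B v e"
  using assms(3)
proof (induction w)
  case (Suc w)
  show ?case
  proof (cases "v = Suc w")
    case False
    then have "v \<le> w" using Suc.prems by simp
    then have "e < radix V B w" using radix_mono[OF assms(1), of v w V] assms(2) by simp
    then show ?thesis using Suc.IH \<open>v \<le> w\<close> digits_support[of "Suc w" V w B e]
      by (auto simp: fun_eq_iff)
  qed simp
qed simp

text \<open>The recursion behind the enumeration: vector \<open>e\<close> is an earlier vector plus
  one job of size \<open>Suc v\<close>, so a program can list all vectors without decoding
  indices.\<close>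

lemma digits_step:
  assumes "0 < B" "Suc v \<in> V" "radix V B v \<le> e" "e < radix V B (Suc v)" "Suc v \<le> w"
  shows "digits V B w e = (\<lambda>u. digits V B w (e - radix V B v) u + (if u = Suc v then 1 else 0))"
proof -
  have "e - radix V B v < radix V B (Suc v)" using assms(4) by linarith
  then have "digits V B w e = digits V B (Suc v) e"
    "digits V B w (e - radix V B v) = digits V B (Suc v) (e - radix V B v)"
    using assms by (blast intro: digits_extend)+
  then show ?thesis using assms radix_pos[OF assms(1), of V v]
    by (auto simp: fun_eq_iff le_div_geq le_mod_geq)
qed

section \<open>Reachable vectors\<close>

locale scheduling =
  fixes n m :: nat and p s :: "nat \<Rightarrow> nat"
  assumes inst: "uniform_instance n m p s"
begin

definition "V = p ` {1..n}"
definition "pm = p_max n p"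
definition "cnt v = card {j\<in>{1..n}. p j = v}"
definition "tot = (\<Sum>j=1..n. p j)"
definition "h = 4 * pm ^ 3"
text \<open>Distance from \<open>cnt v * k / M\<close> that a prefix may have. It has to exceed the
  bound \<open>(pm + 2) * h\<^sup>2\<close> of \<open>spread_prefix_bound\<close>, which follows
  from \<open>pm + 3 \<le> h\<close>.\<close>

definition "W = 2 * h ^ 3"
definition "E = 2 * W + 1"
text \<open>A reachable vector has entries at most \<open>n + E\<close> and a machine content at
  most \<open>E\<close>. Their sums stay below \<open>B\<close>, so codes are added without
  carries.\<close>

definition "B = n + 2 * E + 1"
text \<open>The vectors with entries at most \<open>E\<close> serve twice: as possible contents of a
  machine and as offsets within a box.\<close>

definition "len = radix V (E + 1) pm"
definition "vec = digits V (E + 1) pm"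
definition "cd = code V B pm"
text \<open>No machine receives more than \<open>tot\<close>, so the minimum loses nothing, and it
  bounds the number of parts independently of the speeds.\<close>

definition "cap L i0 i = min tot (L * s i div s i0)"
definition "vl L i0 a = virtual_machines h (a * (2 * pm\<^sup>2)) (cap L i0) m"
definition "M L i0 a = length (vl L i0 a)"
definition "ks L i0 a k = fst (vl L i0 a ! (spread_order (map fst (vl L i0 a)) ! k))"
definition "lo L i0 a k v = cnt v * k div M L i0 a - W"
definition "box L i0 a k =
  {y. \<forall>v. if v \<in> V then lo L i0 a k v \<le> y v \<and> y v \<le> lo L i0 a k v + E else y v = 0}"

text \<open>The box belongs to the definition because the program explores nothing else. Every
  vector found still comes from a true packing of the first \<open>k\<close> machines.\<close>

primrec reach :: "nat \<Rightarrow> nat \<Rightarrow> nat \<Rightarrow> nat \<Rightarrow> (nat \<Rightarrow> nat) set" where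
  "reach L i0 a 0 = {\<lambda>_. 0}"
| "reach L i0 a (Suc k) = {y \<in> box L i0 a (Suc k). \<exists>z\<in>reach L i0 a k. \<exists>e<len.
     load pm (vec e) \<le> ks L i0 a k \<and> y = (\<lambda>v. z v + vec e v)}"

lemma nm: "1 \<le> m" "m \<le> n" "1 \<le> n" and p_pos: "j \<in> {1..n} \<Longrightarrow> 1 \<le> p j"
  and s_pos: "i \<in> {1..m} \<Longrightarrow> 1 \<le> s i"
  using inst by (auto simp: uniform_instance_def)

lemma p_le: "j \<in> {1..n} \<Longrightarrow> p j \<le> pm"
  by (simp add: pm_def p_max_def)

lemma V_sub: "V \<subseteq> {1..pm}"
  using p_pos p_le by (auto simp: V_def)

lemma pm_pos: "1 \<le> pm"
  using p_pos[of 1] p_le[of 1] nm by simp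

lemma pm_in_V: "pm \<in> V"
  using nm unfolding V_def pm_def p_max_def by (intro Max_in) auto

lemma cnt_pos_iff: "0 < cnt v \<longleftrightarrow> v \<in> V"
  by (auto simp: cnt_def V_def card_gt_0_iff)

lemma cnt_le: "cnt v \<le> n"
proof -
  have "cnt v \<le> card {1..n}" unfolding cnt_def by (intro card_mono) auto
  then show ?thesis by simp
qed

lemma h_bounds: "pm + 3 \<le> h" "h \<le> W" "(pm + 3) * h\<^sup>2 \<le> W" "pm < h"
proof -
  have "pm \<le> pm ^ 3" "1 \<le> pm ^ 3" using pm_pos by (auto simp: self_le_power)
  then show h: "pm + 3 \<le> h" by (simp add: h_def)
  then show "pm < h" by simp
  have "(pm + 3) * h\<^sup>2 \<le> h * h\<^sup>2" using h by (rule mult_right_mono) simp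
  then show "(pm + 3) * h\<^sup>2 \<le> W" unfolding W_def power2_eq_square power3_eq_cube by linarith
  have "h \<le> h ^ 3" using h by (simp add: self_le_power)
  then show "h \<le> W" by (simp add: W_def)
qed

lemma part_size: "a \<in> {1..pm} \<Longrightarrow> 0 < a * (2 * pm\<^sup>2) \<and> a * (2 * pm\<^sup>2) < h"
proof -
  assume a: "a \<in> {1..pm}"
  then have "a * (2 * pm\<^sup>2) \<le> pm * (2 * pm\<^sup>2)" by simp
  also have "\<dots> = 2 * pm ^ 3" by (simp add: power2_eq_square power3_eq_cube)
  also have "\<dots> < h" using pm_pos by (simp add: h_def)
  finally show ?thesis using a pm_pos by simp
qed

lemma M_pos: "1 \<le> M L i0 a"
  unfolding M_def vl_def by (rule length_virtual_machines_pos) (rule nm)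

lemma M_le: "M L i0 a \<le> m * (tot + 1)"
  unfolding M_def vl_def by (rule length_virtual_machines) (simp add: cap_def)

lemma vec_support: "v \<notin> V \<Longrightarrow> vec e v = 0"
  unfolding vec_def by (rule digits_support) simp

lemma vec_le: "e < len \<Longrightarrow> vec e v \<le> E"
  using digits_less[of "E + 1" e V pm v] by (simp add: vec_def len_def less_Suc_eq_le)

lemma vec_exists:
  assumes "\<And>v. x v \<le> E" "\<And>v. v \<notin> V \<Longrightarrow> x v = 0"
  shows "\<exists>e<len. vec e = x"
proof (intro exI conjI)
  show "code V (E + 1) pm x < len" unfolding len_def using assms by (intro code_less) (auto simp: less_Suc_eq_le)
  show "vec (code V (E + 1) pm x) = x"
    unfolding vec_def
  proof (rule digits_code)
    show "x u = 0" if "u \<notin> V \<or> u \<notin> {1..pm}" for u using that V_sub assms(2) by blast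
  qed (use assms(1) in \<open>auto simp: less_Suc_eq_le\<close>)
qed

text \<open>Completeness of the search: the contents obtained from \<open>virtual_packing\<close>,
  reordered by \<open>spread_prefix_bound\<close>, have prefixes that never leave the boxes. The
  converse is supplied constructively by \<open>run_reconstruct\<close>.\<close>

lemma packing_reach:
  assumes \<sigma>: "\<sigma> \<in> {1..n} \<rightarrow> {1..m}"
    and ld: "\<And>i. i \<in> {1..m} \<Longrightarrow> (\<Sum>j\<in>{j\<in>{1..n}. \<sigma> j = i}. p j) \<le> cap L i0 i"
  shows "\<exists>a\<in>{1..pm}. cnt \<in> reach L i0 a (M L i0 a)"
proof -
  define x where "x i v = card {j\<in>{1..n}. \<sigma> j = i \<and> p j = v}" for i v
  have lx: "load pm (x i) = (\<Sum>j\<in>{j\<in>{1..n}. \<sigma> j = i}. p j)" for i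
  proof -
    have "(\<Sum>j\<in>{j\<in>{1..n}. \<sigma> j = i}. p j) =
      (\<Sum>v\<in>{1..pm}. \<Sum>j\<in>{j\<in>{j\<in>{1..n}. \<sigma> j = i}. p j = v}. p j)"
      using V_sub by (intro sum.group[symmetric]) (auto simp: V_def)
    also have "\<dots> = (\<Sum>v\<in>{1..pm}. v * x i v)"
      by (intro sum.cong) (auto simp: x_def conj_assoc)
    finally show ?thesis by (simp add: load_def)
  qed
  have sumx: "(\<Sum>i=1..m. x i v) = cnt v" for v
  proof -
    have "cnt v = (\<Sum>j\<in>{j\<in>{1..n}. p j = v}. 1)" by (simp add: cnt_def)
    also have "\<dots> = (\<Sum>i\<in>{1..m}. \<Sum>j\<in>{j\<in>{j\<in>{1..n}. p j = v}. \<sigma> j = i}. 1)"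
      using \<sigma> by (intro sum.group[symmetric]) (auto simp: Pi_iff)
    also have "\<dots> = (\<Sum>i=1..m. x i v)"
      by (intro sum.cong) (auto simp: x_def intro!: arg_cong[where f=card])
    finally show ?thesis by simp
  qed
  have "\<exists>a\<in>{1..pm}. \<exists>zs. length zs = length (virtual_machines (4 * pm ^ 3) (a * (2 * pm\<^sup>2)) (cap L i0) m) \<and>
    (\<forall>u<length zs. load pm (zs ! u) \<le> fst (virtual_machines (4 * pm ^ 3) (a * (2 * pm\<^sup>2)) (cap L i0) m ! u)) \<and>
    (\<forall>v. (\<Sum>z\<leftarrow>zs. z v) = (\<Sum>i=1..m. x i v))"
    by (rule virtual_packing[OF pm_pos]) (use ld lx in simp)
  then obtain a zs where a: "a \<in> {1..pm}"
    and zs: "length zs = M L i0 a" "\<And>u. u < length zs \<Longrightarrow> load pm (zs ! u) \<le> fst (vl L i0 a ! u)"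
      "\<And>v. (\<Sum>z\<leftarrow>zs. z v) = cnt v"
    unfolding sumx M_def vl_def h_def by metis
  define K where "K = map fst (vl L i0 a)"
  have MK: "length K = M L i0 a" by (simp add: K_def M_def)
  have sumz: "(\<Sum>u<length K. (zs ! u) v) = cnt v" for v
    using zs(3)[of v] zs(1) by (simp add: MK sum_list_sum_nth atLeast0LessThan)
  have Kh: "set K \<subseteq> {..<h}"
  proof
    fix \<kappa> assume "\<kappa> \<in> set K"
    then obtain y where y: "y \<in> set (vl L i0 a)" "\<kappa> = fst y" by (auto simp: K_def)
    from part_size[OF a] have "0 < a * (2 * pm\<^sup>2)" "a * (2 * pm\<^sup>2) < h" by auto
    from virtual_machines_less[OF this y(1)[unfolded vl_def]] show "\<kappa> \<in> {..<h}" using y(2) by simp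
  qed
  have "load pm (zs ! u) \<le> K ! u" if "u < length K" for u
    using zs(2)[of u] zs(1) that MK by (simp add: K_def)
  from spread_prefix_bound[OF Kh this, unfolded sumz] obtain w where
    w: "\<And>k. k < length K \<Longrightarrow> load pm (w k) \<le> K ! (spread_order K ! k)"
    "\<And>v. (\<Sum>j<length K. w j v) = cnt v"
    "\<And>k v. k \<le> length K \<Longrightarrow> v \<in> {1..pm} \<Longrightarrow>
       \<bar>real (\<Sum>j<k. w j v) * length K - real k * cnt v\<bar> \<le> (real pm + 2) * h\<^sup>2 * length K"
    by blast
  have ksK: "ks L i0 a k = K ! (spread_order K ! k)" if "k < length K" for k
  proof -
    have "spread_order K ! k < length K"
      using nth_mem[of k "spread_order K"] that by (simp add: set_spread_order length_spread_order)
    then show ?thesis by (simp add: ks_def K_def)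
  qed
  have w0: "w k v = 0" if "v \<notin> V" "k < length K" for k v
  proof -
    have "cnt v = 0" using that(1) cnt_pos_iff[of v] by simp
    then show ?thesis using w(2)[of v] that(2) by auto
  qed
  \<comment> \<open>A content has at most \<open>h\<close> jobs of each size, which lies within the
    range of the enumeration.\<close>
  have wE: "w k v \<le> E" if k: "k < length K" for k v
  proof (cases "v \<in> V")
    case True
    then have v: "v \<in> {1..pm}" using V_sub by auto
    have "w k v \<le> v * w k v" using v by simp
    also have "\<dots> \<le> load pm (w k)" using v by (rule mult_le_load)
    also have "\<dots> \<le> h"
      using w(1)[OF k] Kh nth_mem[of "spread_order K ! k" K] nth_mem[of k "spread_order K"] k
      by (fastforce simp: set_spread_order length_spread_order)
    finally show ?thesis using h_bounds by (simp add: E_def)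
  qed (use w0 k in simp)
  have "(\<lambda>v. \<Sum>j<k. w j v) \<in> reach L i0 a k" if "k \<le> length K" for k
    using that
  proof (induction k)
    case (Suc k)
    have k: "k < length K" using Suc.prems by simp
    have "\<exists>e<len. vec e = w k" using wE w0 k by (intro vec_exists) auto
    then obtain e where e: "e < len" "vec e = w k" by blast
    let ?y = "\<lambda>v. \<Sum>j<Suc k. w j v"
    have "?y \<in> box L i0 a (Suc k)"
      unfolding box_def
    proof (intro CollectI allI)
      fix v
      show "if v \<in> V then lo L i0 a (Suc k) v \<le> ?y v \<and> ?y v \<le> lo L i0 a (Suc k) v + E else ?y v = 0"
      proof (cases "v \<in> V")
        case True
        let ?M = "length K" and ?D = "(pm + 2) * h\<^sup>2"
        have M: "0 < ?M" using k by linarith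
        have v: "v \<in> {1..pm}" using True V_sub by auto
        have "\<bar>real (?y v) * ?M - real (Suc k) * cnt v\<bar> \<le> (real pm + 2) * h\<^sup>2 * ?M"
          by (rule w(3)[OF Suc.prems v])
        then have "real (?y v * ?M) \<le> real (Suc k * cnt v + ?D * ?M)"
          "real (Suc k * cnt v) \<le> real (?y v * ?M + ?D * ?M)"
          by (simp_all only: of_nat_mult of_nat_add of_nat_power of_nat_numeral abs_le_iff) linarith+
        then have up: "?y v * ?M \<le> Suc k * cnt v + ?D * ?M" and lw: "Suc k * cnt v \<le> ?y v * ?M + ?D * ?M"
          by (simp_all only: of_nat_le_iff)
        let ?q = "cnt v * Suc k div ?M"
        have "cnt v * Suc k \<le> (?y v + ?D) * ?M"
          using lw by (simp only: distrib_right[of "?y v" ?D ?M] mult.commute[of "cnt v"])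
        then have "?q \<le> (?y v + ?D) * ?M div ?M" by (rule div_le_mono)
        then have q1: "?q \<le> ?y v + ?D" using M by simp
        \<comment> \<open>The centre \<open>?q\<close> of the box is rounded down, which costs less
          than one.\<close>
        have "cnt v * Suc k < (?q + 1) * ?M"
          using div_less_iff_less_mult[OF M, of "cnt v * Suc k" "?q + 1"] by simp
        then have "?y v * ?M < (?q + 1) * ?M + ?D * ?M"
          using up unfolding mult.commute[of "Suc k" "cnt v"] by linarith
        then have "?y v * ?M < (?q + 1 + ?D) * ?M" by (simp only: distrib_right[of "?q + 1" ?D ?M])
        then have q2: "?y v < ?q + 1 + ?D" unfolding mult_less_cancel2 by blast
        have "?D + h\<^sup>2 \<le> W" using h_bounds(3) by (simp add: distrib_right)
        moreover have "1 \<le> h\<^sup>2" using h_bounds(1) by simp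
        ultimately have "?D + 1 \<le> W" by linarith
        then have "?q - W \<le> ?y v \<and> ?y v \<le> (?q - W) + E" using q1 q2 unfolding E_def by linarith
        then show ?thesis using True by (simp add: lo_def MK)
      next
        case False
        then show ?thesis using w0 Suc.prems by simp
      qed
    qed
    moreover have "(\<lambda>v. \<Sum>j<k. w j v) \<in> reach L i0 a k" using Suc by simp
    moreover have "load pm (vec e) \<le> ks L i0 a k" using w(1)[OF k] ksK[OF k] e by simp
    moreover have "?y = (\<lambda>v. (\<Sum>j<k. w j v) + vec e v)" using e by simp
    ultimately show ?case using e(1) by auto
  qed simp
  from this[of "length K"] have "cnt \<in> reach L i0 a (M L i0 a)" using w(2) by (simp add: MK)
  with a show ?thesis by blast
qed

end

section \<open>Running programs\<close>

text \<open>Total correctness together with the running time. Since execution is deterministic, the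
  rules below are equivalences and evaluate programs symbolically by rewriting.\<close>

definition run :: "com \<Rightarrow> state \<Rightarrow> (nat \<Rightarrow> state \<Rightarrow> bool) \<Rightarrow> bool" where
  "run c st Q \<longleftrightarrow> (\<exists>t st'. exec c st t st' \<and> Q t st')"

lemma run_Skip: "run Skip st Q \<longleftrightarrow> Q 1 st"
  unfolding run_def by (metis exec.Skip exec_deterministic)

lemma run_Assign: "run (Assign x e) st Q \<longleftrightarrow> Q (acost e + 1) (st\<lparr>reg := (reg st)(x := aval e st)\<rparr>)"
  unfolding run_def by (metis exec.Assign exec_deterministic)

lemma run_Put: "run (Put A i e) st Q \<longleftrightarrow>
    Q (acost i + acost e + 1) (st\<lparr>arr := (arr st)(A := (arr st A)(aval i st := aval e st))\<rparr>)"
  unfolding run_def by (metis exec.Put exec_deterministic)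

lemma run_Seq: "run (Seq c1 c2) st Q \<longleftrightarrow> run c1 st (\<lambda>t1 st1. run c2 st1 (\<lambda>t2. Q (t1 + t2)))"
proof
  assume "run (Seq c1 c2) st Q"
  then show "run c1 st (\<lambda>t1 st1. run c2 st1 (\<lambda>t2. Q (t1 + t2)))"
    unfolding run_def by (elim exE conjE exec_SeqE) blast
next
  assume "run c1 st (\<lambda>t1 st1. run c2 st1 (\<lambda>t2. Q (t1 + t2)))"
  then show "run (Seq c1 c2) st Q"
    unfolding run_def by (blast intro: exec.Seq)
qed

lemma run_If: "run (If b c1 c2) st Q \<longleftrightarrow>
    (if bval b st then run c1 st (\<lambda>t. Q (bcost b + t + 1)) else run c2 st (\<lambda>t. Q (bcost b + t + 1)))"
proof (cases "bval b st")
  case True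
  then show ?thesis unfolding run_def
    by (simp, intro iffI) (fastforce elim: exec_IfE, metis exec.IfTrue Suc_eq_plus1)
next
  case False
  then show ?thesis unfolding run_def
    by (simp, intro iffI) (fastforce elim: exec_IfE, metis exec.IfFalse Suc_eq_plus1)
qed

lemmas run_simps = run_Skip run_Assign run_Put run_Seq run_If

section \<open>Syntactic frame conditions\<close>

primrec mod_regs :: "com \<Rightarrow> string list" where
  "mod_regs Skip = []"
| "mod_regs (Assign x e) = [x]"
| "mod_regs (Put A i e) = []"
| "mod_regs (Seq c1 c2) = mod_regs c1 @ mod_regs c2"
| "mod_regs (If b c1 c2) = mod_regs c1 @ mod_regs c2"
| "mod_regs (While b c) = mod_regs c"

primrec mod_arrs :: "com \<Rightarrow> string list" where
  "mod_arrs Skip = []"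
| "mod_arrs (Assign x e) = []"
| "mod_arrs (Put A i e) = [A]"
| "mod_arrs (Seq c1 c2) = mod_arrs c1 @ mod_arrs c2"
| "mod_arrs (If b c1 c2) = mod_arrs c1 @ mod_arrs c2"
| "mod_arrs (While b c) = mod_arrs c"

definition same :: "string list \<Rightarrow> string list \<Rightarrow> state \<Rightarrow> state \<Rightarrow> bool" where
  "same R A st st' \<longleftrightarrow> (\<forall>x. x \<notin> set R \<longrightarrow> reg st' x = reg st x) \<and> (\<forall>x. x \<notin> set A \<longrightarrow> arr st' x = arr st x)"

lemma same_refl: "same R A st st"
  by (simp add: same_def)

lemma same_trans: "same R A st st1 \<Longrightarrow> same R A st1 st2 \<Longrightarrow> same R A st st2"
  by (simp add: same_def)

lemma exec_same: "exec c st t st' \<Longrightarrow> same (mod_regs c) (mod_arrs c) st st'"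
  by (induction rule: exec.induct) (auto simp: same_def)

text \<open>Supplies the frame condition automatically, so that specifications need to mention only
  what a program computes.\<close>

lemma run_conseq:
  assumes "run c st P" and "\<And>t st'. P t st' \<Longrightarrow> same (mod_regs c) (mod_arrs c) st st' \<Longrightarrow> Q t st'"
  shows "run c st Q"
  using assms exec_same unfolding run_def by blast

lemma run_while_exact:
  assumes "I st"
    and step: "\<And>st1. I st1 \<Longrightarrow> same (mod_regs c) (mod_arrs c) st st1 \<Longrightarrow> bval b st1 \<Longrightarrow>
      run c st1 (\<lambda>t st2. t \<le> T \<and> I st2 \<and> \<mu> st2 < \<mu> st1)"
  shows "run (While b c) st (\<lambda>t st1. t \<le> (\<mu> st + 1) * (T + bcost b + 1) \<and> I st1 \<and> \<not> bval b st1)"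
proof -
  have "run (While b c) st0 (\<lambda>t st1. t \<le> (\<mu> st0 + 1) * (T + bcost b + 1) \<and> I st1 \<and> \<not> bval b st1)"
    if "I st0" "same (mod_regs c) (mod_arrs c) st st0" for st0
    using that
  proof (induction "\<mu> st0" arbitrary: st0 rule: less_induct)
    case less
    show ?case
    proof (cases "bval b st0")
      case True
      from step[OF less.prems True] obtain t1 st1 where
        1: "exec c st0 t1 st1" "t1 \<le> T" "I st1" "\<mu> st1 < \<mu> st0" unfolding run_def by blast
      have s: "same (mod_regs c) (mod_arrs c) st st1"
        using same_trans[OF less.prems(2) exec_same[OF 1(1)]] .
      from less.hyps[OF 1(4,3) s] obtain t2 st2 where
        2: "exec (While b c) st1 t2 st2" "t2 \<le> (\<mu> st1 + 1) * (T + bcost b + 1)" "I st2" "\<not> bval b st2"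
        unfolding run_def by blast
      have "(\<mu> st1 + 2) * (T + bcost b + 1) \<le> (\<mu> st0 + 1) * (T + bcost b + 1)"
        using 1(4) by (intro mult_right_mono) auto
      then have "bcost b + t1 + t2 + 1 \<le> (\<mu> st0 + 1) * (T + bcost b + 1)" using 1(2) 2(2) by simp
      then show ?thesis using exec.WhileTrue[OF True 1(1) 2(1)] 2 unfolding run_def by blast
    next
      case False
      have "bcost b + 1 \<le> (\<mu> st0 + 1) * (T + bcost b + 1)" by simp
      then show ?thesis using exec.WhileFalse[OF False] False less.prems(1) unfolding run_def by blast
    qed
  qed
  then show ?thesis using assms(1) same_refl by blast
qed

text \<open>Times are kept in the form \<open>C * U ^ k\<close>, so a loop of at most
  \<open>U\<close> rounds raises \<open>k\<close> by one. The factor 2 absorbs the final test of the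
  condition.\<close>

lemma run_while:
  assumes "I st" and U: "1 \<le> U" and \<mu>: "\<mu> st \<le> U"
    and step: "\<And>st1. I st1 \<Longrightarrow> same (mod_regs c) (mod_arrs c) st st1 \<Longrightarrow> bval b st1 \<Longrightarrow>
      run c st1 (\<lambda>t st2. t \<le> C * U ^ k \<and> I st2 \<and> \<mu> st2 < \<mu> st1)"
    and fin: "\<And>t st1. I st1 \<Longrightarrow> same (mod_regs c) (mod_arrs c) st st1 \<Longrightarrow> \<not> bval b st1 \<Longrightarrow>
      t \<le> 2 * (C + bcost b + 1) * U ^ Suc k \<Longrightarrow> Q t st1"
  shows "run (While b c) st Q"
proof (rule run_conseq[OF run_while_exact[where I = I and \<mu> = \<mu> and T = "C * U ^ k"]])
  fix t st1
  assume a: "t \<le> (\<mu> st + 1) * (C * U ^ k + bcost b + 1) \<and> I st1 \<and> \<not> bval b st1"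
    "same (mod_regs (While b c)) (mod_arrs (While b c)) st st1"
  have "1 \<le> U ^ k" using U by simp
  then have "bcost b + 1 \<le> (bcost b + 1) * U ^ k" by (metis mult.right_neutral mult_le_mono2)
  then have "C * U ^ k + bcost b + 1 \<le> (C + bcost b + 1) * U ^ k" by (simp add: distrib_right)
  moreover have "\<mu> st + 1 \<le> 2 * U" using \<mu> U by simp
  ultimately have "(\<mu> st + 1) * (C * U ^ k + bcost b + 1) \<le> (2 * U) * ((C + bcost b + 1) * U ^ k)"
    by (rule mult_le_mono[rotated])
  also have "\<dots> = 2 * (C + bcost b + 1) * U ^ Suc k" by (simp only: power_Suc mult_ac)
  finally have "t \<le> 2 * (C + bcost b + 1) * U ^ Suc k" using a by linarith
  then show "Q t st1" using a by (intro fin) auto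
qed (use assms in auto)

lemma cost_mono:
  fixes U :: nat
  shows "1 \<le> U \<Longrightarrow> k \<le> k' \<Longrightarrow> C * U ^ k \<le> C * U ^ k'"
  by (simp add: power_increasing)

abbreviation seq_notation :: "com \<Rightarrow> com \<Rightarrow> com" (infixr ";;" 60) where
  "c1 ;; c2 \<equiv> Seq c1 c2"

text \<open>The time depends on \<open>y\<close> only. The factor \<open>x\<close> may be a speed or
  a place value of uncontrolled size, so every call puts a small factor last.\<close>

definition mul :: "string \<Rightarrow> string \<Rightarrow> string \<Rightarrow> com" where
  "mul r x y = Assign r (Const 0) ;; Assign ''z'' (Const 0) ;;
     While (Less (Reg ''z'') (Reg y)) (Assign r (Plus (Reg r) (Reg x)) ;; Assign ''z'' (Plus (Reg ''z'') (Const 1)))"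

lemma mods_mul [simp]: "mod_regs (mul r x y) = [r, ''z'', r, ''z'']" "mod_arrs (mul r x y) = []"
  by (simp_all add: mul_def)

lemma run_mul:
  assumes "distinct [r, x, ''z'']" "distinct [r, y, ''z'']" and U: "1 \<le> U" "reg st y \<le> U"
    and Q: "\<And>t. t \<le> 100 * U \<Longrightarrow>
      Q t (st\<lparr>reg := (reg st)(r := reg st x * reg st y, ''z'' := reg st y)\<rparr>)"
  shows "run (mul r x y) st Q"
  unfolding mul_def run_simps
proof (rule run_while[where I = "\<lambda>st1. reg st1 ''z'' \<le> reg st y \<and>
      st1 = st\<lparr>reg := (reg st)(r := reg st x * reg st1 ''z'', ''z'' := reg st1 ''z'')\<rparr>"
      and U = U and \<mu> = "\<lambda>st1. reg st y - reg st1 ''z''" and C = 8 and k = 0], goal_cases)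
  case (4 st1)
  define c where "c = reg st1 ''z''"
  from 4 have st1: "st1 = st\<lparr>reg := (reg st)(r := reg st x * c, ''z'' := c)\<rparr>" by (simp add: c_def)
  show ?case using 4(3) assms(1,2) unfolding st1 by (auto simp: run_simps fun_upd_def fun_eq_iff)
next
  case (5 t st1)
  define c where "c = reg st1 ''z''"
  from 5 have st1: "st1 = st\<lparr>reg := (reg st)(r := reg st x * c, ''z'' := c)\<rparr>" by (simp add: c_def)
  have c: "c \<le> reg st y" using 5 by (simp add: c_def)
  have cy: "c = reg st y" using 5(3) c assms(1,2) unfolding st1 by auto
  show ?case unfolding st1 cy using 5(4) U by (intro Q) auto
qed (use assms in \<open>auto simp: fun_upd_def fun_eq_iff\<close>)

definition div_mod :: "string \<Rightarrow> string \<Rightarrow> string \<Rightarrow> com" where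
  "div_mod r x y = Assign r (Const 0) ;;
     While (Not (Less (Reg x) (Reg y))) (Assign x (Minus (Reg x) (Reg y)) ;; Assign r (Plus (Reg r) (Const 1)))"

lemma mods_div_mod [simp]: "mod_regs (div_mod r x y) = [r, x, r]" "mod_arrs (div_mod r x y) = []"
  by (simp_all add: div_mod_def)

lemma run_div_mod:
  assumes "distinct [r, x, y]" and U: "1 \<le> U" "reg st x \<le> U" and y: "0 < reg st y"
    and Q: "\<And>t. t \<le> 100 * U \<Longrightarrow>
      Q t (st\<lparr>reg := (reg st)(r := reg st x div reg st y, x := reg st x mod reg st y)\<rparr>)"
  shows "run (div_mod r x y) st Q"
  unfolding div_mod_def run_simps
proof (rule run_while[where I = "\<lambda>st1. reg st1 r * reg st y + reg st1 x = reg st x \<and>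
      st1 = st\<lparr>reg := (reg st)(r := reg st1 r, x := reg st1 x)\<rparr>"
      and U = U and \<mu> = "\<lambda>st1. reg st1 x" and C = 8 and k = 0], goal_cases)
  case (4 st1)
  define c d where "c = reg st1 r" and "d = reg st1 x"
  from 4 have st1: "st1 = st\<lparr>reg := (reg st)(r := c, x := d)\<rparr>" by (simp add: c_def d_def)
  have eq: "c * reg st y + d = reg st x" using 4 by (simp add: c_def d_def)
  show ?case using 4(3) assms(1) y eq unfolding st1 by (auto simp: run_simps fun_upd_def fun_eq_iff)
next
  case (5 t st1)
  define c d where "c = reg st1 r" and "d = reg st1 x"
  from 5 have st1: "st1 = st\<lparr>reg := (reg st)(r := c, x := d)\<rparr>" by (simp add: c_def d_def)
  have eq: "c * reg st y + d = reg st x" using 5 by (simp add: c_def d_def)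
  have "d < reg st y" using 5(3) assms(1) unfolding st1 by auto
  then have cd: "d = reg st x mod reg st y" "c = reg st x div reg st y" unfolding eq[symmetric] by auto
  show ?case unfolding st1 cd using 5(4) U by (intro Q) auto
qed (use assms in \<open>auto simp: fun_upd_def fun_eq_iff\<close>)

section \<open>Preprocessing\<close>

text \<open>Registers \<open>S\<close> and \<open>P\<close> hold the total and the maximum processing time, array \<open>c\<close> the number
  of jobs of each size. A vector of job numbers is stored as a number in base \<open>B\<close>, in which size
  \<open>v\<close> has place value \<open>w v\<close>, and \<open>N\<close> is the code of the vector of all jobs. The vectors with
  entries at most \<open>E\<close> are enumerated: \<open>oc\<close>, \<open>ol\<close> are their codes and loads, \<open>l\<close> is their number,
  and vector \<open>e > 0\<close> is vector \<open>op e\<close> plus one job of size \<open>ov e\<close>.\<close>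

abbreviation incr :: "string \<Rightarrow> com" where
  "incr x \<equiv> Assign x (Plus (Reg x) (Const 1))"

definition scan :: com where
  "scan = Assign ''j'' (Const 1) ;;
     While (Less (Reg ''j'') (Plus (Reg ''n'') (Const 1)))
      (Assign ''S'' (Plus (Reg ''S'') (Get ''p'' (Reg ''j''))) ;;
       Put ''c'' (Get ''p'' (Reg ''j'')) (Plus (Get ''c'' (Get ''p'' (Reg ''j''))) (Const 1)) ;;
       If (Less (Reg ''P'') (Get ''p'' (Reg ''j''))) (Assign ''P'' (Get ''p'' (Reg ''j''))) Skip ;;
       incr ''j'')"

definition constants :: com where
  "constants =
     mul ''x'' ''P'' ''P'' ;; Assign ''q'' (Plus (Reg ''x'') (Reg ''x'')) ;;
     mul ''y'' ''x'' ''P'' ;; Assign ''x'' (Plus (Reg ''y'') (Reg ''y'')) ;;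
     Assign ''h'' (Plus (Reg ''x'') (Reg ''x'')) ;;
     mul ''x'' ''h'' ''h'' ;; mul ''y'' ''x'' ''h'' ;;
     Assign ''W'' (Plus (Reg ''y'') (Reg ''y'')) ;;
     Assign ''E'' (Plus (Plus (Reg ''W'') (Reg ''W'')) (Const 1)) ;;
     Assign ''B'' (Plus (Plus (Reg ''n'') (Plus (Reg ''E'') (Reg ''E''))) (Const 1))"

definition enum_step :: com where
  "enum_step =
     While (Less (Reg ''l'') (Reg ''r''))
      (Put ''oc'' (Reg ''l'') (Plus (Get ''oc'' (Minus (Reg ''l'') (Reg ''k''))) (Reg ''Z'')) ;;
       Put ''ol'' (Reg ''l'') (Plus (Get ''ol'' (Minus (Reg ''l'') (Reg ''k''))) (Reg ''v'')) ;;
       Put ''op'' (Reg ''l'') (Minus (Reg ''l'') (Reg ''k'')) ;;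
       Put ''ov'' (Reg ''l'') (Reg ''v'') ;;
       incr ''l'')"

definition enumerate :: com where
  "enumerate =
     Assign ''v'' (Const 1) ;; Assign ''l'' (Const 1) ;; Assign ''Z'' (Const 1) ;;
     Assign ''e'' (Plus (Reg ''E'') (Const 1)) ;;
     While (Less (Reg ''v'') (Plus (Reg ''P'') (Const 1)))
      (If (Less (Const 0) (Get ''c'' (Reg ''v'')))
        (Put ''w'' (Reg ''v'') (Reg ''Z'') ;;
         Assign ''k'' (Reg ''l'') ;;
         mul ''r'' ''k'' ''e'' ;;
         enum_step ;;
         mul ''y'' ''Z'' ''B'' ;;
         Assign ''Z'' (Reg ''y''))
        Skip ;;
       incr ''v'')"

definition target :: com where
  "target = Assign ''j'' (Const 1) ;;
     While (Less (Reg ''j'') (Plus (Reg ''n'') (Const 1)))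
      (Assign ''N'' (Plus (Reg ''N'') (Get ''w'' (Get ''p'' (Reg ''j'')))) ;; incr ''j'')"

definition holds_list :: "(nat \<Rightarrow> nat) \<Rightarrow> nat list \<Rightarrow> bool" where
  "holds_list f xs \<longleftrightarrow> (\<forall>i<length xs. f i = xs ! i)"

lemma holds_list_snoc: "holds_list f xs \<Longrightarrow> holds_list (f(length xs := x)) (xs @ [x])"
  by (auto simp: holds_list_def nth_append less_Suc_eq)

lemma mods_scan [simp]: "set (mod_regs scan) = {''j'', ''S'', ''P''}" "set (mod_arrs scan) = {''c''}"
  by (auto simp: scan_def)

lemma mods_constants [simp]:
  "set (mod_regs constants) = {''x'', ''y'', ''q'', ''z'', ''h'', ''W'', ''E'', ''B''}" "mod_arrs constants = []"
  by (auto simp: constants_def)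

lemma mods_enum_step [simp]: "mod_regs enum_step = [''l'']" "mod_arrs enum_step = [''oc'', ''ol'', ''op'', ''ov'']"
  by (auto simp: enum_step_def)

lemma mods_enumerate [simp]:
  "set (mod_regs enumerate) = {''v'', ''l'', ''Z'', ''e'', ''k'', ''r'', ''z'', ''y''}"
  "set (mod_arrs enumerate) = {''w'', ''oc'', ''ol'', ''op'', ''ov''}"
  by (auto simp: enumerate_def)

lemma mods_target [simp]: "set (mod_regs target) = {''j'', ''N''}" "mod_arrs target = []"
  by (auto simp: target_def)

context scheduling
begin

text \<open>Bounds the number of virtual machines, because a capacity of at most \<open>tot\<close>
  yields at most \<open>tot + 1\<close> parts.\<close>

definition "A = m * (tot + 1)"
text \<open>One bound for all loops. The summands \<open>n * A\<close> and \<open>A * A\<close>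
  cover the dividends \<open>cnt v * k\<close> and \<open>rank K u * length K\<close> of divisions
  by repeated subtraction.\<close>

definition "U = B + len + h + n * A + A * A"

lemma A_bounds: "m \<le> A" "tot < A"
  using nm unfolding A_def by (simp, metis Suc_eq_plus1 lessI less_le_trans mult_le_mono1 nat_mult_1)

lemma U_bounds: "1 \<le> U" "n < U" "m \<le> U" "tot < U" "pm < U" "h \<le> U" "W \<le> U" "E + 1 \<le> U" "B \<le> U"
  "len \<le> U" "A < U" "n * A \<le> U" "A * A \<le> U"
proof -
  have AA: "A \<le> A * A" using A_bounds(2) by simp
  define x y where "x = n * A" and "y = A * A"
  have "U = n + 2 * (2 * W + 1) + 1 + len + h + x + y" by (simp add: U_def B_def E_def x_def y_def)
  then show "1 \<le> U" "n < U" "m \<le> U" "tot < U" "pm < U" "h \<le> U" "W \<le> U" "E + 1 \<le> U" "B \<le> U"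
    "len \<le> U" "A < U" "n * A \<le> U" "A * A \<le> U"
    using A_bounds h_bounds(1,2,4) AA unfolding x_def[symmetric] y_def[symmetric] B_def E_def by simp_all
qed

lemma U_power: "1 \<le> U ^ k"
  using U_bounds(1) by simp

definition input :: "state \<Rightarrow> bool" where
  "input st \<longleftrightarrow> reg st ''n'' = n \<and> reg st ''m'' = m \<and>
     (\<forall>j\<in>{1..n}. arr st ''p'' j = p j) \<and> (\<forall>i\<in>{1..m}. arr st ''s'' i = s i)"

lemma input_init: "input (input_state n m p s)"
  by (auto simp: input_def input_state_def)

lemma input_same: "input st \<Longrightarrow> same R X st st' \<Longrightarrow> {''n'', ''m''} \<inter> set R = {} \<Longrightarrow> {''p'', ''s''} \<inter> set X = {} \<Longrightarrow> input st'"
  by (auto simp: input_def same_def)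

lemma run_scan:
  assumes "input st" "reg st ''S'' = 0" "reg st ''P'' = 0" "arr st ''c'' = (\<lambda>_. 0)"
  shows "run scan st (\<lambda>t st'. t \<le> 100 * U \<and> reg st' ''S'' = tot \<and> reg st' ''P'' = pm \<and> arr st' ''c'' = cnt)"
proof -
  \<comment> \<open>Inserting 0 gives the empty prefix a maximum, which agrees with the initial
    value of register \<open>P\<close>.\<close>
  define mx where "mx j = Max (insert 0 (p ` {1..<j}))" for j
  show ?thesis
    unfolding scan_def run_simps
  proof (rule run_while[where U = U and C = 40 and k = 0 and \<mu> = "\<lambda>st. n + 1 - reg st ''j''" and
    I = "\<lambda>st. 1 \<le> reg st ''j'' \<and> reg st ''j'' \<le> n + 1 \<and> reg st ''S'' = (\<Sum>j\<in>{1..<reg st ''j''}. p j) \<and>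
      reg st ''P'' = mx (reg st ''j'') \<and>
      arr st ''c'' = (\<lambda>v. card {j\<in>{1..<reg st ''j''}. p j = v})"], goal_cases)
  case 1
  then show ?case using assms by (simp add: mx_def)
next
  case 2
  then show ?case by (rule U_bounds)
next
  case 3
  then show ?case using U_bounds by simp
next
  case (4 st1)
  define j where "j = reg st1 ''j''"
  from 4 assms have j: "1 \<le> j" "j \<le> n" "arr st1 ''p'' j = p j"
    by (auto simp: j_def input_def same_def)
  have set: "{1..<Suc j} = insert j {1..<j}" using j by auto
  have card: "card {i\<in>{1..<Suc j}. p i = v} = (if v = p j then card {i\<in>{1..<j}. p i = v} + 1 else card {i\<in>{1..<j}. p i = v})" for v
  proof -
    have "{i\<in>{1..<Suc j}. p i = v} = (if v = p j then insert j {i\<in>{1..<j}. p i = v} else {i\<in>{1..<j}. p i = v})"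
      unfolding set by auto
    then show ?thesis by simp
  qed
  have max: "mx (Suc j) = (if mx j < p j then p j else mx j)"
  proof -
    have "mx (Suc j) = max (p j) (mx j)"
      unfolding mx_def set image_insert insert_commute[of 0] by (rule Max_insert) auto
    then show ?thesis by (simp add: max_def)
  qed
  show ?case using 4 j by (auto simp: run_simps j_def[symmetric] set[simplified] max card[simplified] fun_eq_iff)
next
  case (5 t st1)
  then have j: "reg st1 ''j'' = n + 1" using assms by (auto simp: input_def same_def)
  have "{1..<n+1} = {1..n}" by auto
  then have "mx (n + 1) = pm"
    using nm by (simp add: mx_def pm_def p_max_def)
  then show ?case using 5 j U_bounds(1) \<open>{1..<n+1} = {1..n}\<close>
    by (simp add: tot_def cnt_def fun_eq_iff less_Suc_eq_le atLeastLessThanSuc_atLeastAtMost del: sum.op_ivl_Suc)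
qed
qed

lemma run_constants:
  assumes "input st" "reg st ''P'' = pm"
  shows "run constants st (\<lambda>t st'. t \<le> 1000 * U \<and> reg st' ''q'' = 2 * pm\<^sup>2 \<and> reg st' ''h'' = h \<and>
    reg st' ''W'' = W \<and> reg st' ''E'' = E \<and> reg st' ''B'' = B)"
proof -
  have hh: "pm * pm * pm + pm * pm * pm + (pm * pm * pm + pm * pm * pm) = h" and WW: "h * h * h + h * h * h = W"
    by (simp_all add: h_def W_def power3_eq_cube)
  have *: "reg st ''n'' = n" using assms(1) by (simp add: input_def)
  show ?thesis
    unfolding constants_def run_Seq
    apply (rule run_mul[where U = U], simp, simp, rule U_bounds)
    subgoal using U_bounds(5) by (simp add: assms)
    apply (simp add: run_simps assms)
    apply (rule run_mul[where U = U], simp, simp, rule U_bounds)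
    subgoal using U_bounds(5) by (simp add: assms)
    apply (simp add: run_simps assms)
    apply (rule run_mul[where U = U], simp, simp, rule U_bounds)
    subgoal using U_bounds(6) hh by (simp add: assms)
    apply (rule run_mul[where U = U], simp, simp, rule U_bounds)
    subgoal using U_bounds(6) hh by (simp add: assms)
    using U_bounds(1)
    by (simp add: run_simps E_def B_def power2_eq_square assms * hh WW)
qed

definition add_unit :: "nat \<Rightarrow> (nat \<Rightarrow> nat) \<Rightarrow> nat \<Rightarrow> nat" where
  "add_unit v x = (\<lambda>u. x u + (if u = v then 1 else 0))"

text \<open>As \<open>op e\<close> is smaller than \<open>e\<close>, following \<open>op\<close>
  down to 0 unwinds a vector job by job; the reconstruction relies on this.\<close>

definition enum_ok :: "state \<Rightarrow> nat \<Rightarrow> bool" where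
  "enum_ok st e \<longleftrightarrow> arr st ''oc'' e = cd (vec e) \<and> arr st ''ol'' e = load pm (vec e) \<and>
     (0 < e \<longrightarrow> arr st ''op'' e < e \<and> arr st ''ov'' e \<in> V \<and>
       vec e = add_unit (arr st ''ov'' e) (vec (arr st ''op'' e)))"

lemma cd_add_unit:
  assumes "v \<in> V"
  shows "cd (add_unit v x) = cd x + radix V B (v - 1)"
proof -
  have "(\<lambda>u. if u = v then 1 else 0) = (\<lambda>_. 0)(v := 1)" by auto
  then have "code V B pm (\<lambda>u. if u = v then 1 else 0) = code V B pm ((\<lambda>_. 0)(v := 1))"
    by (rule arg_cong)
  also have "\<dots> = 1 * radix V B (v - 1)"
    using assms V_sub by (intro code_unit) auto
  finally show ?thesis by (simp only: cd_def add_unit_def code_add mult_1)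
qed

lemma load_add_unit:
  assumes "v \<in> {1..P}"
  shows "load P (add_unit v x) = load P x + v"
  unfolding load_add add_unit_def using assms
  by (simp add: load_def if_distrib[of "\<lambda>c. _ * c"] cong: if_cong)

lemma enum_ok_0: "arr st ''oc'' 0 = 0 \<Longrightarrow> arr st ''ol'' 0 = 0 \<Longrightarrow> enum_ok st 0"
proof -
  have "vec 0 = (\<lambda>_. 0)" using digits_extend[of "E + 1" 0 V 0 pm] by (simp add: vec_def)
  then show "arr st ''oc'' 0 = 0 \<Longrightarrow> arr st ''ol'' 0 = 0 \<Longrightarrow> enum_ok st 0"
    by (simp add: enum_ok_def cd_def code_zero load_def)
qed

text \<open>A further size multiplies the number of listed vectors by \<open>E + 1\<close>; each new
  vector refers back by \<open>radix V (E + 1) v\<close> places, where its last digit is one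
  smaller.\<close>

lemma run_enum_step:
  assumes v: "Suc v \<in> V" "reg st ''v'' = Suc v" "reg st ''k'' = radix V (E + 1) v" "reg st ''l'' = radix V (E + 1) v"
    "reg st ''r'' = radix V (E + 1) (Suc v)" "reg st ''Z'' = radix V B v"
    and ok: "\<And>e. e < radix V (E + 1) v \<Longrightarrow> enum_ok st e"
  shows "run enum_step st (\<lambda>t st'. t \<le> 200 * U \<and> reg st' ''l'' = radix V (E + 1) (Suc v) \<and>
    (\<forall>e<radix V (E + 1) (Suc v). enum_ok st' e))"
  unfolding enum_step_def
proof (rule run_while[where U = U and C = 40 and k = 0 and \<mu> = "\<lambda>st. radix V (E + 1) (Suc v) - reg st ''l''" and
    I = "\<lambda>st. radix V (E + 1) v \<le> reg st ''l'' \<and> reg st ''l'' \<le> radix V (E + 1) (Suc v) \<and>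
      (\<forall>e<reg st ''l''. enum_ok st e)"], goal_cases)
  case 1
  then show ?case using assms radix_mono[of "E + 1" v "Suc v" V] by auto
next
  case 2
  then show ?case by (rule U_bounds)
next
  case 3
  have "Suc v \<le> pm" using v(1) V_sub by auto
  then have "radix V (E + 1) (Suc v) \<le> len" unfolding len_def by (rule radix_mono[rotated]) simp
  then show ?case using U_bounds(10) by linarith
next
  case (4 st1)
  define e where "e = reg st1 ''l''"
  let ?k = "radix V (E + 1) v"
  have vp: "Suc v \<le> pm" using v(1) V_sub by auto
  have e: "?k \<le> e" "e < radix V (E + 1) (Suc v)" using 4 v by (auto simp: e_def same_def)
  have "0 < ?k" by (rule radix_pos) simp
  then have ek: "e - ?k < e" using e by simp
  have ve: "vec e = add_unit (Suc v) (vec (e - ?k))"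
    unfolding vec_def add_unit_def using digits_step[OF _ v(1) e vp] by simp
  have 1: "enum_ok st1 (e - ?k)" using 4 ek by (simp add: e_def)
  have r: "reg st1 ''k'' = ?k" "reg st1 ''v'' = Suc v" "reg st1 ''Z'' = radix V B v" "reg st1 ''l'' = e"
    using 4 v by (auto simp: same_def e_def)
  have "enum_ok st1 e'" if "e' < e" for e' using 4 that by (simp add: e_def)
  then show ?case using e 1 ek v(1) ve vp
    by (auto simp: run_simps r enum_ok_def cd_add_unit load_add_unit less_Suc_eq)
next
  case (5 t st1)
  then have "reg st1 ''l'' = radix V (E + 1) (Suc v)" using v by (auto simp: same_def)
  then show ?case using 5 U_bounds(1) by simp
qed

lemma run_enumerate:
  assumes "reg st ''P'' = pm" "reg st ''E'' = E" "reg st ''B'' = B" "arr st ''c'' = cnt"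
    "arr st ''oc'' 0 = 0" "arr st ''ol'' 0 = 0"
  shows "run enumerate st (\<lambda>t st'. t \<le> 4000 * U ^ 2 \<and> reg st' ''l'' = len \<and> reg st' ''Z'' = radix V B pm \<and>
    (\<forall>e<len. enum_ok st' e) \<and> (\<forall>v\<in>V. arr st' ''w'' v = radix V B (v - 1)))"
  unfolding enumerate_def run_simps
proof (rule run_while[where U = U and C = 800 and k = 1 and \<mu> = "\<lambda>st. pm + 1 - reg st ''v''" and
    I = "\<lambda>st. \<exists>v\<le>pm. reg st ''v'' = Suc v \<and> reg st ''l'' = radix V (E + 1) v \<and> reg st ''Z'' = radix V B v \<and>
      reg st ''e'' = E + 1 \<and> (\<forall>e<radix V (E + 1) v. enum_ok st e) \<and>
      (\<forall>u\<in>V. u \<le> v \<longrightarrow> arr st ''w'' u = radix V B (u - 1))"], goal_cases)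
  case 1
  then show ?case using assms V_sub by (auto simp: enum_ok_0 intro!: exI[of _ 0] dest: subsetD)
next
  case 2
  then show ?case by (rule U_bounds)
next
  case 3
  then show ?case using U_bounds by simp
next
  case (4 st1)
  then obtain v where v: "reg st1 ''v'' = Suc v" "reg st1 ''l'' = radix V (E + 1) v" "reg st1 ''Z'' = radix V B v"
    "reg st1 ''e'' = E + 1" "\<forall>e<radix V (E + 1) v. enum_ok st1 e"
    "\<forall>u\<in>V. u \<le> v \<longrightarrow> arr st1 ''w'' u = radix V B (u - 1)" by blast
  have st1: "reg st1 ''P'' = pm" "reg st1 ''B'' = B" "arr st1 ''c'' = cnt"
    using 4(2) assms by (auto simp: same_def)
  have vp: "Suc v \<le> pm" using 4(3) v st1 by simp
  show ?case
  proof (cases "Suc v \<in> V")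
    case False
    then have "cnt (Suc v) = 0" using cnt_pos_iff[of "Suc v"] by simp
    then show ?thesis using v st1 vp False U_bounds(1)
      by (auto simp: run_simps le_Suc_eq enum_ok_def intro!: exI[of _ "Suc v"])
  next
    case True
    then have c: "0 < cnt (Suc v)" using cnt_pos_iff by simp
    show ?thesis
      apply (simp add: run_simps v st1 c)
      apply (rule run_mul[where U = U], simp, simp, rule U_bounds)
      subgoal using U_bounds(8) by (simp add: v)
      apply (rule run_conseq[OF run_enum_step[of v]])
      subgoal using True .
      subgoal by (simp add: v)
      subgoal by (simp add: v)
      subgoal by (simp add: v)
      subgoal using True by (simp add: v)
      subgoal by (simp add: v)
      subgoal using v(5) by (simp add: enum_ok_def)
      apply (rule run_mul[where U = U], simp, simp, rule U_bounds)
      subgoal using U_bounds(9) by (simp add: st1 same_def)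
      using U_bounds(1) True vp v
      apply (simp add: run_simps st1 same_def)
      apply (auto simp: enum_ok_def le_Suc_eq intro!: exI[of _ "Suc v"])
      done
  qed
next
  case (5 t st1)
  then obtain v where v: "v \<le> pm" "reg st1 ''v'' = Suc v" "reg st1 ''l'' = radix V (E + 1) v" "reg st1 ''Z'' = radix V B v"
    "reg st1 ''e'' = E + 1" "\<forall>e<radix V (E + 1) v. enum_ok st1 e"
    "\<forall>u\<in>V. u \<le> v \<longrightarrow> arr st1 ''w'' u = radix V B (u - 1)" by blast
  have "reg st1 ''P'' = pm" using 5(2) assms by (auto simp: same_def)
  then have "v = pm" using 5(3) v by simp
  moreover have "t \<le> 1612 * U\<^sup>2" using 5(4) by (simp add: power2_eq_square)
  then have "t + 10 \<le> 4000 * U\<^sup>2" using U_power[of 2] by linarith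
  ultimately show ?case using v V_sub by (auto simp: len_def)
qed

text \<open>By linearity of the code the target is a sum of place values over the jobs, which one
  scan computes.\<close>

lemma cd_cnt: "cd cnt = (\<Sum>j=1..n. radix V B (p j - 1))"
proof -
  have "cnt v = (\<Sum>j=1..n. ((\<lambda>_. 0)(p j := 1)) v)" for v
  proof -
    have "cnt v = (\<Sum>j\<in>{j\<in>{1..n}. p j = v}. 1)" by (simp add: cnt_def)
    also have "\<dots> = (\<Sum>j=1..n. if p j = v then 1 else 0)" by (rule sum.inter_filter) simp
    also have "\<dots> = (\<Sum>j=1..n. ((\<lambda>_. 0)(p j := 1)) v)" by (intro sum.cong) auto
    finally show ?thesis .
  qed
  then have "cd cnt = code V B pm (\<lambda>v. \<Sum>j=1..n. ((\<lambda>_. 0)(p j := 1)) v)" unfolding cd_def by presburger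
  also have "\<dots> = (\<Sum>j=1..n. code V B pm ((\<lambda>_. 0)(p j := 1)))" by (rule code_sum) simp
  also have "\<dots> = (\<Sum>j=1..n. radix V B (p j - 1))"
  proof (rule sum.cong[OF refl])
    fix j assume "j \<in> {1..n}"
    then have "p j \<in> V" by (simp add: V_def)
    then show "code V B pm ((\<lambda>_. 0)(p j := 1)) = radix V B (p j - 1)"
      using V_sub code_unit[of "p j" V pm B 1] by auto
  qed
  finally show ?thesis .
qed

lemma run_target:
  assumes "input st" "reg st ''N'' = 0" "\<forall>v\<in>V. arr st ''w'' v = radix V B (v - 1)"
  shows "run target st (\<lambda>t st'. t \<le> 100 * U \<and> reg st' ''N'' = cd cnt)"
  unfolding target_def run_simps
proof (rule run_while[where U = U and C = 40 and k = 0 and \<mu> = "\<lambda>st. n + 1 - reg st ''j''" and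
    I = "\<lambda>st. 1 \<le> reg st ''j'' \<and> reg st ''j'' \<le> n + 1 \<and>
      reg st ''N'' = (\<Sum>j\<in>{1..<reg st ''j''}. radix V B (p j - 1))"], goal_cases)
  case 1
  then show ?case using assms by simp
next
  case 2
  then show ?case by (rule U_bounds)
next
  case 3
  then show ?case using U_bounds by simp
next
  case (4 st1)
  define j where "j = reg st1 ''j''"
  from 4 assms have j: "1 \<le> j" "j \<le> n" "arr st1 ''p'' j = p j"
    by (auto simp: j_def input_def same_def)
  then have "p j \<in> V" by (simp add: V_def)
  then have "arr st1 ''w'' (p j) = radix V B (p j - 1)" using 4 assms by (auto simp: same_def)
  then show ?case using 4 j by (auto simp: run_simps j_def[symmetric])
next
  case (5 t st1)
  then have j: "reg st1 ''j'' = n + 1" using assms by (auto simp: input_def same_def)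
  then show ?case using 5 U_bounds(1)
    by (simp add: cd_cnt atLeastLessThanSuc_atLeastAtMost del: sum.op_ivl_Suc)
qed

end

section \<open>Virtual machines of a guess\<close>

definition push_part :: "aexp \<Rightarrow> com" where
  "push_part e = Put ''ku'' (Reg ''M'') e ;; Put ''ru'' (Reg ''M'') (Reg ''i'') ;; incr ''M''"

text \<open>The quotient \<open>L * s i div s i0\<close> can be as large as the speeds, so the
  repeated subtraction is cut off at the total processing time. This computes exactly the minimum in
  \<open>cap\<close>.\<close>

definition capacity :: com where
  "capacity =
     Assign ''u'' (Get ''s'' (Reg ''i'')) ;; mul ''r'' ''u'' ''L'' ;; Assign ''g'' (Const 0) ;;
     While (And (Less (Reg ''g'') (Reg ''S'')) (Not (Less (Reg ''r'') (Reg ''t''))))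
      (Assign ''r'' (Minus (Reg ''r'') (Reg ''t'')) ;; incr ''g'')"

definition split_capacity :: com where
  "split_capacity =
     While (Not (Less (Reg ''g'') (Reg ''h'')))
      (push_part (Reg ''Q'') ;; Assign ''g'' (Minus (Reg ''g'') (Reg ''Q''))) ;;
     push_part (Reg ''g'')"

definition split_machines :: com where
  "split_machines =
     mul ''Q'' ''q'' ''a'' ;; Assign ''M'' (Const 0) ;; Assign ''i'' (Const 1) ;;
     Assign ''t'' (Get ''s'' (Reg ''I'')) ;;
     While (Less (Reg ''i'') (Plus (Reg ''m'') (Const 1)))
      (capacity ;; split_capacity ;; incr ''i'')"

lemma mods_push_part [simp]: "mod_regs (push_part e) = [''M'']" "mod_arrs (push_part e) = [''ku'', ''ru'']"
  by (auto simp: push_part_def)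

lemma mods_capacity [simp]: "set (mod_regs capacity) = {''u'', ''r'', ''z'', ''g''}" "mod_arrs capacity = []"
  by (auto simp: capacity_def)

lemma mods_split_capacity [simp]:
  "set (mod_regs split_capacity) = {''M'', ''g''}" "set (mod_arrs split_capacity) = {''ku'', ''ru''}"
  by (auto simp: split_capacity_def)

lemma mods_split_machines [simp]:
  "set (mod_regs split_machines) = {''Q'', ''z'', ''M'', ''i'', ''t'', ''u'', ''r'', ''g''}"
  "set (mod_arrs split_machines) = {''ku'', ''ru''}"
  by (auto simp: split_machines_def)

context scheduling
begin

lemma run_capacity:
  assumes "input st" "reg st ''S'' = tot" "reg st ''L'' = L" "L \<le> tot" "reg st ''i'' = i" "i \<in> {1..m}"
    "reg st ''t'' = s i0" "i0 \<in> {1..m}"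
  shows "run capacity st (\<lambda>t st'. t \<le> 300 * U \<and> reg st' ''g'' = cap L i0 i)"
proof -
  have si: "arr st ''s'' i = s i" using assms by (simp add: input_def)
  have s0: "0 < s i0" using s_pos assms by fastforce
  show ?thesis
    unfolding capacity_def run_Seq
    apply (simp add: run_simps assms si)
    apply (rule run_mul[where U = U], simp, simp, rule U_bounds)
    subgoal using U_bounds(4) assms by simp
    apply (simp add: run_simps assms si)
  proof (rule run_while[where U = U and C = 40 and k = 0 and \<mu> = "\<lambda>st. tot - reg st ''g''" and
      I = "\<lambda>st. reg st ''g'' \<le> tot \<and> reg st ''g'' * s i0 + reg st ''r'' = L * s i"], goal_cases)
    case (1 t)
    then show ?case by simp
  next
    case 2
    show ?case by (rule U_bounds)
  next
    case 3
    then show ?case using U_bounds(4) by simp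
  next
    case (4 t st1)
    then have st1: "reg st1 ''S'' = tot" "reg st1 ''t'' = s i0" using assms by (auto simp: same_def)
    have "reg st1 ''g'' < tot" "s i0 \<le> reg st1 ''r''" "reg st1 ''g'' * s i0 + reg st1 ''r'' = L * s i"
      using 4(2,4) st1 by auto
    then show ?case using U_bounds(1) by (simp add: run_simps st1)
  next
    case (5 t t' st1)
    then have st1: "reg st1 ''S'' = tot" "reg st1 ''t'' = s i0" using assms by (auto simp: same_def)
    have eq: "L * s i = reg st1 ''g'' * s i0 + reg st1 ''r''" and le: "reg st1 ''g'' \<le> tot" using 5 by auto
    have "reg st1 ''g'' = cap L i0 i"
    proof (cases "reg st1 ''g'' = tot")
      case True
      have "tot * s i0 div s i0 \<le> L * s i div s i0" unfolding eq True by (intro div_le_mono) simp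
      then show ?thesis using True s0 by (simp add: cap_def)
    next
      case False
      then have "reg st1 ''r'' < s i0" using 5 st1 le by simp
      then have "L * s i div s i0 = reg st1 ''g''" unfolding eq using s0 by simp
      then show ?thesis using le by (simp add: cap_def)
    qed
    then show ?case using 5 U_bounds(1) by simp
  qed
qed

definition holds_machines :: "state \<Rightarrow> (nat \<times> nat) list \<Rightarrow> bool" where
  "holds_machines st xs \<longleftrightarrow> reg st ''M'' = length xs \<and> holds_list (arr st ''ku'') (map fst xs) \<and>
     holds_list (arr st ''ru'') (map snd xs)"

lemma run_push_part:
  assumes "holds_machines st xs" "reg st ''i'' = i" "aval e (st\<lparr>arr := arr st\<rparr>) = \<kappa>"
  shows "run (push_part e) st (\<lambda>t st'. t \<le> acost e + 20 \<and> holds_machines st' (xs @ [(\<kappa>, i)]))"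
  using assms holds_list_snoc[of "arr st ''ku''" "map fst xs" \<kappa>] holds_list_snoc[of "arr st ''ru''" "map snd xs" i]
  unfolding push_part_def by (simp add: run_simps holds_machines_def)

lemma run_split_capacity:
  assumes "holds_machines st xs" "reg st ''i'' = i" "reg st ''h'' = h" "reg st ''Q'' = b" "0 < b" "b < h"
    "reg st ''g'' = g" "g \<le> tot"
  shows "run split_capacity st (\<lambda>t st'. t \<le> 300 * U \<and> holds_machines st' (xs @ map (\<lambda>\<kappa>. (\<kappa>, i)) (parts h b g)))"
  unfolding split_capacity_def run_Seq
proof (rule run_while[where U = U and C = 60 and k = 0 and \<mu> = "\<lambda>st. reg st ''g''" and
    I = "\<lambda>st. \<exists>ys. holds_machines st (xs @ map (\<lambda>\<kappa>. (\<kappa>, i)) ys) \<and> ys @ parts h b (reg st ''g'') = parts h b g"], goal_cases)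
  case 1
  then show ?case using assms by (auto intro!: exI[of _ "[]"])
next
  case 2
  show ?case by (rule U_bounds)
next
  case 3
  then show ?case using U_bounds(4) assms by simp
next
  case (4 st1)
  then obtain ys where ys: "holds_machines st1 (xs @ map (\<lambda>\<kappa>. (\<kappa>, i)) ys)"
    "ys @ parts h b (reg st1 ''g'') = parts h b g" by blast
  have r: "reg st1 ''i'' = i" "reg st1 ''h'' = h" "reg st1 ''Q'' = b" using 4(2) assms by (auto simp: same_def)
  have g: "h \<le> reg st1 ''g''" using 4(3) r by simp
  then have p: "parts h b (reg st1 ''g'') = b # parts h b (reg st1 ''g'' - b)"
    using assms by (subst parts.simps) simp
  show ?case
    apply (simp only: run_Seq)
    apply (rule run_conseq[OF run_push_part[OF ys(1) r(1)]], rule refl)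
    using g assms r ys(2) p
    apply (simp add: run_simps same_def)
    apply (rule exI[of _ "ys @ [b]"])
    apply (simp add: holds_machines_def)
    done
next
  case (5 t st1)
  then obtain ys where ys: "holds_machines st1 (xs @ map (\<lambda>\<kappa>. (\<kappa>, i)) ys)"
    "ys @ parts h b (reg st1 ''g'') = parts h b g" by blast
  have r: "reg st1 ''i'' = i" "reg st1 ''h'' = h" "reg st1 ''Q'' = b" using 5(2) assms by (auto simp: same_def)
  have g: "reg st1 ''g'' < h" using 5(3) r by simp
  then have p: "parts h b (reg st1 ''g'') = [reg st1 ''g'']"
    by (subst parts.simps) simp
  show ?case
    apply (rule run_conseq[OF run_push_part[OF ys(1) r(1)]], rule refl)
    using 5(4) U_bounds(1) ys(2)[symmetric] p by auto
qed

lemma run_split_machines: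
  assumes "input st" "reg st ''S'' = tot" "reg st ''L'' = L" "L \<le> tot" "reg st ''I'' = i0" "i0 \<in> {1..m}"
    "reg st ''h'' = h" "reg st ''q'' = 2 * pm\<^sup>2" "reg st ''a'' = a" "a \<in> {1..pm}"
  shows "run split_machines st (\<lambda>t st'. t \<le> 4000 * U ^ 2 \<and> holds_machines st' (vl L i0 a))"
proof -
  let ?b = "a * (2 * pm\<^sup>2)"
  have s0: "arr st ''s'' i0 = s i0" using assms by (simp add: input_def)
  show ?thesis
    unfolding split_machines_def run_Seq
    apply (rule run_mul[where U = U], simp, simp, rule U_bounds)
    subgoal using U_bounds(5) assms by simp
    apply (simp add: run_simps assms s0)
  proof (rule run_while[where U = U and C = 700 and k = 1 and \<mu> = "\<lambda>st. m + 1 - reg st ''i''" and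
      I = "\<lambda>st. \<exists>i\<le>m. reg st ''i'' = Suc i \<and> holds_machines st (virtual_machines h ?b (cap L i0) i)"], goal_cases)
    case (1 t)
    then show ?case by (auto simp: holds_machines_def virtual_machines_0 holds_list_def intro!: exI[of _ 0])
  next
    case 2
    show ?case by (rule U_bounds)
  next
    case 3
    then show ?case using U_bounds(3) by simp
  next
    case (4 t st1)
    then obtain i where i: "reg st1 ''i'' = Suc i" "holds_machines st1 (virtual_machines h ?b (cap L i0) i)" by blast
    have inp: "input st1" using assms(1) 4(3) by (auto simp: input_def same_def)
    have r: "reg st1 ''S'' = tot" "reg st1 ''L'' = L" "reg st1 ''t'' = s i0" "reg st1 ''h'' = h" "reg st1 ''Q'' = ?b"
      using 4(3) assms by (auto simp: same_def mult.commute)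
    have im: "Suc i \<in> {1..m}" using 4(4) i inp by (simp add: input_def)
    show ?case
      apply (simp only: run_Seq)
      apply (rule run_conseq[OF run_capacity[OF inp r(1,2) assms(4) i(1) im r(3) assms(6)]])
      apply (rule run_conseq[OF run_split_capacity[of _ "virtual_machines h ?b (cap L i0) i" "Suc i" ?b "cap L i0 (Suc i)"]])
      subgoal using i by (simp add: same_def holds_machines_def)
      subgoal using i by (simp add: same_def)
      subgoal using r by (simp add: same_def)
      subgoal using r by (simp add: same_def)
      subgoal using part_size[OF assms(10)] by simp
      subgoal using part_size[OF assms(10)] by simp
      subgoal by simp
      subgoal by (simp add: cap_def)
      using im i(1) U_bounds(1)
      apply (auto simp: run_simps same_def virtual_machines_Suc holds_machines_def intro!: exI[of _ "Suc i"])
      done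
  next
    case (5 t t' st1)
    then obtain i where i: "i \<le> m" "reg st1 ''i'' = Suc i" "holds_machines st1 (virtual_machines h ?b (cap L i0) i)" by blast
    have "reg st1 ''m'' = m" using assms(1) 5(3) by (auto simp: input_def same_def)
    then have "i = m" using i 5(4) by simp
    moreover have "t' \<le> 1412 * U\<^sup>2" using 5(5) by (simp add: power2_eq_square)
    then have "t + t' + 20 \<le> 4000 * U\<^sup>2" using 5(1) U_power[of 2] cost_mono[OF U_bounds(1), of 1 2 100] by simp
    ultimately show ?case using i by (simp add: vl_def)
  qed
qed

end

section \<open>Computing the spread order\<close>

definition slot_of :: com where
  "slot_of =
     Assign ''x'' (Const 0) ;; Assign ''y'' (Const 0) ;; Assign ''w'' (Const 0) ;;
     While (Less (Reg ''w'') (Reg ''M''))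
      (If (And (Not (Less (Get ''ku'' (Reg ''w'')) (Get ''ku'' (Reg ''u'')))) (Not (Less (Get ''ku'' (Reg ''u'')) (Get ''ku'' (Reg ''w'')))))
        (incr ''x'' ;; If (Less (Reg ''u'') (Reg ''w'')) Skip (incr ''y'')) Skip ;;
       incr ''w'') ;;
     mul ''r'' ''y'' ''M'' ;; div_mod ''g'' ''r'' ''x'' ;; Put ''tm'' (Reg ''u'') (Reg ''g'')"

definition slots :: com where
  "slots = Assign ''u'' (Const 0) ;;
     While (Less (Reg ''u'') (Reg ''M'')) (slot_of ;; incr ''u'')"

definition order_slot :: com where
  "order_slot = Assign ''u'' (Const 0) ;;
     While (Less (Reg ''u'') (Reg ''M''))
      (If (And (Not (Less (Get ''tm'' (Reg ''u'')) (Reg ''t''))) (Not (Less (Reg ''t'') (Get ''tm'' (Reg ''u'')))))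
        (Put ''sq'' (Reg ''k'') (Reg ''u'') ;; incr ''k'') Skip ;;
       incr ''u'')"

definition order_machines :: com where
  "order_machines = slots ;; Assign ''k'' (Const 0) ;; Assign ''t'' (Const 0) ;;
     While (Less (Reg ''t'') (Plus (Reg ''M'') (Const 1))) (order_slot ;; incr ''t'')"

lemma mods_slot_of [simp]: "set (mod_regs slot_of) = {''x'', ''y'', ''w'', ''r'', ''z'', ''g''}" "mod_arrs slot_of = [''tm'']"
  by (auto simp: slot_of_def)

lemma mods_slots [simp]: "set (mod_regs slots) = {''u'', ''x'', ''y'', ''w'', ''r'', ''z'', ''g''}" "mod_arrs slots = [''tm'']"
  by (auto simp: slots_def)

lemma mods_order_slot [simp]: "set (mod_regs order_slot) = {''u'', ''k''}" "mod_arrs order_slot = [''sq'']"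
  by (auto simp: order_slot_def)

lemma mods_order_machines [simp]:
  "set (mod_regs order_machines) = {''u'', ''x'', ''y'', ''w'', ''r'', ''z'', ''g'', ''k'', ''t''}"
  "set (mod_arrs order_machines) = {''tm'', ''sq''}"
  by (auto simp: order_machines_def)

context scheduling
begin

lemma run_slot_of:
  assumes M: "reg st ''M'' = length K" "length K \<le> A" and K: "holds_list (arr st ''ku'') K"
    and u: "reg st ''u'' = u" "u < length K"
  shows "run slot_of st (\<lambda>t st'. t \<le> 500 * U \<and> arr st' ''tm'' = (arr st ''tm'')(u := slot K u))"
proof -
  have MU: "length K \<le> U" using M(2) U_bounds(11) by simp
  show ?thesis
    unfolding slot_of_def run_Seq
    apply (simp only: run_simps)
  proof (rule run_while[where U = U and C = 60 and k = 0 and \<mu> = "\<lambda>st. length K - reg st ''w''" and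
      I = "\<lambda>st. reg st ''w'' \<le> length K \<and>
        reg st ''x'' = card {w. w < reg st ''w'' \<and> K ! w = K ! u} \<and>
        reg st ''y'' = card {w. w < reg st ''w'' \<and> K ! w = K ! u \<and> w \<le> u}"], goal_cases)
    case 1
    then show ?case by simp
  next
    case 2
    show ?case by (rule U_bounds)
  next
    case 3
    then show ?case using MU by simp
  next
    case (4 st1)
    define w where "w = reg st1 ''w''"
    have st1: "reg st1 ''M'' = length K" "reg st1 ''u'' = u" "arr st1 ''ku'' = arr st ''ku''"
      using 4(2) M u by (auto simp: same_def)
    have w: "w < length K" using 4(3) st1 by (simp add: w_def)
    have k: "arr st ''ku'' w = K ! w" "arr st ''ku'' u = K ! u"
      using K w u(2) st1 by (auto simp: holds_list_def)
    have "{x. x < Suc w \<and> Q x} = (if Q w then insert w {x. x < w \<and> Q x} else {x. x < w \<and> Q x})" for Q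
      by (auto simp: less_Suc_eq)
    then have c: "card {x. x < Suc w \<and> Q x} = card {x. x < w \<and> Q x} + (if Q w then 1 else 0)" for Q
      by simp
    show ?case using 4(1) w
      by (auto simp: run_simps st1 k w_def[symmetric] c)
  next
    case (5 t st1)
    have st1: "reg st1 ''M'' = length K" "reg st1 ''u'' = u" "arr st1 ''tm'' = arr st ''tm''"
      using 5(2) M u by (auto simp: same_def)
    have w: "reg st1 ''w'' = length K" using 5(1,3) st1 by simp
    have x: "reg st1 ''x'' = card (kind K (K ! u))" using 5(1) w by (simp add: kind_def)
    have y: "reg st1 ''y'' = rank K u" using 5(1) w by (simp add: rank_def kind_def conj_assoc)
    have "u \<in> kind K (K ! u)" using u by (simp add: kind_def)
    then have "0 < card (kind K (K ! u))" by (auto simp: card_gt_0_iff)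
    moreover have "rank K u \<le> card {..<length K}"
      unfolding rank_def by (intro card_mono) (auto simp: kind_def)
    then have "rank K u * length K \<le> A * A" using M(2) by (intro mult_le_mono) auto
    then have "rank K u * length K \<le> U" using U_bounds(13) by linarith
    ultimately show ?case
      apply -
      apply (rule run_mul[where U = U], simp, simp, rule U_bounds)
      subgoal using MU by (simp add: st1)
      apply (rule run_div_mod[where U = U], simp, rule U_bounds)
      subgoal by (simp add: st1 x y)
      subgoal by (simp add: st1 x y)
      using 5(4) U_bounds(1) st1 by (simp add: run_simps x y slot_def)
  qed
qed

lemma run_slots:
  assumes M: "reg st ''M'' = length K" "length K \<le> A" and K: "holds_list (arr st ''ku'') K"
  shows "run slots st (\<lambda>t st'. t \<le> 1200 * U ^ 2 \<and> (\<forall>u<length K. arr st' ''tm'' u = slot K u))"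
  unfolding slots_def run_simps
proof (rule run_while[where U = U and C = 520 and k = 1 and \<mu> = "\<lambda>st. length K - reg st ''u''" and
    I = "\<lambda>st. reg st ''u'' \<le> length K \<and> (\<forall>u<reg st ''u''. arr st ''tm'' u = slot K u)"], goal_cases)
  case 1
  then show ?case by simp
next
  case 2
  show ?case by (rule U_bounds)
next
  case 3
  then show ?case using M(2) U_bounds(11) by simp
next
  case (4 st1)
  have st1: "reg st1 ''M'' = length K" "arr st1 ''ku'' = arr st ''ku''"
    using 4(2) M by (auto simp: same_def)
  have u: "reg st1 ''u'' < length K" using 4(3) st1 by simp
  show ?case
    apply (simp only: run_Seq)
    apply (rule run_conseq[OF run_slot_of[of st1 K, OF st1(1) M(2) _ refl u]])
    subgoal using K st1 by simp
    using 4(1) u U_bounds(1) by (auto simp: run_simps same_def less_Suc_eq)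
next
  case (5 t st1)
  have "reg st1 ''M'' = length K" using 5(2) M by (auto simp: same_def)
  moreover have "t \<le> 1048 * U\<^sup>2" using 5(4) by (simp add: power2_eq_square)
  then have "t + 10 \<le> 1200 * U\<^sup>2" using U_power[of 2] by linarith
  ultimately show ?case using 5(1,3) by simp
qed

lemma run_order_slot:
  assumes M: "reg st ''M'' = length K" "length K \<le> A" and tm: "\<forall>u<length K. arr st ''tm'' u = slot K u"
    and xs: "holds_list (arr st ''sq'') xs" "reg st ''k'' = length xs" and t: "reg st ''t'' = i"
  shows "run order_slot st (\<lambda>t st'. t \<le> 200 * U \<and>
    holds_list (arr st' ''sq'') (xs @ filter (\<lambda>u. slot K u = i) [0..<length K]) \<and>
    reg st' ''k'' = length (xs @ filter (\<lambda>u. slot K u = i) [0..<length K]))"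
  unfolding order_slot_def run_simps
proof (rule run_while[where U = U and C = 60 and k = 0 and \<mu> = "\<lambda>st. length K - reg st ''u''" and
    I = "\<lambda>st. reg st ''u'' \<le> length K \<and>
      holds_list (arr st ''sq'') (xs @ filter (\<lambda>u. slot K u = i) [0..<reg st ''u'']) \<and>
      reg st ''k'' = length (xs @ filter (\<lambda>u. slot K u = i) [0..<reg st ''u''])"], goal_cases)
  case 1
  then show ?case using xs by simp
next
  case 2
  show ?case by (rule U_bounds)
next
  case 3
  then show ?case using M(2) U_bounds(11) by simp
next
  case (4 st1)
  have st1: "reg st1 ''M'' = length K" "reg st1 ''t'' = i" "arr st1 ''tm'' = arr st ''tm''"
    using 4(2) M t by (auto simp: same_def)
  define u where "u = reg st1 ''u''"
  have u: "u < length K" using 4(3) st1 by (simp add: u_def)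
  then have "arr st1 ''tm'' u = slot K u" using tm st1 by simp
  moreover note holds_list_snoc[of "arr st1 ''sq''" "xs @ filter (\<lambda>u. slot K u = i) [0..<u]" u]
  ultimately show ?case using 4(1) u
    by (auto simp: run_simps st1 u_def[symmetric])
next
  case (5 t st1)
  have "reg st1 ''M'' = length K" using 5(2) M by (auto simp: same_def)
  then have u: "reg st1 ''u'' = length K" using 5(1,3) by simp
  show ?case using 5(1,4) U_bounds(1) unfolding u by simp
qed

lemma run_order_machines:
  assumes M: "reg st ''M'' = length K" "length K \<le> A" and K: "holds_list (arr st ''ku'') K"
  shows "run order_machines st (\<lambda>t st'. t \<le> 3000 * U ^ 2 \<and> holds_list (arr st' ''sq'') (spread_order K))"
  unfolding order_machines_def run_Seq
  apply (rule run_conseq[OF run_slots[OF assms]])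
  apply (simp only: run_simps)
proof (rule run_while[where U = U and C = 230 and k = 1 and \<mu> = "\<lambda>st. length K + 1 - reg st ''t''" and
    I = "\<lambda>st. reg st ''t'' \<le> length K + 1 \<and>
      holds_list (arr st ''sq'') (concat (map (\<lambda>t. filter (\<lambda>u. slot K u = t) [0..<length K]) [0..<reg st ''t''])) \<and>
      reg st ''k'' = length (concat (map (\<lambda>t. filter (\<lambda>u. slot K u = t) [0..<length K]) [0..<reg st ''t'']))"], goal_cases)
  case (1 t st')
  then show ?case by (simp add: holds_list_def)
next
  case 2
  show ?case by (rule U_bounds)
next
  case 3
  then show ?case using M(2) U_bounds(11) by simp
next
  case (4 t st' st1)
  have st1: "reg st1 ''M'' = length K" "arr st1 ''tm'' = arr st' ''tm''"
    using 4(2,4) M by (auto simp: same_def)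
  have tm: "\<forall>u<length K. arr st1 ''tm'' u = slot K u" using 4(1) st1 by simp
  have i: "reg st1 ''t'' < length K + 1" using 4(5) st1 by simp
  show ?case
    apply (simp only: run_Seq)
    apply (rule run_conseq[OF run_order_slot[OF st1(1) M(2) tm, where i = "reg st1 ''t''" and
          xs = "concat (map (\<lambda>t. filter (\<lambda>u. slot K u = t) [0..<length K]) [0..<reg st1 ''t''])"]])
    subgoal using 4(3) by simp
    subgoal using 4(3) by simp
    subgoal by simp
    using 4(3) i U_bounds(1) by (auto simp: run_simps same_def)
next
  case (5 t st' t' st1)
  have "reg st1 ''M'' = length K" using 5(2,4) M by (auto simp: same_def)
  then have "reg st1 ''t'' = length K + 1" using 5(3,5) by simp
  moreover have "t' \<le> 472 * U\<^sup>2" using 5(6) by (simp add: power2_eq_square)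
  then have "t + (t' + 10) \<le> 3000 * U\<^sup>2" using U_power[of 2] 5(1) by linarith
  ultimately show ?case using 5(3) by (simp add: spread_order_def del: upt_Suc)
qed

end

section \<open>Dynamic programming\<close>

text \<open>Layer \<open>k\<close> of the table occupies the \<open>Z\<close> cells of \<open>tab\<close> from address \<open>o\<close> on; a nonzero
  entry is one plus the index of the vector placed on the last machine. Each layer uses fresh
  cells, which saves clearing the table between guesses.\<close>

definition lower_corner :: com where
  "lower_corner = Assign ''f'' (Const 0) ;; Assign ''v'' (Const 1) ;;
     While (Less (Reg ''v'') (Plus (Reg ''P'') (Const 1)))
      (If (Less (Const 0) (Get ''c'' (Reg ''v'')))
        (Assign ''u'' (Get ''c'' (Reg ''v'')) ;; mul ''r'' ''u'' ''b'' ;; div_mod ''g'' ''r'' ''M'' ;;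
         Assign ''g'' (Minus (Reg ''g'') (Reg ''W'')) ;; Assign ''u'' (Get ''w'' (Reg ''v'')) ;;
         mul ''r'' ''u'' ''g'' ;; Assign ''f'' (Plus (Reg ''f'') (Reg ''r'')))
        Skip ;;
       incr ''v'')"

definition fill_cell :: com where
  "fill_cell = Assign ''y'' (Plus (Reg ''f'') (Get ''oc'' (Reg ''j''))) ;; Assign ''e'' (Const 0) ;;
     While (Less (Reg ''e'') (Reg ''l''))
      (If (And (Not (Less (Reg ''x'') (Get ''ol'' (Reg ''e''))))
            (And (Not (Less (Reg ''y'') (Get ''oc'' (Reg ''e''))))
              (Less (Const 0) (Get ''tab'' (Minus (Plus (Reg ''o'') (Minus (Reg ''y'') (Get ''oc'' (Reg ''e'')))) (Reg ''Z''))))))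
        (Put ''tab'' (Plus (Reg ''o'') (Reg ''y'')) (Plus (Reg ''e'') (Const 1))) Skip ;;
       incr ''e'')"

definition fill_layer :: com where
  "fill_layer = Assign ''j'' (Const 0) ;; While (Less (Reg ''j'') (Reg ''l'')) (fill_cell ;; incr ''j'')"

definition fill_table :: com where
  "fill_table = Assign ''o'' (Plus (Reg ''o'') (Reg ''Z'')) ;; Put ''tab'' (Reg ''o'') (Const 1) ;;
     Assign ''k'' (Const 0) ;;
     While (Less (Reg ''k'') (Reg ''M''))
      (Assign ''b'' (Plus (Reg ''k'') (Const 1)) ;; lower_corner ;;
       Assign ''o'' (Plus (Reg ''o'') (Reg ''Z'')) ;;
       Assign ''x'' (Get ''ku'' (Get ''sq'' (Reg ''k''))) ;;
       fill_layer ;; incr ''k'')"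

lemma mods_lower_corner [simp]:
  "set (mod_regs lower_corner) = {''f'', ''v'', ''u'', ''r'', ''z'', ''g''}" "mod_arrs lower_corner = []"
  by (auto simp: lower_corner_def)

lemma mods_fill_cell [simp]: "set (mod_regs fill_cell) = {''y'', ''e''}" "mod_arrs fill_cell = [''tab'']"
  by (auto simp: fill_cell_def)

lemma mods_fill_layer [simp]: "set (mod_regs fill_layer) = {''j'', ''y'', ''e''}" "mod_arrs fill_layer = [''tab'']"
  by (auto simp: fill_layer_def)

lemmas mods_fill_table [simp] =
  arg_cong[OF fill_table_def, of "\<lambda>c. set (mod_regs c)", simplified]
  arg_cong[OF fill_table_def, of "\<lambda>c. set (mod_arrs c)", simplified]

context scheduling
begin

definition "Z = radix V B pm"

definition prepared :: "state \<Rightarrow> bool" where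
  "prepared st \<longleftrightarrow> input st \<and> reg st ''S'' = tot \<and> reg st ''P'' = pm \<and> arr st ''c'' = cnt \<and>
     reg st ''q'' = 2 * pm\<^sup>2 \<and> reg st ''h'' = h \<and> reg st ''W'' = W \<and>
     reg st ''l'' = len \<and> reg st ''Z'' = Z \<and> (\<forall>e<len. enum_ok st e) \<and>
     (\<forall>v\<in>V. arr st ''w'' v = radix V B (v - 1)) \<and> reg st ''N'' = cd cnt"

lemma prepared_same:
  assumes "prepared st" "same R X st st'"
    and "set R \<inter> {''n'', ''m'', ''S'', ''P'', ''q'', ''h'', ''W'', ''l'', ''Z'', ''N''} = {}"
    and "set X \<inter> {''p'', ''s'', ''c'', ''oc'', ''ol'', ''op'', ''ov'', ''w''} = {}"
  shows "prepared st'"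
proof -
  have r: "reg st' x = reg st x" if "x \<in> {''n'', ''m'', ''S'', ''P'', ''q'', ''h'', ''W'', ''l'', ''Z'', ''N''}" for x
    using assms(2,3) that unfolding same_def by blast
  have a: "arr st' x = arr st x" if "x \<in> {''p'', ''s'', ''c'', ''oc'', ''ol'', ''op'', ''ov'', ''w''}" for x
    using assms(2,4) that unfolding same_def by blast
  show ?thesis using assms(1) by (simp add: prepared_def input_def enum_ok_def r a)
qed

lemma B_pos: "0 < B"
  by (simp add: B_def)

lemma less_B: "x \<le> n + E \<Longrightarrow> x < B"
  by (simp add: B_def)

lemma Z_pos: "0 < Z"
  unfolding Z_def by (rule radix_pos) (rule B_pos)

lemma cd_less: "(\<And>v. v \<in> V \<Longrightarrow> x v < B) \<Longrightarrow> cd x < Z"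
  unfolding cd_def Z_def by (rule code_less[OF B_pos])

lemma cd_add: "cd (\<lambda>v. x v + y v) = cd x + cd y"
  unfolding cd_def by (rule code_add)

lemma cd_inj:
  assumes "cd x = cd y" "\<And>v. x v < B" "\<And>v. y v < B" "\<And>v. v \<notin> V \<Longrightarrow> x v = 0" "\<And>v. v \<notin> V \<Longrightarrow> y v = 0"
  shows "x = y"
proof
  fix v
  show "x v = y v"
    using code_inj[OF B_pos, of V pm x y v] assms V_sub unfolding cd_def by (cases "v \<in> V") auto
qed

lemma lo_le: "k \<le> M L i0 a \<Longrightarrow> lo L i0 a k v \<le> n"
proof -
  assume k: "k \<le> M L i0 a"
  have "cnt v * k div M L i0 a \<le> cnt v * M L i0 a div M L i0 a"
    using k by (intro div_le_mono) simp
  also have "\<dots> \<le> n" using cnt_le M_pos[of L i0 a] by simp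
  finally show ?thesis by (simp add: lo_def)
qed

lemma box_bounds:
  assumes "k \<le> M L i0 a" "y \<in> box L i0 a k"
  shows "y v \<le> n + E" "v \<notin> V \<Longrightarrow> y v = 0"
  using assms lo_le[of k L i0 a v] unfolding box_def by (auto split: if_splits dest!: spec[of _ v])

lemma reach_bounds:
  assumes "k \<le> M L i0 a" "y \<in> reach L i0 a k"
  shows "y v \<le> n + E" "v \<notin> V \<Longrightarrow> y v = 0"
  using assms box_bounds[of k L i0 a y v] by (cases k; auto)+

lemma box_lo_vec: "e < len \<Longrightarrow> (\<lambda>v. if v \<in> V then lo L i0 a k v + vec e v else 0) \<in> box L i0 a k"
  using vec_le by (auto simp: box_def)

lemma box_obtain:
  assumes "y \<in> box L i0 a k"
  obtains e where "e < len" "y = (\<lambda>v. if v \<in> V then lo L i0 a k v + vec e v else 0)"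
proof -
  have y: "if v \<in> V then lo L i0 a k v \<le> y v \<and> y v \<le> lo L i0 a k v + E else y v = 0" for v
    using assms by (simp add: box_def)
  have "\<exists>e<len. vec e = (\<lambda>v. if v \<in> V then y v - lo L i0 a k v else 0)"
  proof (rule vec_exists)
    fix v show "(if v \<in> V then y v - lo L i0 a k v else 0) \<le> E" using y[of v] by auto
  qed auto
  then obtain e where e: "e < len" "vec e = (\<lambda>v. if v \<in> V then y v - lo L i0 a k v else 0)" by blast
  have "y = (\<lambda>v. if v \<in> V then lo L i0 a k v + vec e v else 0)"
  proof
    fix v show "y v = (if v \<in> V then lo L i0 a k v + vec e v else 0)" using y[of v] e(2) by auto
  qed
  with e(1) that show ?thesis by blast
qed

lemma cd_lo_vec: "cd (\<lambda>v. if v \<in> V then lo L i0 a k v + vec e v else 0) = cd (lo L i0 a k) + cd (vec e)"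
proof -
  have "cd (\<lambda>v. if v \<in> V then lo L i0 a k v + vec e v else 0) = cd (\<lambda>v. lo L i0 a k v + vec e v)"
    unfolding cd_def by (rule code_cong) simp
  then show ?thesis by (simp add: cd_add)
qed

definition last_config :: "nat \<Rightarrow> nat \<Rightarrow> nat \<Rightarrow> nat \<Rightarrow> (nat \<Rightarrow> nat) \<Rightarrow> nat \<Rightarrow> bool" where
  "last_config L i0 a k y e \<longleftrightarrow> e < len \<and> load pm (vec e) \<le> ks L i0 a k \<and>
     (\<exists>z\<in>reach L i0 a k. y = (\<lambda>v. z v + vec e v))"

text \<open>Layer 0 has no last machine, so its entry only marks the zero vector; later entries name
  a possible content of the last machine.\<close>

definition layer_ok :: "nat \<Rightarrow> nat \<Rightarrow> nat \<Rightarrow> nat \<Rightarrow> (nat \<Rightarrow> nat) \<Rightarrow> bool" where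
  "layer_ok L i0 a k f \<longleftrightarrow> (\<forall>v\<in>reach L i0 a k. f (cd v) \<noteq> 0) \<and>
     (\<forall>y<Z. f y \<noteq> 0 \<longrightarrow> (\<exists>v\<in>reach L i0 a k. cd v = y \<and> (0 < k \<longrightarrow> last_config L i0 a (k - 1) v (f y - 1))))"

lemma reach_Suc_iff: "y \<in> reach L i0 a (Suc k) \<longleftrightarrow> y \<in> box L i0 a (Suc k) \<and> (\<exists>e. last_config L i0 a k y e)"
  by (auto simp: last_config_def)

text \<open>Subtracting codes could involve borrows, but a marked cell is the code of a genuine
  vector \<open>z\<close>. As \<open>z\<close> plus \<open>vec e\<close> has entries below
  \<open>B\<close>, equal codes give equal vectors.\<close>

lemma last_config_iff:
  assumes k: "k < M L i0 a" and ok: "layer_ok L i0 a k f" and y: "y \<in> box L i0 a (Suc k)" and e: "e < len"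
  shows "last_config L i0 a k y e \<longleftrightarrow>
    load pm (vec e) \<le> ks L i0 a k \<and> cd (vec e) \<le> cd y \<and> f (cd y - cd (vec e)) \<noteq> 0"
proof
  assume "last_config L i0 a k y e"
  then obtain z where z: "load pm (vec e) \<le> ks L i0 a k" "z \<in> reach L i0 a k" "y = (\<lambda>v. z v + vec e v)"
    by (auto simp: last_config_def)
  then show "load pm (vec e) \<le> ks L i0 a k \<and> cd (vec e) \<le> cd y \<and> f (cd y - cd (vec e)) \<noteq> 0"
    using ok by (simp add: cd_add layer_ok_def)
next
  assume a: "load pm (vec e) \<le> ks L i0 a k \<and> cd (vec e) \<le> cd y \<and> f (cd y - cd (vec e)) \<noteq> 0"
  have yb: "y v \<le> n + E" "v \<notin> V \<Longrightarrow> y v = 0" for v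
    using box_bounds[of "Suc k" L i0 a y v] k y by auto
  have "cd y < Z" using yb(1) by (intro cd_less less_B)
  then have "cd y - cd (vec e) < Z" by simp
  with a ok obtain z where z: "z \<in> reach L i0 a k" "cd z = cd y - cd (vec e)" by (auto simp: layer_ok_def)
  have zb: "z v \<le> n + E" "v \<notin> V \<Longrightarrow> z v = 0" for v
    using reach_bounds[of k L i0 a z v] k z(1) by auto
  have "cd (\<lambda>v. z v + vec e v) = cd y" using z(2) a by (simp add: cd_add)
  then have "(\<lambda>v. z v + vec e v) = y"
  proof (rule cd_inj)
    fix v
    show "z v + vec e v < B" using zb(1)[of v] vec_le[OF e, of v] by (simp add: B_def)
    show "y v < B" using yb(1)[of v] by (simp add: B_def)
    show "v \<notin> V \<Longrightarrow> z v + vec e v = 0" using zb(2) vec_support by simp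
    show "v \<notin> V \<Longrightarrow> y v = 0" by (rule yb(2))
  qed
  then show "last_config L i0 a k y e" using a e z(1) unfolding last_config_def by blast
qed

lemma layer_ok_cong:
  assumes "k \<le> M L i0 a" "\<And>y. y < Z \<Longrightarrow> f y = g y" "layer_ok L i0 a k f"
  shows "layer_ok L i0 a k g"
proof -
  have "cd v < Z" if "v \<in> reach L i0 a k" for v
    using reach_bounds(1)[OF assms(1) that] by (intro cd_less less_B)
  then show ?thesis using assms(2,3) unfolding layer_ok_def by metis
qed

text \<open>A new layer lies beyond all earlier ones, which therefore survive for the
  reconstruction.\<close>

lemma layers_extend:
  assumes k: "k < M L i0 a" and old: "\<forall>k'\<le>k. layer_ok L i0 a k' (\<lambda>y. f (off + Z * Suc k' + y))"
    and new: "layer_ok L i0 a (Suc k) (\<lambda>y. g (off + Z * Suc k + Z + y))"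
    and eq: "\<forall>x. x < off + Z * Suc k + Z \<or> off + Z * Suc k + Z + Z \<le> x \<longrightarrow> g x = f x"
  shows "\<forall>k'\<le>Suc k. layer_ok L i0 a k' (\<lambda>y. g (off + Z * Suc k' + y))"
proof (intro allI impI)
  fix k' assume "k' \<le> Suc k"
  show "layer_ok L i0 a k' (\<lambda>y. g (off + Z * Suc k' + y))"
  proof (cases "k' = Suc k")
    case True
    then have eq': "off + Z * Suc k' + y = off + Z * Suc k + Z + y" for y by simp
    show ?thesis unfolding eq' using new True by simp
  next
    case False
    then have le: "k' \<le> k" using \<open>k' \<le> Suc k\<close> by simp
    have "Z * Suc k' \<le> Z * Suc k" using le by (intro mult_le_mono2) simp
    then have "f (off + Z * Suc k' + y) = g (off + Z * Suc k' + y)" if "y < Z" for y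
    proof -
      have "off + Z * Suc k' + y < off + Z * Suc k + Z"
        using \<open>Z * Suc k' \<le> Z * Suc k\<close> that by linarith
      then show ?thesis using eq by simp
    qed
    moreover have "k' \<le> M L i0 a" using le k by simp
    moreover have "layer_ok L i0 a k' (\<lambda>y. f (off + Z * Suc k' + y))" using old le by blast
    ultimately show ?thesis using layer_ok_cong[of k' L i0 a "\<lambda>y. f (off + Z * Suc k' + y)" "\<lambda>y. g (off + Z * Suc k' + y)"] by blast
  qed
qed

lemma run_lower_corner:
  assumes "prepared st" "reg st ''M'' = M L i0 a" "reg st ''b'' = k" "k \<le> M L i0 a"
  shows "run lower_corner st (\<lambda>t st'. t \<le> 2000 * U ^ 2 \<and> reg st' ''f'' = cd (lo L i0 a k))"
  unfolding lower_corner_def run_simps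
proof (rule run_while[where U = U and C = 400 and k = 1 and \<mu> = "\<lambda>st. pm + 1 - reg st ''v''" and
    I = "\<lambda>st. \<exists>v\<le>pm. reg st ''v'' = Suc v \<and> reg st ''f'' = code V B v (lo L i0 a k)"], goal_cases)
  case 1
  then show ?case by (auto intro!: exI[of _ 0])
next
  case 2
  show ?case by (rule U_bounds)
next
  case 3
  then show ?case using U_bounds(5) by simp
next
  case (4 st1)
  then obtain v where v: "v \<le> pm" "reg st1 ''v'' = Suc v" "reg st1 ''f'' = code V B v (lo L i0 a k)" by blast
  have st1: "reg st1 ''P'' = pm" "reg st1 ''b'' = k" "reg st1 ''M'' = M L i0 a" "reg st1 ''W'' = W" "arr st1 ''c'' = cnt"
    "arr st1 ''w'' = arr st ''w''" using 4(2) assms by (auto simp: same_def prepared_def)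
  have vp: "Suc v \<le> pm" using 4(3) v st1 by simp
  show ?case
  proof (cases "Suc v \<in> V")
    case False
    then have "cnt (Suc v) = 0" using cnt_pos_iff[of "Suc v"] by simp
    then show ?thesis using v st1 vp False U_bounds(1)
      by (auto simp: run_simps intro!: exI[of _ "Suc v"])
  next
    case True
    then have c: "0 < cnt (Suc v)" using cnt_pos_iff by simp
    have w: "arr st ''w'' (Suc v) = radix V B v" using assms(1) True by (auto simp: prepared_def)
    have MA: "M L i0 a \<le> A" using M_le by (simp add: A_def)
    have kU: "k \<le> U" using assms(4) MA U_bounds(11) by simp
    have "cnt (Suc v) * k \<le> n * A" using assms(4) MA cnt_le by (intro mult_le_mono) auto
    then have ckU: "cnt (Suc v) * k \<le> U" using U_bounds(12) by linarith
    have M0: "0 < M L i0 a" using M_pos[of L i0 a] by simp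
    have lU: "lo L i0 a k (Suc v) \<le> U" using lo_le[OF assms(4), of "Suc v"] U_bounds(2) by linarith
    have lo: "cnt (Suc v) * k div M L i0 a - W = lo L i0 a k (Suc v)" by (simp add: lo_def)
    show ?thesis
      apply (simp add: run_simps v st1 c)
      apply (rule run_mul[where U = U], simp, simp, rule U_bounds)
      subgoal using kU by (simp add: st1)
      apply (rule run_div_mod[where U = U], simp, rule U_bounds)
      subgoal using ckU by (simp add: st1)
      subgoal using M0 by (simp add: st1)
      apply (simp add: run_simps st1 v w lo)
      apply (rule run_mul[where U = U], simp, simp, rule U_bounds)
      subgoal using lU by simp
      using U_bounds(1) True vp v
      apply (auto simp: run_simps st1 mult.commute intro!: exI[of _ "Suc v"])
      done
  qed
next
  case (5 t st1)
  then obtain v where v: "v \<le> pm" "reg st1 ''v'' = Suc v" "reg st1 ''f'' = code V B v (lo L i0 a k)" by blast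
  have "reg st1 ''P'' = pm" using 5(2) assms by (auto simp: same_def prepared_def)
  then have "v = pm" using 5(3) v by simp
  moreover have "t \<le> 812 * U\<^sup>2" using 5(4) by (simp add: power2_eq_square)
  then have "t + 10 \<le> 2000 * U\<^sup>2" using U_power[of 2] by linarith
  ultimately show ?case using v by (simp add: cd_def)
qed

text \<open>The hypothesis \<open>init\<close> admits a cell that is already marked; an overwritten
  entry again names a valid last content, so the cell stays correct.\<close>

lemma run_fill_cell:
  assumes prep: "prepared st" and k: "k < M L i0 a"
    and prev: "layer_ok L i0 a k (\<lambda>y. arr st ''tab'' (off + y))"
    and r: "reg st ''o'' = off + Z" "reg st ''x'' = ks L i0 a k" "reg st ''f'' = cd (lo L i0 a (Suc k))" "reg st ''j'' = j" "j < len"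
    and b: "b = (\<lambda>v. if v \<in> V then lo L i0 a (Suc k) v + vec j v else 0)"
    and init: "arr st ''tab'' (off + Z + cd b) \<noteq> 0 \<Longrightarrow> last_config L i0 a k b (arr st ''tab'' (off + Z + cd b) - 1)"
  shows "run fill_cell st (\<lambda>t st'. t \<le> 300 * U \<and>
    (\<exists>c. arr st' ''tab'' = (arr st ''tab'')(off + Z + cd b := c) \<and> (c \<noteq> 0 \<longrightarrow> last_config L i0 a k b (c - 1)) \<and>
      (\<forall>e. last_config L i0 a k b e \<longrightarrow> c \<noteq> 0) \<and> (arr st ''tab'' (off + Z + cd b) \<noteq> 0 \<longrightarrow> c \<noteq> 0)))"
proof -
  have bb: "b \<in> box L i0 a (Suc k)" unfolding b by (rule box_lo_vec[OF r(5)])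
  have cb: "cd b = cd (lo L i0 a (Suc k)) + cd (vec j)" unfolding b by (rule cd_lo_vec)
  have "b v \<le> n + E" for v using box_bounds(1)[OF _ bb] k by simp
  then have bZ: "cd b < Z" by (intro cd_less less_B)
  have oc: "arr st ''oc'' e = cd (vec e)" "arr st ''ol'' e = load pm (vec e)" if "e < len" for e
    using prep that by (auto simp: prepared_def enum_ok_def)
  show ?thesis
    unfolding fill_cell_def
    apply (simp only: run_simps)
    apply (simp add: r oc cb[symmetric])
  proof (rule run_while[where U = U and C = 60 and k = 0 and \<mu> = "\<lambda>st. len - reg st ''e''" and
      I = "\<lambda>st1. reg st1 ''e'' \<le> len \<and>
        (\<exists>c. arr st1 ''tab'' = (arr st ''tab'')(off + Z + cd b := c) \<and> (c \<noteq> 0 \<longrightarrow> last_config L i0 a k b (c - 1)) \<and>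
        (\<forall>e<reg st1 ''e''. last_config L i0 a k b e \<longrightarrow> c \<noteq> 0) \<and> (arr st ''tab'' (off + Z + cd b) \<noteq> 0 \<longrightarrow> c \<noteq> 0))"], goal_cases)
    case 1
    then show ?case using init by (auto intro!: exI[of _ "arr st ''tab'' (off + Z + cd b)"])
  next
    case 2
    show ?case by (rule U_bounds)
  next
    case 3
    then show ?case using U_bounds(10) by simp
  next
    case (4 st1)
    then obtain c where c: "arr st1 ''tab'' = (arr st ''tab'')(off + Z + cd b := c)" "c \<noteq> 0 \<longrightarrow> last_config L i0 a k b (c - 1)"
      "\<forall>e<reg st1 ''e''. last_config L i0 a k b e \<longrightarrow> c \<noteq> 0" "arr st ''tab'' (off + Z + cd b) \<noteq> 0 \<longrightarrow> c \<noteq> 0" by blast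
    define e where "e = reg st1 ''e''"
    have st1: "reg st1 ''l'' = len" "reg st1 ''y'' = cd b" "reg st1 ''x'' = ks L i0 a k" "reg st1 ''Z'' = Z" "reg st1 ''o'' = off + Z"
      "arr st1 ''oc'' = arr st ''oc''" "arr st1 ''ol'' = arr st ''ol''"
      using 4(2) r prep by (auto simp: same_def prepared_def)
    have e: "e < len" using 4(3) st1 by (simp add: e_def)
    define d where "d = cd b - cd (vec e)"
    \<comment> \<open>Reads hit addresses below \<open>off + Z\<close>, in the previous layer, and
      are unaffected by the writes to the current cell.\<close>
    have addr: "off + Z + d - Z = off + d" "off + d \<noteq> off + Z + cd b" using bZ by (auto simp: d_def)
    have iff: "last_config L i0 a k b e \<longleftrightarrow>
      load pm (vec e) \<le> ks L i0 a k \<and> cd (vec e) \<le> cd b \<and> arr st ''tab'' (off + d) \<noteq> 0"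
      unfolding d_def by (rule last_config_iff[OF k prev bb e])
    have bv: "bval (And (Not (Less (Reg ''x'') (Get ''ol'' (Reg ''e''))))
            (And (Not (Less (Reg ''y'') (Get ''oc'' (Reg ''e''))))
              (Less (Const 0) (Get ''tab'' (Minus (Plus (Reg ''o'') (Minus (Reg ''y'') (Get ''oc'' (Reg ''e'')))) (Reg ''Z'')))))) st1
        \<longleftrightarrow> last_config L i0 a k b e"
      unfolding iff using addr by (simp add: st1 e_def[symmetric] oc[OF e] c(1) d_def[symmetric] not_less)
    show ?case
    proof (cases "last_config L i0 a k b e")
      case True
      show ?thesis unfolding run_Seq run_If bv
        using True e U_bounds(1) c(1)
        by (auto simp: run_simps st1 e_def[symmetric] less_Suc_eq intro!: exI[of _ "Suc e"])
    next
      case False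
      show ?thesis unfolding run_Seq run_If bv
        using False e U_bounds(1) c
        by (auto simp: run_simps st1 e_def[symmetric] less_Suc_eq intro!: exI[of _ c])
    qed
  next
    case (5 t st1)
    then obtain c where c: "arr st1 ''tab'' = (arr st ''tab'')(off + Z + cd b := c)" "c \<noteq> 0 \<longrightarrow> last_config L i0 a k b (c - 1)"
      "\<forall>e<reg st1 ''e''. last_config L i0 a k b e \<longrightarrow> c \<noteq> 0" "arr st ''tab'' (off + Z + cd b) \<noteq> 0 \<longrightarrow> c \<noteq> 0" by blast
    have "reg st1 ''l'' = len" using 5(2) prep by (auto simp: same_def prepared_def)
    then have "reg st1 ''e'' = len" using 5(1,3) by simp
    then have "\<forall>e. last_config L i0 a k b e \<longrightarrow> c \<noteq> 0" using c(3) by (auto simp: last_config_def)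
    then show ?case using 5(4) U_bounds(1) c by auto
  qed
qed


lemma run_fill_layer:
  assumes prep: "prepared st" and k: "k < M L i0 a"
    and prev: "layer_ok L i0 a k (\<lambda>y. arr st ''tab'' (off + y))"
    and r: "reg st ''o'' = off + Z" "reg st ''x'' = ks L i0 a k" "reg st ''f'' = cd (lo L i0 a (Suc k))"
    and fresh: "\<And>y. off + Z \<le> y \<Longrightarrow> arr st ''tab'' y = 0"
  shows "run fill_layer st (\<lambda>t st'. t \<le> 1000 * U ^ 2 \<and>
    layer_ok L i0 a (Suc k) (\<lambda>y. arr st' ''tab'' (off + Z + y)) \<and>
    (\<forall>x. x < off + Z \<or> off + Z + Z \<le> x \<longrightarrow> arr st' ''tab'' x = arr st ''tab'' x))"
proof -
  define b where "b j = (\<lambda>v. if v \<in> V then lo L i0 a (Suc k) v + vec j v else 0)" for j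
  have bb: "b j \<in> box L i0 a (Suc k)" if "j < len" for j unfolding b_def by (rule box_lo_vec[OF that])
  have "b j v \<le> n + E" if "j < len" for j v using box_bounds(1)[OF _ bb[OF that]] k by simp
  then have bZ: "cd (b j) < Z" if "j < len" for j using that by (intro cd_less less_B)
  \<comment> \<open>Soundness of the entries is claimed for all cells of the layer, completeness
    only for the offsets below \<open>j\<close>.\<close>
  define I where "I st1 \<longleftrightarrow> reg st1 ''j'' \<le> len \<and>
      (\<forall>x. x < off + Z \<or> off + Z + Z \<le> x \<longrightarrow> arr st1 ''tab'' x = arr st ''tab'' x) \<and>
      (\<forall>y<Z. arr st1 ''tab'' (off + Z + y) \<noteq> 0 \<longrightarrow>
        (\<exists>v\<in>box L i0 a (Suc k). cd v = y \<and> last_config L i0 a k v (arr st1 ''tab'' (off + Z + y) - 1))) \<and>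
      (\<forall>j<reg st1 ''j''. (\<exists>e. last_config L i0 a k (b j) e) \<longrightarrow> arr st1 ''tab'' (off + Z + cd (b j)) \<noteq> 0)" for st1 :: state
  show ?thesis
    unfolding fill_layer_def
    apply (simp only: run_simps)
  proof (rule run_while[where U = U and C = 320 and k = 1 and \<mu> = "\<lambda>st. len - reg st ''j''" and I = I], goal_cases)
    case 1
    then show ?case using fresh by (simp add: I_def)
  next
    case 2
    show ?case by (rule U_bounds)
  next
    case 3
    then show ?case using U_bounds(10) by simp
  next
    case (4 st1)
    define j where "j = reg st1 ''j''"
    note I = 4(1)[unfolded I_def j_def[symmetric]]
    have st1: "reg st1 ''l'' = len" "reg st1 ''x'' = ks L i0 a k" "reg st1 ''o'' = off + Z"
      "reg st1 ''f'' = cd (lo L i0 a (Suc k))"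
      using 4(2) r prep by (auto simp: same_def prepared_def)
    have p1: "prepared st1"
      using prep 4(2) by (auto simp: prepared_def input_def enum_ok_def same_def)
    have j: "j < len" using 4(3) st1 by (simp add: j_def)
    have "arr st1 ''tab'' (off + y) = arr st ''tab'' (off + y)" if "y < Z" for y using I that by simp
    then have prev1: "layer_ok L i0 a k (\<lambda>y. arr st1 ''tab'' (off + y))"
      using prev k layer_ok_cong[of k L i0 a "\<lambda>y. arr st ''tab'' (off + y)"] by simp
    have "last_config L i0 a k (b j) (arr st1 ''tab'' (off + Z + cd (b j)) - 1)"
      if nz: "arr st1 ''tab'' (off + Z + cd (b j)) \<noteq> 0"
    proof -
      from I nz bZ[OF j] obtain v where v: "v \<in> box L i0 a (Suc k)" "cd v = cd (b j)"
        "last_config L i0 a k v (arr st1 ''tab'' (off + Z + cd (b j)) - 1)" by blast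
      have "v = b j"
      proof (rule cd_inj[OF v(2)])
        fix u
        have "Suc k \<le> M L i0 a" using k by simp
        note bnd = box_bounds[OF this v(1), of u] box_bounds[OF this bb[OF j], of u]
        show "v u < B" "b j u < B" using bnd(1,3) by (auto intro: less_B)
        show "u \<notin> V \<Longrightarrow> v u = 0" "u \<notin> V \<Longrightarrow> b j u = 0" using bnd(2,4) by auto
      qed
      then show ?thesis using v(3) by simp
    qed
    note cell = run_fill_cell[OF p1 k prev1 st1(3,2,4) j_def[symmetric] j b_def this]
    have step: "(\<forall>x. x < off + Z \<or> off + Z + Z \<le> x \<longrightarrow> f x = arr st ''tab'' x) \<and>
      (\<forall>y<Z. f (off + Z + y) \<noteq> 0 \<longrightarrow>
        (\<exists>v\<in>box L i0 a (Suc k). cd v = y \<and> last_config L i0 a k v (f (off + Z + y) - 1))) \<and>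
      (\<forall>j'<Suc j. (\<exists>e. last_config L i0 a k (b j') e) \<longrightarrow> f (off + Z + cd (b j')) \<noteq> 0)"
      if f: "f = (arr st1 ''tab'')(off + Z + cd (b j) := c)" and c: "c \<noteq> 0 \<longrightarrow> last_config L i0 a k (b j) (c - 1)"
        "\<forall>e. last_config L i0 a k (b j) e \<longrightarrow> c \<noteq> 0" "arr st1 ''tab'' (off + Z + cd (b j)) \<noteq> 0 \<longrightarrow> c \<noteq> 0" for f c
    proof (intro conjI allI impI)
      fix x assume x: "x < off + Z \<or> off + Z + Z \<le> x"
      then have "x \<noteq> off + Z + cd (b j)" using bZ[OF j] by auto
      moreover have "arr st1 ''tab'' x = arr st ''tab'' x" using I x by blast
      ultimately show "f x = arr st ''tab'' x" by (simp add: f)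
    next
      fix y assume y: "y < Z" "f (off + Z + y) \<noteq> 0"
      show "\<exists>v\<in>box L i0 a (Suc k). cd v = y \<and> last_config L i0 a k v (f (off + Z + y) - 1)"
      proof (cases "y = cd (b j)")
        case True
        then show ?thesis using y c(1) bb[OF j] by (intro bexI[of _ "b j"]) (simp_all add: f)
      next
        case False
        then have "f (off + Z + y) = arr st1 ''tab'' (off + Z + y)" by (simp add: f)
        then show ?thesis using I y by metis
      qed
    next
      fix j' assume j': "j' < Suc j" "\<exists>e. last_config L i0 a k (b j') e"
      show "f (off + Z + cd (b j')) \<noteq> 0"
      proof (cases "cd (b j') = cd (b j)")
        case True
        show ?thesis
        proof (cases "j' = j")
          case True
          then show ?thesis using j'(2) c(2) by (auto simp: f)
        next
          case False
          then have "arr st1 ''tab'' (off + Z + cd (b j')) \<noteq> 0" using I j' by (metis less_SucE)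
          then show ?thesis using True c(3) by (simp add: f)
        qed
      next
        case False
        then have "j' < j" using j'(1) by (metis less_SucE)
        then have "arr st1 ''tab'' (off + Z + cd (b j')) \<noteq> 0" using I j'(2) by blast
        then show ?thesis using False by (simp add: f)
      qed
    qed
    show ?case
      apply (simp only: run_Seq)
      apply (rule run_conseq[OF cell], assumption)
      apply (elim conjE exE)
      subgoal for t st2 c
        apply (drule step, assumption, assumption, assumption)
        unfolding I_def run_Assign
        using j U_bounds(1)
        apply (simp add: same_def j_def[symmetric])
        done
      done
  next
    case (5 t st1)
    note I = 5(1)[unfolded I_def]
    have "reg st1 ''l'' = len" using 5(2) prep by (auto simp: same_def prepared_def)
    then have j: "reg st1 ''j'' = len" using I 5(3) by simp
    have "layer_ok L i0 a (Suc k) (\<lambda>y. arr st1 ''tab'' (off + Z + y))"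
      unfolding layer_ok_def
    proof (intro conjI ballI allI impI)
      fix v assume v: "v \<in> reach L i0 a (Suc k)"
      then have vb: "v \<in> box L i0 a (Suc k)" "\<exists>e. last_config L i0 a k v e" by (simp_all only: reach_Suc_iff)
      from box_obtain[OF vb(1)] obtain j' where "j' < len" "v = b j'" unfolding b_def by blast
      moreover have "\<forall>j'<len. (\<exists>e. last_config L i0 a k (b j') e) \<longrightarrow> arr st1 ''tab'' (off + Z + cd (b j')) \<noteq> 0"
        using I unfolding j by (elim conjE)
      ultimately show "arr st1 ''tab'' (off + Z + cd v) \<noteq> 0" using vb(2) by metis
    next
      fix y assume "y < Z" "arr st1 ''tab'' (off + Z + y) \<noteq> 0"
      then obtain v where "v \<in> box L i0 a (Suc k)" "cd v = y" "last_config L i0 a k v (arr st1 ''tab'' (off + Z + y) - 1)"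
        using I by blast
      then show "\<exists>v\<in>reach L i0 a (Suc k). cd v = y \<and> (0 < Suc k \<longrightarrow> last_config L i0 a (Suc k - 1) v (arr st1 ''tab'' (off + Z + y) - 1))"
        by (intro bexI[of _ v]) (auto simp only: reach_Suc_iff diff_Suc_1)
    qed
    moreover have "t \<le> 648 * U\<^sup>2" using 5(4) by (simp add: power2_eq_square)
    then have "t + 10 \<le> 1000 * U\<^sup>2" using U_power[of 2] by linarith
    ultimately show ?case using I by simp
  qed
qed

lemma ks_eq:
  assumes "holds_machines st (vl L i0 a)" "holds_list (arr st ''sq'') (spread_order (map fst (vl L i0 a)))" "k < M L i0 a"
  shows "arr st ''ku'' (arr st ''sq'' k) = ks L i0 a k"
proof -
  let ?o = "spread_order (map fst (vl L i0 a))"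
  have len: "length ?o = M L i0 a" by (simp add: length_spread_order M_def)
  then have "arr st ''sq'' k = ?o ! k" using assms(2,3) by (simp add: holds_list_def)
  moreover have "?o ! k < M L i0 a"
    using nth_mem[of k ?o] assms(3) len by (simp add: set_spread_order M_def)
  ultimately show ?thesis using assms(1) by (simp add: holds_machines_def holds_list_def ks_def M_def)
qed

text \<open>\<open>off\<close> is where the last layer of the preceding guess starts, or 0 before
  the first guess. Layers of this guess therefore begin at \<open>off + Z\<close>.\<close>

lemma run_fill_table:
  assumes prep: "prepared st" and vm: "holds_machines st (vl L i0 a)"
    and sq: "holds_list (arr st ''sq'') (spread_order (map fst (vl L i0 a)))"
    and o: "reg st ''o'' = off" and fresh: "\<And>y. off + Z \<le> y \<Longrightarrow> arr st ''tab'' y = 0"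
  shows "run fill_table st (\<lambda>t st'. t \<le> 8000 * U ^ 3 \<and> reg st' ''o'' = off + Z * Suc (M L i0 a) \<and>
    (\<forall>k\<le>M L i0 a. layer_ok L i0 a k (\<lambda>y. arr st' ''tab'' (off + Z * Suc k + y))) \<and>
    (\<forall>y. off + Z * Suc (M L i0 a) + Z \<le> y \<longrightarrow> arr st' ''tab'' y = 0))"
proof -
  have Mr: "reg st ''M'' = M L i0 a" using vm by (simp add: holds_machines_def M_def)
  have MU: "M L i0 a \<le> U" using M_le[of L i0 a] U_bounds(11) by (simp add: A_def)
  have rz: "reg st ''Z'' = Z" using prep by (simp add: prepared_def)
  define I where "I st1 \<longleftrightarrow> reg st1 ''k'' \<le> M L i0 a \<and> reg st1 ''o'' = off + Z * Suc (reg st1 ''k'') \<and>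
    (\<forall>k\<le>reg st1 ''k''. layer_ok L i0 a k (\<lambda>y. arr st1 ''tab'' (off + Z * Suc k + y))) \<and>
    (\<forall>y. off + Z * Suc (reg st1 ''k'') + Z \<le> y \<longrightarrow> arr st1 ''tab'' y = 0)" for st1 :: state
  have layer0: "layer_ok L i0 a 0 f" if "\<And>y. y < Z \<Longrightarrow> f y = (if y = 0 then 1 else 0)" for f
    using that Z_pos by (auto simp: layer_ok_def cd_def code_zero)
  show ?thesis
    unfolding fill_table_def
    apply (simp only: run_simps)
  proof (rule run_while[where U = U and C = 3500 and k = 2 and \<mu> = "\<lambda>st. M L i0 a - reg st ''k''" and I = I], goal_cases)
    case 1
    show ?case unfolding I_def using fresh Z_pos by (auto simp: o rz intro!: layer0)
  next
    case 2
    show ?case by (rule U_bounds)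
  next
    case 3
    then show ?case using MU by simp
  next
    case (4 st1)
    define k where "k = reg st1 ''k''"
    note I = 4(1)[unfolded I_def k_def[symmetric]]
    have st1: "reg st1 ''M'' = M L i0 a" "reg st1 ''Z'' = Z"
      using 4(2) Mr rz by (auto simp: same_def)
    have k: "k < M L i0 a" using 4(3) st1 by (simp add: k_def)
    have ks: "arr st1 ''ku'' (arr st1 ''sq'' k) = ks L i0 a k"
      using ks_eq[OF vm sq k] 4(2) by (simp add: same_def)
    have p1: "prepared (st1\<lparr>reg := (reg st1)(''b'' := Suc k)\<rparr>)"
      using prep 4(2) by (auto simp: prepared_def input_def enum_ok_def same_def)
    show ?case
      apply (simp only: run_Seq)
      apply (simp only: run_simps)
      apply (simp add: k_def[symmetric])
      apply (rule run_conseq[OF run_lower_corner[OF p1, of L i0 a "Suc k"]])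
      subgoal using st1 by simp
      subgoal by simp
      subgoal using k by simp
      subgoal for t st2
        apply (rule run_conseq[OF run_fill_layer[of _ k L i0 a "off + Z * Suc k"]])
        subgoal using p1 by (auto simp: prepared_def input_def enum_ok_def same_def)
        subgoal using k .
        subgoal using I by (simp add: same_def)
        subgoal using I st1 by (simp add: same_def k_def[symmetric])
        subgoal using ks by (simp add: same_def k_def[symmetric])
        subgoal by (simp add: same_def)
        subgoal using I by (simp add: same_def)
        subgoal for t' st3
          apply (elim conjE)
          apply (drule layers_extend[OF k, where off = off and f = "arr st1 ''tab''", rotated])
            apply (simp add: same_def)
          subgoal using I by blast
          unfolding I_def
          using I k st1 U_power[of 2]
          apply (simp add: same_def k_def[symmetric])
          done
        done
      done
  next
    case (5 t st1)
    note I = 5(1)[unfolded I_def]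
    have "reg st1 ''M'' = M L i0 a" using 5(2) Mr by (auto simp: same_def)
    then have k: "reg st1 ''k'' = M L i0 a" using I 5(3) by simp
    have "t \<le> 7008 * U ^ 3" using 5(4) by (simp add: power3_eq_cube power2_eq_square ac_simps)
    then have "t + 20 \<le> 8000 * U ^ 3" using U_power[of 3] by linarith
    then show ?case using I unfolding k by simp
  qed
qed

end

section \<open>Reconstructing an assignment\<close>

definition reset :: com where
  "reset = Assign ''j'' (Const 1) ;;
     While (Less (Reg ''j'') (Plus (Reg ''n'') (Const 1))) (Put ''sigma'' (Reg ''j'') (Const 0) ;; incr ''j'')"

text \<open>The search has no bound test: it is started only when an unplaced job of size
  \<open>v\<close> exists.\<close>

definition place_job :: com where
  "place_job = Assign ''j'' (Const 1) ;;
     While (Not (And (And (Not (Less (Get ''p'' (Reg ''j'')) (Reg ''v''))) (Not (Less (Reg ''v'') (Get ''p'' (Reg ''j'')))))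
        (Less (Get ''sigma'' (Reg ''j'')) (Const 1)))) (incr ''j'') ;;
     Put ''sigma'' (Reg ''j'') (Reg ''i'')"

text \<open>The code in \<open>y\<close> shrinks by one place value per job, so it ends as the code
  of the vector to look up in the previous layer.\<close>

definition place_config :: com where
  "place_config =
     While (Less (Const 0) (Reg ''e''))
      (Assign ''v'' (Get ''ov'' (Reg ''e'')) ;; place_job ;;
       Assign ''y'' (Minus (Reg ''y'') (Get ''w'' (Reg ''v''))) ;;
       Assign ''e'' (Get ''op'' (Reg ''e'')))"

definition reconstruct :: com where
  "reconstruct = reset ;; Assign ''y'' (Reg ''N'') ;; Assign ''d'' (Reg ''o'') ;; Assign ''k'' (Reg ''M'') ;;
     While (Less (Const 0) (Reg ''k''))
      (Assign ''k'' (Minus (Reg ''k'') (Const 1)) ;;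
       Assign ''i'' (Get ''ru'' (Get ''sq'' (Reg ''k''))) ;;
       Assign ''e'' (Minus (Get ''tab'' (Plus (Reg ''d'') (Reg ''y''))) (Const 1)) ;;
       place_config ;;
       Assign ''d'' (Minus (Reg ''d'') (Reg ''Z'')))"

lemma mods_reset [simp]: "mod_regs reset = [''j'', ''j'']" "mod_arrs reset = [''sigma'']"
  by (simp_all add: reset_def)

lemma mods_place_job [simp]: "mod_regs place_job = [''j'', ''j'']" "mod_arrs place_job = [''sigma'']"
  by (simp_all add: place_job_def)

lemma mods_place_config [simp]:
  "mod_regs place_config = [''v'', ''j'', ''j'', ''y'', ''e'']" "mod_arrs place_config = [''sigma'']"
  by (simp_all add: place_config_def)

lemma mods_reconstruct [simp]:
  "mod_regs reconstruct = [''j'', ''j'', ''y'', ''d'', ''k'', ''k'', ''i'', ''e'', ''v'', ''j'', ''j'', ''y'', ''e'', ''d'']"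
  "mod_arrs reconstruct = [''sigma'', ''sigma'']"
  by (simp_all add: reconstruct_def)

context scheduling
begin

definition machine_load :: "(nat \<Rightarrow> nat) \<Rightarrow> nat \<Rightarrow> nat" where
  "machine_load f i = (\<Sum>j\<in>{j\<in>{1..n}. f j = i}. p j)"

text \<open>Job \<open>j\<close> is not yet placed if \<open>f j = 0\<close>; \<open>x\<close> counts these jobs by size. Machine \<open>i\<close> is
  about to receive further load \<open>r\<close>.\<close>

definition partial_assignment ::
  "(nat \<Rightarrow> nat) \<Rightarrow> (nat \<Rightarrow> nat) \<Rightarrow> nat \<Rightarrow> nat \<Rightarrow> (nat \<Rightarrow> nat) \<Rightarrow> bool" where
  "partial_assignment f x i r g \<longleftrightarrow> (\<forall>j\<in>{1..n}. f j \<le> m) \<and>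
     (\<forall>v\<in>V. x v = card {j\<in>{1..n}. p j = v \<and> f j = 0}) \<and>
     (\<forall>i'\<in>{1..m}. machine_load f i' + (if i' = i then r else 0) \<le> g i')"

lemma partial_assignment_place:
  assumes "partial_assignment f (add_unit v x) i (r + v) g" and v: "v \<in> V" and i: "i \<in> {1..m}"
    and j: "j \<in> {1..n}" "p j = v" "f j = 0"
  shows "partial_assignment (f(j := i)) x i r g"
proof -
  have ld: "machine_load (f(j := i)) i' = machine_load f i' + (if i' = i then v else 0)" if "i' \<in> {1..m}" for i'
  proof -
    have "{k\<in>{1..n}. (f(j := i)) k = i'} =
      (if i' = i then insert j {k\<in>{1..n}. f k = i'} else {k\<in>{1..n}. f k = i'})"
      using j that by auto
    moreover have "j \<notin> {k\<in>{1..n}. f k = i'}" using j that by auto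
    ultimately show ?thesis using j by (simp add: machine_load_def)
  qed
  have "x u = card {k\<in>{1..n}. p k = u \<and> (f(j := i)) k = 0}" if u: "u \<in> V" for u
  proof -
    have *: "add_unit v x u = card {k\<in>{1..n}. p k = u \<and> f k = 0}"
      using assms(1) u by (simp add: partial_assignment_def)
    show ?thesis
    proof (cases "u = v")
      case True
      have "{k\<in>{1..n}. p k = u \<and> f k = 0} = insert j {k\<in>{1..n}. p k = u \<and> (f(j := i)) k = 0}"
        using j i True by auto
      moreover have "j \<notin> {k\<in>{1..n}. p k = u \<and> (f(j := i)) k = 0}" using i by simp
      ultimately have "card {k\<in>{1..n}. p k = u \<and> f k = 0} = Suc (card {k\<in>{1..n}. p k = u \<and> (f(j := i)) k = 0})"
        by simp
      then show ?thesis using * True by (simp add: add_unit_def)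
    next
      case False
      then have "{k\<in>{1..n}. p k = u \<and> f k = 0} = {k\<in>{1..n}. p k = u \<and> (f(j := i)) k = 0}"
        using j by auto
      then show ?thesis using * False by (simp add: add_unit_def)
    qed
  qed
  moreover have "\<forall>k\<in>{1..n}. (f(j := i)) k \<le> m" using assms(1) i by (auto simp: partial_assignment_def)
  moreover have "\<forall>i'\<in>{1..m}. machine_load (f(j := i)) i' + (if i' = i then r else 0) \<le> g i'"
  proof
    fix i' assume i': "i' \<in> {1..m}"
    then have "machine_load f i' + (if i' = i then r + v else 0) \<le> g i'"
      using assms(1) by (simp only: partial_assignment_def)
    then show "machine_load (f(j := i)) i' + (if i' = i then r else 0) \<le> g i'"
      unfolding ld[OF i'] by (auto split: if_splits)
  qed
  ultimately show ?thesis unfolding partial_assignment_def by blast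
qed

lemma run_reset:
  assumes "input st"
  shows "run reset st (\<lambda>t st'. t \<le> 100 * U \<and> (\<forall>j\<in>{1..n}. arr st' ''sigma'' j = 0))"
  unfolding reset_def run_simps
proof (rule run_while[where U = U and C = 20 and k = 0 and \<mu> = "\<lambda>st. n + 1 - reg st ''j''" and
    I = "\<lambda>st. 1 \<le> reg st ''j'' \<and> reg st ''j'' \<le> n + 1 \<and> (\<forall>j. 1 \<le> j \<longrightarrow> j < reg st ''j'' \<longrightarrow> arr st ''sigma'' j = 0)"], goal_cases)
  case 1
  then show ?case by simp
next
  case 2
  show ?case by (rule U_bounds)
next
  case 3
  then show ?case using U_bounds(2) by simp
next
  case (4 st1)
  have "reg st1 ''n'' = n" using 4(2) assms by (simp add: input_def same_def)
  then show ?case using 4(1,3) U_bounds(1) by (auto simp: run_simps less_Suc_eq)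
next
  case (5 t st1)
  have "reg st1 ''n'' = n" using 5(2) assms by (simp add: input_def same_def)
  then show ?case using 5(1,3,4) U_bounds(1) by auto
qed

lemma run_place_job:
  assumes "input st" "reg st ''v'' = v" "reg st ''i'' = i"
    and ex: "j0 \<in> {1..n}" "p j0 = v" "arr st ''sigma'' j0 = 0"
  shows "run place_job st (\<lambda>t st'. t \<le> 100 * U \<and>
    (\<exists>j\<in>{1..n}. p j = v \<and> arr st ''sigma'' j = 0 \<and> arr st' ''sigma'' = (arr st ''sigma'')(j := i)))"
proof -
  define P where "P j \<longleftrightarrow> j \<in> {1..n} \<and> p j = v \<and> arr st ''sigma'' j = 0" for j
  define jm where "jm = (LEAST j. P j)"
  have P: "P jm" unfolding jm_def using ex by (intro LeastI[of P j0]) (simp add: P_def)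
  have min: "P j \<Longrightarrow> jm \<le> j" for j unfolding jm_def by (rule Least_le)
  show ?thesis
    unfolding place_job_def run_Seq
    apply (simp only: run_Assign)
  proof (rule run_while[where U = U and C = 20 and k = 0 and \<mu> = "\<lambda>st. jm - reg st ''j''" and
      I = "\<lambda>st. 1 \<le> reg st ''j'' \<and> reg st ''j'' \<le> jm"], goal_cases)
    case 1
    then show ?case using P by (simp add: P_def)
  next
    case 2
    show ?case by (rule U_bounds)
  next
    case 3
    have "jm \<le> n" using P by (simp add: P_def)
    then show ?case using U_bounds(2) by linarith
  next
    case (4 st1)
    have j: "1 \<le> reg st1 ''j''" "reg st1 ''j'' \<le> jm" using 4(1) by auto
    have pj: "arr st1 ''p'' (reg st1 ''j'') = p (reg st1 ''j'')"
      using 4(2) assms(1) j P by (simp add: input_def same_def P_def)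
    have st1: "reg st1 ''v'' = v" "arr st1 ''sigma'' = arr st ''sigma''"
      using 4(2) assms by (auto simp: same_def)
    have "\<not> P (reg st1 ''j'')" using 4(3) pj st1 by (auto simp: P_def)
    then have "reg st1 ''j'' < jm" using j P by (metis le_neq_implies_less)
    then show ?case using j U_bounds(1) by (simp add: run_simps)
  next
    case (5 t st1)
    have j: "1 \<le> reg st1 ''j''" "reg st1 ''j'' \<le> jm" using 5(1) by auto
    have pj: "arr st1 ''p'' (reg st1 ''j'') = p (reg st1 ''j'')"
      using 5(2) assms(1) j P by (simp add: input_def same_def P_def)
    have st1: "reg st1 ''v'' = v" "reg st1 ''i'' = i" "arr st1 ''sigma'' = arr st ''sigma''"
      using 5(2) assms by (auto simp: same_def)
    have "P (reg st1 ''j'')" using 5(3) pj st1 j P by (auto simp: P_def)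
    then show ?case using 5(4) U_bounds(1) st1 by (auto simp: run_simps P_def)
  qed
qed

lemma vec_0: "vec 0 = (\<lambda>_. 0)"
  using digits_extend[of "E + 1" 0 V 0 pm] by (simp add: vec_def)

lemma run_place_config:
  assumes prep: "prepared st" and e: "reg st ''e'' < len" and i: "reg st ''i'' = i" "i \<in> {1..m}"
    and part: "partial_assignment (arr st ''sigma'') (\<lambda>v. z v + vec (reg st ''e'') v) i (load pm (vec (reg st ''e''))) g"
    and y: "reg st ''y'' = cd (\<lambda>v. z v + vec (reg st ''e'') v)"
  shows "run place_config st (\<lambda>t st'. t \<le> 500 * U ^ 2 \<and> partial_assignment (arr st' ''sigma'') z i 0 g \<and> reg st' ''y'' = cd z)"
  unfolding place_config_def
proof (rule run_while[where U = U and C = 150 and k = 1 and \<mu> = "\<lambda>st. reg st ''e''" and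
    I = "\<lambda>st. reg st ''e'' < len \<and>
      partial_assignment (arr st ''sigma'') (\<lambda>v. z v + vec (reg st ''e'') v) i (load pm (vec (reg st ''e''))) g \<and>
      reg st ''y'' = cd (\<lambda>v. z v + vec (reg st ''e'') v)"], goal_cases)
  case 1
  then show ?case using assms by simp
next
  case 2
  show ?case by (rule U_bounds)
next
  case 3
  then show ?case using e U_bounds(10) by simp
next
  case (4 st1)
  define e where "e = reg st1 ''e''"
  have e: "0 < e" "e < len" using 4(1,3) by (auto simp: e_def)
  define v e' where "v = arr st1 ''ov'' e" and "e' = arr st1 ''op'' e"
  have arrs: "arr st1 ''ov'' = arr st ''ov''" "arr st1 ''op'' = arr st ''op''" "arr st1 ''w'' = arr st ''w''"
    "reg st1 ''i'' = i"
    using 4(2) i by (auto simp: same_def)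
  have ve: "v \<in> V" "e' < e" "vec e = add_unit v (vec e')" "arr st1 ''w'' v = radix V B (v - 1)"
    using prep e by (auto simp: prepared_def enum_ok_def v_def e'_def arrs)
  have vpm: "v \<in> {1..pm}" using ve(1) V_sub by blast
  have ze: "(\<lambda>u. z u + vec e u) = add_unit v (\<lambda>u. z u + vec e' u)"
    unfolding ve(3) by (auto simp: add_unit_def)
  have le: "load pm (vec e) = load pm (vec e') + v" unfolding ve(3) by (rule load_add_unit[OF vpm])
  have pa: "partial_assignment (arr st1 ''sigma'') (add_unit v (\<lambda>u. z u + vec e' u)) i (load pm (vec e') + v) g"
    using 4(1) ze le by (simp add: e_def)
  have yy: "reg st1 ''y'' = cd (\<lambda>u. z u + vec e' u) + radix V B (v - 1)"
    using 4(1) cd_add_unit[OF ve(1)] by (simp add: e_def[symmetric] ze)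
  have left: "add_unit v (\<lambda>u. z u + vec e' u) v = card {j\<in>{1..n}. p j = v \<and> arr st1 ''sigma'' j = 0}"
    using pa ve(1) unfolding partial_assignment_def by blast
  have "add_unit v (\<lambda>u. z u + vec e' u) v \<noteq> 0" by (simp add: add_unit_def)
  then have "card {j\<in>{1..n}. p j = v \<and> arr st1 ''sigma'' j = 0} \<noteq> 0" unfolding left .
  then have "{j\<in>{1..n}. p j = v \<and> arr st1 ''sigma'' j = 0} \<noteq> {}" by (metis card.empty)
  then obtain j0 where j0: "j0 \<in> {1..n}" "p j0 = v" "arr st1 ''sigma'' j0 = 0" by blast
  have inp: "input (st1\<lparr>reg := (reg st1)(''v'' := v)\<rparr>)"
    using prep 4(2) by (auto simp: prepared_def input_def same_def)
  show ?case
    apply (simp only: run_Seq)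
    apply (simp only: run_Assign aval.simps e_def[symmetric] v_def[symmetric])
    apply (rule run_conseq[OF run_place_job[OF inp, of v i j0]])
    subgoal by simp
    subgoal using arrs by simp
    subgoal using j0 by simp
    subgoal using j0 by simp
    subgoal using j0 by simp
    apply (elim conjE bexE)
    subgoal for t st2 j
      using partial_assignment_place[OF pa ve(1) i(2), of j] yy ve(2,4) e U_bounds(1)
      by (simp add: same_def e_def[symmetric] e'_def[symmetric])
    done
next
  case (5 t st1)
  then have "reg st1 ''e'' = 0" by simp
  moreover have "t \<le> 308 * U\<^sup>2" using 5(4) by (simp add: power2_eq_square)
  then have "t + 10 \<le> 500 * U\<^sup>2" using U_power[of 2] by linarith
  ultimately show ?case using 5(1) by (simp add: vec_0 load_def)
qed

definition "rs L i0 a k = snd (vl L i0 a ! (spread_order (map fst (vl L i0 a)) ! k))"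

lemma rs_in: "a \<in> {1..pm} \<Longrightarrow> k < M L i0 a \<Longrightarrow> rs L i0 a k \<in> {1..m}"
proof -
  assume a: "a \<in> {1..pm}" and k: "k < M L i0 a"
  let ?o = "spread_order (map fst (vl L i0 a))"
  have "?o ! k < M L i0 a"
    using nth_mem[of k ?o] k by (simp add: set_spread_order length_spread_order M_def)
  then have "vl L i0 a ! (?o ! k) \<in> set (vl L i0 a)" by (simp add: M_def)
  then show ?thesis using part_size[OF a] virtual_machines_less unfolding vl_def rs_def by blast
qed

lemma rs_eq:
  assumes "holds_machines st (vl L i0 a)" "holds_list (arr st ''sq'') (spread_order (map fst (vl L i0 a)))" "k < M L i0 a"
  shows "arr st ''ru'' (arr st ''sq'' k) = rs L i0 a k"
proof -
  let ?o = "spread_order (map fst (vl L i0 a))"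
  have len: "length ?o = M L i0 a" by (simp add: length_spread_order M_def)
  then have "arr st ''sq'' k = ?o ! k" using assms(2,3) by (simp add: holds_list_def)
  moreover have "?o ! k < M L i0 a"
    using nth_mem[of k ?o] assms(3) len by (simp add: set_spread_order M_def)
  ultimately show ?thesis using assms(1) by (simp add: holds_machines_def holds_list_def rs_def M_def)
qed

text \<open>The spread order is a permutation of the virtual machines, so the parts of a real
  machine add up to its capacity in any order of processing.\<close>

lemma sum_parts_of_machine:
  assumes "i \<in> {1..m}"
  shows "(\<Sum>k<M L i0 a. if rs L i0 a k = i then ks L i0 a k else 0) = cap L i0 i"
proof -
  let ?v = "vl L i0 a" and ?o = "spread_order (map fst (vl L i0 a))"
  define F where "F u = (if snd (?v ! u) = i then fst (?v ! u) else 0)" for u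
  have len: "length ?o = M L i0 a" by (simp add: length_spread_order M_def)
  have "(\<Sum>k<M L i0 a. if rs L i0 a k = i then ks L i0 a k else 0) = sum_list (map F ?o)"
    unfolding rs_def ks_def F_def[symmetric] by (simp add: sum_list_sum_nth len atLeast0LessThan)
  also have "\<dots> = sum F (set ?o)" by (rule sum_list_distinct_conv_sum_set[OF distinct_spread_order])
  also have "\<dots> = (\<Sum>u<length ?v. F u)" by (simp add: set_spread_order)
  also have "\<dots> = sum_list (map (\<lambda>y. if snd y = i then fst y else 0) ?v)"
    by (simp add: sum_list_sum_nth F_def atLeast0LessThan)
  also have "\<dots> = (\<Sum>y\<leftarrow>filter (\<lambda>y. snd y = i) ?v. fst y)"
    by (rule sum_list_map_filter'[symmetric])
  also have "\<dots> = cap L i0 i" using assms by (simp add: vl_def virtual_machines_sum)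
  finally show ?thesis .
qed

lemma layer_ok_config:
  assumes "layer_ok L i0 a (Suc k) f" "Suc k \<le> M L i0 a" "x \<in> reach L i0 a (Suc k)"
  shows "last_config L i0 a k x (f (cd x) - 1)"
proof -
  have xb: "x v \<le> n + E" "v \<notin> V \<Longrightarrow> x v = 0" for v
    using reach_bounds[OF assms(2,3), of v] by auto
  have "cd x < Z" using xb(1) by (intro cd_less less_B)
  with assms(1,3) obtain y where y: "y \<in> reach L i0 a (Suc k)" "cd y = cd x" "last_config L i0 a k y (f (cd x) - 1)"
    unfolding layer_ok_def by (metis diff_Suc_1 zero_less_Suc)
  have yb: "y v \<le> n + E" "v \<notin> V \<Longrightarrow> y v = 0" for v
    using reach_bounds[OF assms(2) y(1), of v] by auto
  have "y = x" by (rule cd_inj[OF y(2)]) (use xb yb in \<open>auto intro: less_B\<close>)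
  then show ?thesis using y(3) by simp
qed

text \<open>Soundness of the search: a marked target is turned into an assignment by walking back
  through the layers.\<close>

lemma run_reconstruct:
  assumes prep: "prepared st" and a: "a \<in> {1..pm}" and vm: "holds_machines st (vl L i0 a)"
    and sq: "holds_list (arr st ''sq'') (spread_order (map fst (vl L i0 a)))"
    and o: "reg st ''o'' = off + Z * Suc (M L i0 a)"
    and tab: "\<And>k. k \<le> M L i0 a \<Longrightarrow> layer_ok L i0 a k (\<lambda>y. arr st ''tab'' (off + Z * Suc k + y))"
    and feas: "cnt \<in> reach L i0 a (M L i0 a)"
  shows "run reconstruct st (\<lambda>t st'. t \<le> 2000 * U ^ 3 \<and> (\<forall>j\<in>{1..n}. arr st' ''sigma'' j \<in> {1..m}) \<and>
    (\<forall>i\<in>{1..m}. machine_load (arr st' ''sigma'') i \<le> cap L i0 i))"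
proof -
  have inp: "input st" using prep by (simp add: prepared_def)
  have r: "reg st ''N'' = cd cnt" "reg st ''M'' = M L i0 a" "reg st ''Z'' = Z"
    using prep vm by (auto simp: prepared_def holds_machines_def M_def)
  \<comment> \<open>The capacity on machine \<open>i\<close> of the positions from \<open>k\<close>
    on, which the backward walk has already filled. At \<open>k = 0\<close> it is all of
    \<open>cap L i0 i\<close>.\<close>
  define g where "g k i = (\<Sum>k'\<in>{k..<M L i0 a}. if rs L i0 a k' = i then ks L i0 a k' else 0)" for k i
  \<comment> \<open>Between two positions no load is pending; this is expressed by machine 0, which
    does not exist.\<close>
  define I where "I st1 \<longleftrightarrow> reg st1 ''k'' \<le> M L i0 a \<and> reg st1 ''d'' = off + Z * Suc (reg st1 ''k'') \<and>
    (\<exists>x\<in>reach L i0 a (reg st1 ''k''). reg st1 ''y'' = cd x \<and>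
      partial_assignment (arr st1 ''sigma'') x 0 0 (g (reg st1 ''k'')))" for st1 :: state
  have MU: "M L i0 a \<le> U" using M_le[of L i0 a] U_bounds(11) by (simp add: A_def)
  show ?thesis
    unfolding reconstruct_def
    apply (simp only: run_Seq)
    apply (rule run_conseq[OF run_reset[OF inp]])
    apply (simp only: run_simps)
  proof (rule run_while[where U = U and C = 600 and k = 2 and \<mu> = "\<lambda>st. reg st ''k''" and I = I], goal_cases)
    case (1 t st0)
    have "machine_load (arr st0 ''sigma'') i = 0" if "i \<in> {1..m}" for i
      unfolding machine_load_def using 1(1) that by (intro sum.neutral) auto
    moreover have "card {j\<in>{1..n}. p j = v \<and> arr st0 ''sigma'' j = 0} = cnt v" for v
      unfolding cnt_def using 1(1) by (intro arg_cong[where f = card]) auto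
    ultimately have "partial_assignment (arr st0 ''sigma'') cnt 0 0 (g (M L i0 a))"
      using 1(1) by (auto simp: partial_assignment_def)
    then show ?case using 1(2) r o feas by (auto simp: I_def same_def intro!: bexI[of _ cnt])
  next
    case 2
    show ?case by (rule U_bounds)
  next
    case (3 t st0)
    then show ?case using MU r by (simp add: same_def)
  next
    case (4 t st0 st1)
    from 4(3)[unfolded I_def] obtain x where k: "reg st1 ''k'' \<le> M L i0 a" "reg st1 ''d'' = off + Z * Suc (reg st1 ''k'')"
      and x: "x \<in> reach L i0 a (reg st1 ''k'')" "reg st1 ''y'' = cd x"
        "partial_assignment (arr st1 ''sigma'') x 0 0 (g (reg st1 ''k''))" by blast
    obtain k' where k': "reg st1 ''k'' = Suc k'" using 4(5) by (cases "reg st1 ''k''") auto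
    have k'M: "k' < M L i0 a" using k k' by simp
    define i where "i = rs L i0 a k'"
    have im: "i \<in> {1..m}" unfolding i_def by (rule rs_in[OF a k'M])
    have st1: "arr st1 ''ru'' (arr st1 ''sq'' k') = i" "arr st1 ''tab'' = arr st ''tab''" "reg st1 ''Z'' = Z"
      using rs_eq[OF vm sq k'M] 4(2,4) r by (auto simp: same_def i_def)
    define e where "e = arr st ''tab'' (off + Z * Suc (Suc k') + cd x) - 1"
    have "last_config L i0 a k' x e"
      unfolding e_def by (rule layer_ok_config[OF tab]) (use x k' k'M in auto)
    then obtain z where z: "e < len" "load pm (vec e) \<le> ks L i0 a k'" "z \<in> reach L i0 a k'" "x = (\<lambda>v. z v + vec e v)"
      by (auto simp: last_config_def)
    have gk: "g k' i' = g (Suc k') i' + (if i' = i then ks L i0 a k' else 0)" for i'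
      unfolding g_def i_def using k'M by (simp add: sum.atLeast_Suc_lessThan)
    \<comment> \<open>Stepping back to \<open>k'\<close> adds \<open>ks L i0 a k'\<close> to the
      allowance of machine \<open>i\<close>, which covers the pending load of the content
      \<open>e\<close>.\<close>
    have pa: "partial_assignment (arr st1 ''sigma'') (\<lambda>v. z v + vec e v) i (load pm (vec e)) (g k')"
      using x(3) z(2) unfolding partial_assignment_def gk k' z(4) by (auto simp: add_mono)
    define st2 where "st2 = st1\<lparr>reg := (reg st1)(''k'' := k', ''i'' := i, ''e'' := e)\<rparr>"
    have p2: "prepared st2"
      using prep 4(2,4) by (auto simp: st2_def prepared_def input_def enum_ok_def same_def)
    have st2: "reg st2 ''e'' = e" "reg st2 ''i'' = i" "arr st2 ''sigma'' = arr st1 ''sigma''" "reg st2 ''y'' = cd x"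
      using x by (simp_all add: st2_def)
    note conf = run_place_config[of st2 i z "g k'", OF p2, unfolded st2, OF z(1) refl im pa]
    have eq: "st1\<lparr>reg := (reg st1)(''k'' := k', ''i'' := i,
        ''e'' := arr st ''tab'' (off + Z * Suc (Suc k') + cd x) - 1)\<rparr> = st2"
      by (simp add: st2_def e_def)
    show ?case
      apply (simp only: run_Seq)
      apply (simp add: run_Assign k' st1 k x(2) eq[simplified])
      apply (rule run_conseq[OF conf])
      subgoal using z(4) by simp
      using z(3) k'M k U_power[of 2]
      apply (auto simp: run_Assign I_def same_def st2_def k' st1 partial_assignment_def intro!: bexI[of _ z])
      done
  next
    case (5 t st0 t' st1)
    from 5(3)[unfolded I_def] obtain x where x: "x \<in> reach L i0 a (reg st1 ''k'')"
        "partial_assignment (arr st1 ''sigma'') x 0 0 (g (reg st1 ''k''))" by blast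
    have k: "reg st1 ''k'' = 0" using 5(5) by simp
    then have x0: "x = (\<lambda>_. 0)" using x(1) by simp
    have "arr st1 ''sigma'' j \<in> {1..m}" if j: "j \<in> {1..n}" for j
    proof -
      have "p j \<in> V" using j by (simp add: V_def)
      moreover have "\<forall>v\<in>V. 0 = card {j'\<in>{1..n}. p j' = v \<and> arr st1 ''sigma'' j' = 0}"
        using x(2) unfolding x0 partial_assignment_def by (elim conjE)
      ultimately have "0 = card {j'\<in>{1..n}. p j' = p j \<and> arr st1 ''sigma'' j' = 0}" by (rule bspec[rotated])
      moreover have "0 < card {j'\<in>{1..n}. p j' = p j \<and> arr st1 ''sigma'' j' = 0}" if "arr st1 ''sigma'' j = 0"
        unfolding card_gt_0_iff using j that by auto
      ultimately have "arr st1 ''sigma'' j \<noteq> 0" by linarith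
      moreover have "arr st1 ''sigma'' j \<le> m" using x(2) j by (simp add: partial_assignment_def)
      ultimately show ?thesis by simp
    qed
    moreover have "machine_load (arr st1 ''sigma'') i \<le> cap L i0 i" if i: "i \<in> {1..m}" for i
    proof -
      have "machine_load (arr st1 ''sigma'') i + (if i = 0 then 0 else 0) \<le> g 0 i"
        using x(2) i unfolding k partial_assignment_def by blast
      also have "g 0 i = cap L i0 i"
        using sum_parts_of_machine[OF i] by (simp add: g_def atLeast0LessThan)
      finally show ?thesis by simp
    qed
    moreover have "t' \<le> 1208 * U ^ 3" using 5(6) by (simp add: power3_eq_cube power2_eq_square ac_simps)
    moreover have "t \<le> 100 * U ^ 3" using 5(1) cost_mono[OF U_bounds(1), of 1 3 100] by simp
    ultimately show ?case using U_power[of 3] by simp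
  qed
qed

end

section \<open>Searching over all guesses\<close>

text \<open>The best makespan found so far is \<open>C / D\<close>, initially \<open>1 / 0\<close>, which exceeds every guess
  when the comparison is multiplied out.\<close>

definition attempt :: com where
  "attempt = split_machines ;; order_machines ;; fill_table ;; Assign ''t'' (Get ''s'' (Reg ''I'')) ;;
     mul ''x'' ''D'' ''L'' ;; mul ''y'' ''t'' ''C'' ;;
     If (And (Less (Const 0) (Get ''tab'' (Plus (Reg ''o'') (Reg ''N'')))) (Less (Reg ''x'') (Reg ''y'')))
      (Assign ''C'' (Reg ''L'') ;; Assign ''D'' (Reg ''t'') ;; reconstruct) Skip"

definition search_sizes :: com where
  "search_sizes = Assign ''a'' (Const 1) ;;
     While (Less (Reg ''a'') (Plus (Reg ''P'') (Const 1))) (attempt ;; incr ''a'')"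

definition search_machines :: com where
  "search_machines = Assign ''I'' (Const 1) ;;
     While (Less (Reg ''I'') (Plus (Reg ''m'') (Const 1))) (search_sizes ;; incr ''I'')"

definition search :: com where
  "search = Assign ''L'' (Const 0) ;;
     While (Less (Reg ''L'') (Plus (Reg ''S'') (Const 1))) (search_machines ;; incr ''L'')"

definition schedule_program :: com where
  "schedule_program = scan ;; constants ;; enumerate ;; target ;; Assign ''C'' (Const 1) ;; search"

definition attempt_regs :: "string list" where
  "attempt_regs = [''Q'', ''M'', ''i'', ''t'', ''u'', ''x'', ''w'', ''o'', ''b'', ''f'', ''v'', ''r'', ''z'', ''g'', ''C'', ''D'',
     ''j'', ''y'', ''d'', ''k'', ''e'']"

lemma mods_attempt: "set (mod_regs attempt) \<subseteq> set attempt_regs"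
  "set (mod_arrs attempt) \<subseteq> {''ku'', ''ru'', ''tm'', ''sq'', ''tab'', ''sigma''}"
  by (simp_all add: attempt_def attempt_regs_def)

lemma attempt_untouched:
  "x \<in> {''n'', ''m'', ''S'', ''P'', ''q'', ''h'', ''W'', ''l'', ''Z'', ''N'', ''L'', ''I'', ''a''} \<Longrightarrow> x \<notin> set (mod_regs attempt)"
  using mods_attempt(1) by (auto simp: attempt_regs_def)

lemma mods_search_sizes [simp]: "set (mod_regs search_sizes) = insert ''a'' (set (mod_regs attempt))"
  by (auto simp: search_sizes_def)

lemma mods_search_machines [simp]: "set (mod_regs search_machines) = insert ''I'' (insert ''a'' (set (mod_regs attempt)))"
  by (auto simp: search_machines_def)

context scheduling
begin

text \<open>In fractions: the stored assignment has makespan at most \<open>C / D\<close>, and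
  \<open>C / D\<close> is at most \<open>L / s i0\<close> for every feasible guess in
  \<open>G\<close>. The bound on \<open>C\<close> limits a loop of \<open>mul\<close>. For
  \<open>C = 1\<close> and \<open>D = 0\<close> the last condition fails at any feasible guess, so
  such a guess forces \<open>D\<close> to be positive.\<close>

definition best :: "state \<Rightarrow> (nat \<times> nat \<times> nat) set \<Rightarrow> bool" where
  "best st G \<longleftrightarrow> reg st ''C'' \<le> tot \<and> (reg st ''D'' = 0 \<longrightarrow> reg st ''C'' = 1) \<and>
     (0 < reg st ''D'' \<longrightarrow> (\<forall>j\<in>{1..n}. arr st ''sigma'' j \<in> {1..m}) \<and>
       (\<forall>i\<in>{1..m}. machine_load (arr st ''sigma'') i * reg st ''D'' \<le> reg st ''C'' * s i)) \<and>
     (\<forall>(L, i0, a)\<in>G. cnt \<in> reach L i0 a (M L i0 a) \<longrightarrow> reg st ''C'' * s i0 \<le> L * reg st ''D'')"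

definition searching :: "state \<Rightarrow> (nat \<times> nat \<times> nat) set \<Rightarrow> bool" where
  "searching st G \<longleftrightarrow> prepared st \<and> (\<forall>y. reg st ''o'' + Z \<le> y \<longrightarrow> arr st ''tab'' y = 0) \<and> best st G"

lemma table_decides:
  assumes "layer_ok L i0 a (M L i0 a) f"
  shows "f (cd cnt) \<noteq> 0 \<longleftrightarrow> cnt \<in> reach L i0 a (M L i0 a)"
proof
  have cB: "cnt v < B" for v using cnt_le[of v] by (simp add: B_def)
  have c0: "v \<notin> V \<Longrightarrow> cnt v = 0" for v using cnt_pos_iff[of v] by simp
  assume nz: "f (cd cnt) \<noteq> 0"
  have "cd cnt < Z" by (rule cd_less) (rule cB)
  with assms nz obtain v where v: "v \<in> reach L i0 a (M L i0 a)" "cd v = cd cnt" unfolding layer_ok_def by blast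
  have "v = cnt"
    by (rule cd_inj[OF v(2)]) (use reach_bounds[OF order.refl v(1)] cB c0 in \<open>auto intro: less_B\<close>)
  then show "cnt \<in> reach L i0 a (M L i0 a)" using v by simp
qed (use assms in \<open>simp add: layer_ok_def\<close>)

lemma best_insert_skip:
  assumes "best st G" "\<not> (cnt \<in> reach L i0 a (M L i0 a) \<and> L * reg st ''D'' < reg st ''C'' * s i0)"
    and "reg st' ''C'' = reg st ''C''" "reg st' ''D'' = reg st ''D''" "arr st' ''sigma'' = arr st ''sigma''"
  shows "best st' (insert (L, i0, a) G)"
  using assms by (auto simp: best_def not_less)

text \<open>Transitivity of the order on fractions in cross-multiplied form, which also covers the
  initial value with denominator 0.\<close>

lemma best_insert_improve:
  assumes b: "best st G" and L: "L \<le> tot" "L * reg st ''D'' < reg st ''C'' * s i0" and i0: "i0 \<in> {1..m}"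
    and G: "\<And>L1 i1 a1. (L1, i1, a1) \<in> G \<Longrightarrow> i1 \<in> {1..m}"
    and \<sigma>: "\<forall>j\<in>{1..n}. arr st' ''sigma'' j \<in> {1..m}" "\<forall>i\<in>{1..m}. machine_load (arr st' ''sigma'') i \<le> cap L i0 i"
    and st': "reg st' ''C'' = L" "reg st' ''D'' = s i0"
  shows "best st' (insert (L, i0, a) G)"
proof -
  have s0: "0 < s i0" using s_pos[OF i0] by simp
  have "machine_load (arr st' ''sigma'') i * s i0 \<le> L * s i" if i: "i \<in> {1..m}" for i
  proof -
    have "machine_load (arr st' ''sigma'') i \<le> L * s i div s i0" using \<sigma>(2) i by (auto simp: cap_def)
    then have "machine_load (arr st' ''sigma'') i * s i0 \<le> (L * s i div s i0) * s i0" by (rule mult_right_mono) simp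
    also have "\<dots> \<le> L * s i" by simp
    finally show ?thesis .
  qed
  moreover have "L * s i1 \<le> L1 * s i0" if g: "(L1, i1, a1) \<in> G" "cnt \<in> reach L1 i1 a1 (M L1 i1 a1)" for L1 i1 a1
  proof -
    have s1: "0 < s i1" using s_pos[OF G[OF g(1)]] by simp
    have old: "reg st ''C'' * s i1 \<le> L1 * reg st ''D''" using b g by (auto simp: best_def)
    have "(L * s i1) * reg st ''D'' < (reg st ''C'' * s i0) * s i1"
      using L(2) s1 by (metis mult.commute mult.left_commute mult_less_mono2)
    also have "\<dots> \<le> (L1 * s i0) * reg st ''D''"
      using mult_right_mono[OF old, of "s i0"] by (simp add: ac_simps)
    finally show ?thesis by simp
  qed
  ultimately show ?thesis using \<sigma>(1) L(1) s0 by (auto simp: best_def st')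
qed

lemma searching_intro:
  assumes "prepared st" "\<forall>y. reg st ''o'' + Z \<le> y \<longrightarrow> arr st ''tab'' y = 0" "same R X st st'"
    and "set R \<inter> {''n'', ''m'', ''S'', ''P'', ''q'', ''h'', ''W'', ''l'', ''Z'', ''N'', ''o''} = {}"
    and "set X \<inter> {''p'', ''s'', ''c'', ''oc'', ''ol'', ''op'', ''ov'', ''w'', ''tab''} = {}" and "best st' G"
  shows "searching st' G"
proof -
  have "prepared st'"
    by (rule prepared_same[OF assms(1,3)]) (use assms(4,5) in \<open>simp_all add: disjoint_iff\<close>)
  moreover have "reg st' ''o'' = reg st ''o''" "arr st' ''tab'' = arr st ''tab''"
    using assms(3-5) by (simp_all add: same_def)
  ultimately show ?thesis using assms(2,6) by (simp add: searching_def)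
qed

lemma run_attempt:
  assumes st: "searching st G" and L: "reg st ''L'' = L" "L \<le> tot" and i0: "reg st ''I'' = i0" "i0 \<in> {1..m}"
    and a: "reg st ''a'' = a" "a \<in> {1..pm}" and G: "\<And>L1 i1 a1. (L1, i1, a1) \<in> G \<Longrightarrow> i1 \<in> {1..m}"
  shows "run attempt st (\<lambda>t st'. t \<le> 20000 * U ^ 3 \<and> searching st' (insert (L, i0, a) G))"
proof -
  have prep: "prepared st" and b: "best st G" using st by (auto simp: searching_def)
  note p = prep[unfolded prepared_def]
  have U3: "C * U ^ 2 \<le> C * U ^ 3" "C * U \<le> C * U ^ 3" for C
    using cost_mono[OF U_bounds(1), of 2 3 C] cost_mono[OF U_bounds(1), of 1 3 C] by simp_all
  have MA: "length (map fst (vl L i0 a)) \<le> A" using M_le[of L i0 a] by (simp add: M_def A_def)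
  define K where "K = map fst (vl L i0 a)"
  show ?thesis
    unfolding attempt_def run_Seq
  proof (rule run_conseq[OF run_split_machines[of st L i0 a]], goal_cases)
    case (11 t1 st1)
    have vm1: "holds_machines st1 (vl L i0 a)" using 11(1) by simp
    have p1: "prepared st1" by (rule prepared_same[OF prep 11(2)]) simp_all
    show ?case
    proof (rule run_conseq[OF run_order_machines[of st1 K]], goal_cases)
      case (4 t2 st2)
      have p2: "prepared st2" by (rule prepared_same[OF p1 4(2)]) simp_all
      have vm2: "holds_machines st2 (vl L i0 a)" using vm1 4(2) by (simp add: holds_machines_def same_def)
      have sq2: "holds_list (arr st2 ''sq'') (spread_order (map fst (vl L i0 a)))" using 4(1) by (simp add: K_def)
      have tab2: "reg st2 ''o'' = reg st ''o''" "arr st2 ''tab'' = arr st ''tab''"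
        using 4(2) 11(2) by (simp_all add: same_def)
      show ?case
      proof (rule run_conseq[OF run_fill_table[OF p2 vm2 sq2 tab2(1)]], goal_cases)
        case (1 y)
        then show ?case using st tab2 by (simp add: searching_def)
      next
        case (2 t3 st3)
        define off where "off = reg st ''o''"
        have p3: "prepared st3" by (rule prepared_same[OF p2 2(2)]) simp_all
        have vm3: "holds_machines st3 (vl L i0 a)" using vm2 2(2) by (simp add: holds_machines_def same_def)
        have sq3: "holds_list (arr st3 ''sq'') (spread_order (map fst (vl L i0 a)))" using sq2 2(2) by (simp add: same_def)
        have r3: "reg st3 ''L'' = L" "reg st3 ''I'' = i0" "reg st3 ''C'' = reg st ''C''" "reg st3 ''D'' = reg st ''D''"
          "arr st3 ''sigma'' = arr st ''sigma''"
          using 2(2) 4(2) 11(2) L i0 by (simp_all add: same_def)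
        have o3: "reg st3 ''o'' = off + Z * Suc (M L i0 a)"
          and lay: "\<And>k. k \<le> M L i0 a \<Longrightarrow> layer_ok L i0 a k (\<lambda>y. arr st3 ''tab'' (off + Z * Suc k + y))"
          and fr: "\<forall>y. reg st3 ''o'' + Z \<le> y \<longrightarrow> arr st3 ''tab'' y = 0"
          using 2(1) by (simp_all add: off_def)
        have s3: "arr st3 ''s'' i0 = s i0" "reg st3 ''N'' = cd cnt"
          using p3 i0 by (simp_all add: prepared_def input_def)
        have dec: "arr st3 ''tab'' (reg st3 ''o'' + cd cnt) \<noteq> 0 \<longleftrightarrow> cnt \<in> reach L i0 a (M L i0 a)"
          unfolding o3 by (rule table_decides) (use lay in simp)
        have CU: "reg st ''C'' \<le> U" using b U_bounds(4) by (simp add: best_def)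
        have LU: "L \<le> U" using L U_bounds(4) by simp
        have time: "t1 \<le> 4000 * U ^ 3" "t2 \<le> 3000 * U ^ 3" "t3 \<le> 8000 * U ^ 3" "1 \<le> U ^ 3"
          using 11(1) 4(1) 2(1) U3(1)[of 4000] U3(1)[of 3000] U_power[of 3] by auto
        show ?case
          apply (simp only: run_simps)
          apply (rule run_mul[where U = U], simp, simp, rule U_bounds)
          subgoal using LU r3 by simp
          apply (rule run_mul[where U = U], simp, simp, rule U_bounds)
          subgoal using CU r3 by simp
        proof (goal_cases)
          case (1 t4 t5)
          have t45: "t4 \<le> 100 * U ^ 3" "t5 \<le> 100 * U ^ 3" using 1 U3(2)[of 100] by linarith+
          show ?case
          proof (cases "cnt \<in> reach L i0 a (M L i0 a) \<and> L * reg st ''D'' < reg st ''C'' * s i0")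
            case False
            then have no: "\<not> (0 < arr st3 ''tab'' (reg st3 ''o'' + cd cnt) \<and> reg st ''D'' * L < s i0 * reg st ''C'')"
              using dec by (simp add: mult.commute)
            show ?thesis
              using no t45 time
              apply (simp add: run_If run_Skip r3 s3 del: de_Morgan_conj)
              apply (rule searching_intro[OF p3 fr, where R = "[''t'', ''x'', ''z'', ''y'']" and X = "[]"])
              subgoal by (simp add: same_def)
              subgoal by simp
              subgoal by simp
              subgoal by (rule best_insert_skip[OF b False]) (simp_all add: r3)
              done
          next
            case True
            then have yes: "0 < arr st3 ''tab'' (reg st3 ''o'' + cd cnt)" "reg st ''D'' * L < s i0 * reg st ''C''"
              using dec by (simp_all add: mult.commute)
            show ?thesis
              apply (simp add: run_simps r3 s3 yes)
              apply (rule run_conseq[OF run_reconstruct[where L = L and ?i0.0 = i0 and a = a and off = off]])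
              subgoal using p3 by (simp add: prepared_def input_def enum_ok_def)
              subgoal by (rule a)
              subgoal using vm3 by (simp add: holds_machines_def)
              subgoal using sq3 by simp
              subgoal using o3 by simp
              subgoal using lay by simp
              subgoal using True by simp
              subgoal for t6 st6
                using t45 time
                apply (intro conjI)
                 apply simp
                apply (rule searching_intro[OF p3 fr, where X = "[''sigma'']" and
                      R = "[''t'', ''x'', ''z'', ''y'', ''C'', ''D'', ''j'', ''d'', ''k'', ''i'', ''e'', ''v'']"])
                subgoal by (simp add: same_def)
                subgoal by simp
                subgoal by simp
                subgoal by (rule best_insert_improve[OF b L(2) conjunct2[OF True] i0(2) G]) (simp_all add: same_def)
                done
              done
          qed
        qed
      qed
    next
      case 1
      then show ?case using vm1 by (simp add: holds_machines_def K_def)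
    next
      case 2
      then show ?case using MA by (simp add: K_def)
    next
      case 3
      then show ?case using vm1 by (simp add: holds_machines_def K_def)
    qed
  qed (use p L i0 a in auto)
qed

lemma searching_reg:
  assumes "searching st G" "x \<noteq> ''o''" "x \<notin> {''n'', ''m'', ''S'', ''P'', ''q'', ''h'', ''W'', ''l'', ''Z'', ''N'', ''C'', ''D''}"
  shows "searching (st\<lparr>reg := (reg st)(x := c)\<rparr>) G"
proof (rule searching_intro[where R = "[x]" and X = "[]"])
  show "prepared st" "\<forall>y. reg st ''o'' + Z \<le> y \<longrightarrow> arr st ''tab'' y = 0"
    using assms(1) by (simp_all add: searching_def)
  show "same [x] [] st (st\<lparr>reg := (reg st)(x := c)\<rparr>)" by (simp add: same_def)
  show "set [x] \<inter> {''n'', ''m'', ''S'', ''P'', ''q'', ''h'', ''W'', ''l'', ''Z'', ''N'', ''o''} = {}"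
    using assms(2,3) by simp
  have "best st G" "x \<noteq> ''C''" "x \<noteq> ''D''" using assms by (simp_all add: searching_def)
  then show "best (st\<lparr>reg := (reg st)(x := c)\<rparr>) G" by (simp add: best_def)
qed simp

lemma run_search_sizes:
  assumes st: "searching st G" and L: "reg st ''L'' = L" "L \<le> tot" and i0: "reg st ''I'' = i0" "i0 \<in> {1..m}"
    and G: "\<And>L1 i1 a1. (L1, i1, a1) \<in> G \<Longrightarrow> i1 \<in> {1..m}"
  shows "run search_sizes st (\<lambda>t st'. t \<le> 50000 * U ^ 4 \<and> searching st' (G \<union> {L} \<times> {i0} \<times> {1..pm}))"
  unfolding search_sizes_def run_simps
proof (rule run_while[where U = U and C = 20010 and k = 3 and \<mu> = "\<lambda>st. pm + 1 - reg st ''a''" and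
    I = "\<lambda>st. 1 \<le> reg st ''a'' \<and> reg st ''a'' \<le> pm + 1 \<and> searching st (G \<union> {L} \<times> {i0} \<times> {1..<reg st ''a''})"], goal_cases)
  case 1
  then show ?case using searching_reg[OF st] by simp
next
  case 2
  show ?case by (rule U_bounds)
next
  case 3
  then show ?case using U_bounds(5) by simp
next
  case (4 st1)
  define a where "a = reg st1 ''a''"
  have s1: "searching st1 (G \<union> {L} \<times> {i0} \<times> {1..<a})" using 4(1) by (simp add: a_def)
  have "reg st1 ''P'' = pm" using s1 by (simp add: searching_def prepared_def)
  then have a: "a \<in> {1..pm}" using 4(1,3) by (simp add: a_def)
  have r: "reg st1 ''L'' = L" "reg st1 ''I'' = i0" using 4(2) L i0 by (simp_all add: same_def attempt_untouched)
  have G1: "(L1, i1, a1) \<in> G \<union> {L} \<times> {i0} \<times> {1..<a} \<Longrightarrow> i1 \<in> {1..m}" for L1 i1 a1 using G i0 by auto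
  have "insert (L, i0, a) (G \<union> {L} \<times> {i0} \<times> {1..<a}) = G \<union> {L} \<times> {i0} \<times> {1..<Suc a}" using a by auto
  then show ?case
    apply (simp only: run_Seq)
    apply (rule run_conseq[OF run_attempt[OF s1 r(1) L(2) r(2) i0(2) a_def[symmetric] a G1]], assumption)
    using a U_power[of 3] by (simp add: run_simps same_def attempt_untouched a_def[symmetric] searching_reg Suc_diff_le)
next
  case (5 t st1)
  have "reg st1 ''P'' = pm" using 5(1) by (simp add: searching_def prepared_def)
  then have "reg st1 ''a'' = pm + 1" using 5(1,3) by simp
  moreover have "Suc 3 = 4" by simp
  then have "t \<le> 40032 * U ^ 4" using 5(4) by (simp del: power_Suc)
  then have "t + 10 \<le> 50000 * U ^ 4" using U_power[of 4] by linarith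
  ultimately show ?case using 5(1) by (simp add: atLeastLessThanSuc_atLeastAtMost)
qed

lemma run_search_machines:
  assumes st: "searching st G" and L: "reg st ''L'' = L" "L \<le> tot"
    and G: "\<And>L1 i1 a1. (L1, i1, a1) \<in> G \<Longrightarrow> i1 \<in> {1..m}"
  shows "run search_machines st (\<lambda>t st'. t \<le> 150000 * U ^ 5 \<and> searching st' (G \<union> {L} \<times> {1..m} \<times> {1..pm}))"
  unfolding search_machines_def run_simps
proof (rule run_while[where U = U and C = 50010 and k = 4 and \<mu> = "\<lambda>st. m + 1 - reg st ''I''" and
    I = "\<lambda>st. 1 \<le> reg st ''I'' \<and> reg st ''I'' \<le> m + 1 \<and> searching st (G \<union> {L} \<times> {1..<reg st ''I''} \<times> {1..pm})"], goal_cases)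
  case 1
  then show ?case using searching_reg[OF st] by simp
next
  case 2
  show ?case by (rule U_bounds)
next
  case 3
  then show ?case using U_bounds(3) by simp
next
  case (4 st1)
  define i0 where "i0 = reg st1 ''I''"
  have s1: "searching st1 (G \<union> {L} \<times> {1..<i0} \<times> {1..pm})" using 4(1) by (simp add: i0_def)
  have "reg st1 ''m'' = m" using s1 by (simp add: searching_def prepared_def input_def)
  then have i0: "i0 \<in> {1..m}" using 4(1,3) by (simp add: i0_def)
  have r: "reg st1 ''L'' = L" using 4(2) L by (simp add: same_def attempt_untouched)
  have G1: "(L1, i1, a1) \<in> G \<union> {L} \<times> {1..<i0} \<times> {1..pm} \<Longrightarrow> i1 \<in> {1..m}" for L1 i1 a1 using G i0 by auto
  have "G \<union> {L} \<times> {1..<i0} \<times> {1..pm} \<union> {L} \<times> {i0} \<times> {1..pm} = G \<union> {L} \<times> {1..<Suc i0} \<times> {1..pm}"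
    using i0 by auto
  then show ?case
    apply (simp only: run_Seq)
    apply (rule run_conseq[OF run_search_sizes[OF s1 r L(2) i0_def[symmetric] i0 G1]], assumption)
    using i0 U_power[of 4] by (simp add: run_simps same_def attempt_untouched i0_def[symmetric] searching_reg Suc_diff_le)
next
  case (5 t st1)
  have "reg st1 ''m'' = m" using 5(1) by (simp add: searching_def prepared_def input_def)
  then have "reg st1 ''I'' = m + 1" using 5(1,3) by simp
  moreover have "Suc 4 = 5" by simp
  then have "t \<le> 100032 * U ^ 5" using 5(4) by (simp del: power_Suc)
  then have "t + 10 \<le> 150000 * U ^ 5" using U_power[of 5] by linarith
  ultimately show ?case using 5(1) by (simp add: atLeastLessThanSuc_atLeastAtMost)
qed

text \<open>The loops over \<open>L\<close>, \<open>i0\<close> and \<open>a\<close> raise the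
  \<open>U ^ 3\<close> of one attempt to \<open>U ^ 6\<close>.\<close>

lemma run_search:
  assumes st: "searching st {}"
  shows "run search st (\<lambda>t st'. t \<le> 400000 * U ^ 6 \<and> searching st' ({0..tot} \<times> {1..m} \<times> {1..pm}))"
  unfolding search_def run_simps
proof (rule run_while[where U = U and C = 150010 and k = 5 and \<mu> = "\<lambda>st. tot + 1 - reg st ''L''" and
    I = "\<lambda>st. reg st ''L'' \<le> tot + 1 \<and> searching st ({0..<reg st ''L''} \<times> {1..m} \<times> {1..pm})"], goal_cases)
  case 1
  then show ?case using searching_reg[OF st] by simp
next
  case 2
  show ?case by (rule U_bounds)
next
  case 3
  then show ?case using U_bounds(4) by simp
next
  case (4 st1)
  define L where "L = reg st1 ''L''"
  have s1: "searching st1 ({0..<L} \<times> {1..m} \<times> {1..pm})" using 4(1) by (simp add: L_def)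
  have "reg st1 ''S'' = tot" using s1 by (simp add: searching_def prepared_def)
  then have L: "L \<le> tot" using 4(3) by (simp add: L_def)
  have "{0..<L} \<times> {1..m} \<times> {1..pm} \<union> {L} \<times> {1..m} \<times> {1..pm} = {0..<Suc L} \<times> {1..m} \<times> {1..pm}" by auto
  then show ?case
    apply (simp only: run_Seq)
    apply (rule run_conseq[OF run_search_machines[OF s1 L_def[symmetric] L]])
    subgoal by auto
    using L U_power[of 5] by (simp add: run_simps same_def attempt_untouched L_def[symmetric] searching_reg Suc_diff_le)
next
  case (5 t st1)
  have "reg st1 ''S'' = tot" using 5(1) by (simp add: searching_def prepared_def)
  then have "reg st1 ''L'' = tot + 1" using 5(1,3) by simp
  moreover have "Suc 5 = 6" by simp
  then have "t \<le> 300034 * U ^ 6" using 5(4) by (simp del: power_Suc)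
  then have "t + 10 \<le> 400000 * U ^ 6" using U_power[of 6] by linarith
  ultimately show ?case using 5(1) by (simp add: atLeastLessThanSuc_atLeastAtMost)
qed

lemma makespan_machine_load:
  "makespan n m p s \<sigma> = (MAX i\<in>{1..m}. real (machine_load \<sigma> i) / real (s i))"
  by (simp add: makespan_def machine_load_def sum_divide_distrib)

lemma searching_optimal:
  assumes st: "searching st ({0..tot} \<times> {1..m} \<times> {1..pm})"
  shows "optimal_assignment n m p s (output_assignment st)"
proof -
  let ?C = "reg st ''C''" and ?D = "reg st ''D''" and ?\<sigma> = "arr st ''sigma''"
  have b: "best st ({0..tot} \<times> {1..m} \<times> {1..pm})" using st by (simp add: searching_def)
  have ne: "{1..m} \<noteq> {}" using nm by auto
  \<comment> \<open>The makespan of \<open>\<tau>\<close> is attained on some machine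
    \<open>i0\<close> with load \<open>L\<close>. This guess is feasible by
    \<open>packing_reach\<close>, so its value bounds \<open>C / D\<close> from above.\<close>
  have witness: "\<exists>L i0. i0 \<in> {1..m} \<and> ?C * s i0 \<le> L * ?D \<and> real L / real (s i0) = makespan n m p s \<tau>"
    if \<tau>: "\<tau> \<in> {1..n} \<rightarrow> {1..m}" for \<tau>
  proof -
    have "makespan n m p s \<tau> \<in> (\<lambda>i. real (machine_load \<tau> i) / real (s i)) ` {1..m}"
      unfolding makespan_machine_load using ne by (intro Max_in) auto
    then obtain i0 where i0: "i0 \<in> {1..m}" "makespan n m p s \<tau> = real (machine_load \<tau> i0) / real (s i0)" by blast
    define L where "L = machine_load \<tau> i0"
    have le_tot: "machine_load \<tau> i \<le> tot" for i
      unfolding machine_load_def tot_def by (intro sum_mono2) auto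
    have s0: "0 < s i0" using s_pos[OF i0(1)] by simp
    have "machine_load \<tau> i \<le> cap L i0 i" if i: "i \<in> {1..m}" for i
    proof -
      have si: "0 < s i" using s_pos[OF i] by simp
      have "real (machine_load \<tau> i) / real (s i) \<le> makespan n m p s \<tau>"
        unfolding makespan_machine_load using i by (intro Max_ge) auto
      then have "real (machine_load \<tau> i * s i0) \<le> real (L * s i)"
        using i0(2) s0 si by (simp add: L_def divide_simps mult.commute)
      then have "machine_load \<tau> i * s i0 \<le> L * s i" by (simp only: of_nat_le_iff)
      then have "machine_load \<tau> i \<le> L * s i div s i0" using s0 by (simp add: less_eq_div_iff_mult_less_eq)
      then show ?thesis using le_tot by (simp add: cap_def)
    qed
    with packing_reach[OF \<tau>, of L i0] obtain a where a: "a \<in> {1..pm}" "cnt \<in> reach L i0 a (M L i0 a)"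
      unfolding machine_load_def by blast
    have "L \<le> tot" unfolding L_def by (rule le_tot)
    then have "(L, i0, a) \<in> {0..tot} \<times> {1..m} \<times> {1..pm}" using i0 a by simp
    then have "?C * s i0 \<le> L * ?D" using b a(2) unfolding best_def by fast
    then show ?thesis using i0 by (auto simp: L_def)
  qed
  \<comment> \<open>Any assignment at all yields a feasible guess, so \<open>D\<close> is positive
    at the end and an assignment has been stored.\<close>
  have "(\<lambda>_. 1) \<in> {1..n} \<rightarrow> {1..m}" using nm by simp
  from witness[OF this] obtain L i0 where "i0 \<in> {1..m}" "?C * s i0 \<le> L * ?D" by blast
  then have D: "0 < ?D" using b s_pos[of i0] by (auto simp: best_def intro!: gr0I)
  then have \<sigma>: "\<forall>j\<in>{1..n}. ?\<sigma> j \<in> {1..m}" "\<forall>i\<in>{1..m}. machine_load ?\<sigma> i * ?D \<le> ?C * s i"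
    using b by (simp_all add: best_def)
  have "makespan n m p s ?\<sigma> \<le> makespan n m p s \<tau>" if \<tau>: "\<tau> \<in> {1..n} \<rightarrow> {1..m}" for \<tau>
  proof -
    from witness[OF \<tau>] obtain L i0 where w: "i0 \<in> {1..m}" "?C * s i0 \<le> L * ?D"
      "real L / real (s i0) = makespan n m p s \<tau>" by blast
    have s0: "0 < s i0" using s_pos[OF w(1)] by simp
    have "real ?C * real (s i0) \<le> real L * real ?D" using w(2) by (metis of_nat_le_iff of_nat_mult)
    then have CL: "real ?C / real ?D \<le> real L / real (s i0)" using s0 D by (simp add: divide_simps)
    have "real (machine_load ?\<sigma> i) / real (s i) \<le> real ?C / real ?D" if i: "i \<in> {1..m}" for i
    proof -
      have "0 < s i" using s_pos[OF i] by simp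
      moreover have "real (machine_load ?\<sigma> i) * real ?D \<le> real ?C * real (s i)"
        using \<sigma>(2) i by (metis of_nat_le_iff of_nat_mult)
      ultimately show ?thesis using D by (simp add: divide_simps)
    qed
    then have "makespan n m p s ?\<sigma> \<le> real ?C / real ?D"
      unfolding makespan_machine_load using ne by (intro Max.boundedI) auto
    then show ?thesis using CL w(3) by simp
  qed
  then show ?thesis using \<sigma>(1) by (auto simp: optimal_assignment_def output_assignment_def)
qed

lemma run_schedule_program:
  "run schedule_program (input_state n m p s)
    (\<lambda>t st. t \<le> 500000 * U ^ 6 \<and> optimal_assignment n m p s (output_assignment st))"
proof -
  define st0 where "st0 = input_state n m p s"
  have inp: "input st0" unfolding st0_def by (rule input_init)
  have zero: "reg st0 ''S'' = 0" "reg st0 ''P'' = 0" "reg st0 ''N'' = 0" "reg st0 ''o'' = 0" "reg st0 ''D'' = 0"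
    "arr st0 ''c'' = (\<lambda>_. 0)" "arr st0 ''oc'' = (\<lambda>_. 0)" "arr st0 ''ol'' = (\<lambda>_. 0)" "arr st0 ''tab'' = (\<lambda>_. 0)"
    by (simp_all add: st0_def input_state_def)
  \<comment> \<open>The initial value 1 of \<open>C\<close> must respect the bound
    \<open>C \<le> tot\<close> in \<open>best\<close>.\<close>
  have tot1: "1 \<le> tot"
    using p_pos[of 1] nm sum_mono2[of "{1..n}" "{1}" p] by (simp add: tot_def)
  show ?thesis
    unfolding schedule_program_def run_Seq st0_def[symmetric]
  proof (rule run_conseq[OF run_scan[OF inp]], goal_cases)
    case (4 t1 st1)
    have i1: "input st1" by (rule input_same[OF inp 4(2)]) simp_all
    show ?case
    proof (rule run_conseq[OF run_constants[OF i1]], goal_cases)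
      case (2 t2 st2)
      have i2: "input st2" by (rule input_same[OF i1 2(2)]) simp_all
      show ?case
      proof (rule run_conseq[OF run_enumerate[of st2]], goal_cases)
        case (7 t3 st3)
        have i3: "input st3" by (rule input_same[OF i2 7(2)]) simp_all
        show ?case
        proof (rule run_conseq[OF run_target[OF i3]], goal_cases)
          case (3 t4 st4)
          have i4: "input st4" by (rule input_same[OF i3 3(2)]) simp_all
          have r4: "reg st4 ''S'' = tot" "reg st4 ''P'' = pm" "arr st4 ''c'' = cnt"
            "reg st4 ''q'' = 2 * pm\<^sup>2" "reg st4 ''h'' = h" "reg st4 ''W'' = W"
            "reg st4 ''l'' = len" "reg st4 ''Z'' = Z" "reg st4 ''N'' = cd cnt"
            "reg st4 ''o'' = 0" "reg st4 ''D'' = 0" "arr st4 ''tab'' = (\<lambda>_. 0)"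
            "\<forall>e<len. enum_ok st4 e" "\<forall>v\<in>V. arr st4 ''w'' v = radix V B (v - 1)"
            using 4 2 7 3 zero by (simp_all add: same_def Z_def enum_ok_def)
          then have s4: "searching (st4\<lparr>reg := (reg st4)(''C'' := 1)\<rparr>) {}"
            using i4 tot1 by (simp add: searching_def best_def prepared_def input_def enum_ok_def)
          have time: "t1 \<le> 100 * U ^ 6" "t2 \<le> 1000 * U ^ 6" "t3 \<le> 4000 * U ^ 6" "t4 \<le> 100 * U ^ 6" "1 \<le> U ^ 6"
            using 4(1) 2(1) 7(1) 3(1) U_power[of 6] cost_mono[OF U_bounds(1), of 1 6 100]
              cost_mono[OF U_bounds(1), of 1 6 1000] cost_mono[OF U_bounds(1), of 2 6 4000] by auto
          show ?case
            apply (simp only: run_Assign aval.simps)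
            apply (rule run_conseq[OF run_search[OF s4]])
            using time searching_optimal by auto
        qed (use 7 2 4 zero in \<open>simp_all add: same_def\<close>)
      qed (use 2 4 zero in \<open>simp_all add: same_def\<close>)
    qed (use 4 in simp)
  qed (use zero in simp_all)
qed

lemma U_poly: "U \<le> 1000 * pm ^ (18 * card V) * n ^ 4"
proof -
  have d: "1 \<le> card V" using pm_in_V by (auto simp: V_def card_gt_0_iff Suc_le_eq)
  have pw: "pm ^ k \<le> pm ^ (18 * card V)" if "k \<le> 18" for k
    using pm_pos d that by (intro power_increasing) auto
  have nw: "n ^ k \<le> n ^ 4" if "k \<le> 4" for k
    using nm that by (intro power_increasing) auto
  define X where "X = pm ^ (18 * card V) * n ^ 4"
  have X: "pm ^ k * n ^ l \<le> X" if "k \<le> 18" "l \<le> 4" for k l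
    unfolding X_def using pw nw that by (intro mult_le_mono)
  have h3: "h ^ 3 = 64 * pm ^ 9"
    by (simp add: h_def power_mult_distrib flip: power_mult)
  then have E: "E = 256 * pm ^ 9 + 1" by (simp add: E_def W_def)
  have p9: "1 \<le> pm ^ 9" using pm_pos by simp
  have len: "len \<le> 258 * X"
  proof -
    have VI: "V \<inter> {1..pm} = V" using V_sub by auto
    have "E + 1 \<le> 258 * pm ^ 9" using E p9 by linarith
    then have l: "len \<le> (258 * pm ^ 9) ^ card V"
      unfolding len_def radix_eq_power VI by (rule power_mono) simp
    \<comment> \<open>The factor \<open>258 ^ card V\<close> has to be absorbed into a power of
      \<open>pm\<close>. If \<open>pm\<close> is at least 2, then
      \<open>258 \<le> 2 ^ 9 \<le> pm ^ 9\<close>, which doubles the exponent 9 to 18; if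
      \<open>pm = 1\<close>, there is only one size.\<close>
    show ?thesis
    proof (cases "pm = 1")
      case True
      then have "V = {1}" using V_sub pm_in_V by auto
      then have "len \<le> 258" using l True by simp
      moreover have "1 \<le> X" using X[of 0 0] by simp
      ultimately show ?thesis by linarith
    next
      case False
      then have "2 ^ 9 \<le> pm ^ 9" using pm_pos by (intro power_mono) auto
      then have "258 * pm ^ 9 \<le> pm ^ 9 * pm ^ 9" by (intro mult_right_mono) auto
      then have "258 * pm ^ 9 \<le> pm ^ 18" by (simp flip: power_add)
      then have "(258 * pm ^ 9) ^ card V \<le> (pm ^ 18) ^ card V" by (rule power_mono) simp
      then have "len \<le> pm ^ (18 * card V) * n ^ 0" using l by (simp add: power_mult)
      also have "\<dots> \<le> X" unfolding X_def using nw[of 0] by (intro mult_left_mono) auto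
      finally show ?thesis by simp
    qed
  qed
  have "tot \<le> (\<Sum>j=1..n. pm)" unfolding tot_def by (intro sum_mono) (auto intro: p_le)
  then have "tot \<le> n * pm" by simp
  moreover have "1 \<le> n * pm" using nm pm_pos by simp
  ultimately have "tot + 1 \<le> 2 * (n * pm)" by linarith
  then have "A \<le> n * (2 * (n * pm))" unfolding A_def using nm by (intro mult_le_mono) auto
  then have A: "A \<le> 2 * (pm * n\<^sup>2)" by (simp add: power2_eq_square ac_simps)
  have "n * A \<le> n * (2 * (pm * n\<^sup>2))" using A by (rule mult_left_mono) simp
  also have "\<dots> = 2 * (pm ^ 1 * n ^ 3)" by (simp add: power2_eq_square power3_eq_cube ac_simps)
  also have "\<dots> \<le> 2 * X" using X[of 1 3] by simp
  finally have nA: "n * A \<le> 2 * X" .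
  have "A * A \<le> (2 * (pm * n\<^sup>2)) * (2 * (pm * n\<^sup>2))" using A by (intro mult_le_mono)
  also have "\<dots> = 4 * (pm ^ 2 * n ^ 4)" by (simp add: power2_eq_square power4_eq_xxxx ac_simps)
  also have "\<dots> \<le> 4 * X" using X[of 2 4] by simp
  finally have AA: "A * A \<le> 4 * X" .
  have h: "h \<le> 4 * X" using X[of 3 0] by (simp add: h_def)
  have "n \<le> X" "pm ^ 9 \<le> X" "1 \<le> X" using X[of 0 1] X[of 9 0] X[of 0 0] by simp_all
  then have B: "B \<le> 516 * X" unfolding B_def E by simp
  then have "U \<le> 1000 * X" unfolding U_def using B len nA AA h by simp
  then show ?thesis by (simp add: X_def mult.assoc)
qed

end

theorem theorem1:
  "\<exists>(prog :: com) (C :: nat) (a :: nat) (b :: nat).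
     \<forall>(n :: nat) (m :: nat) (p :: nat \<Rightarrow> nat) (s :: nat \<Rightarrow> nat).
       uniform_instance n m p s \<longrightarrow>
       (\<exists>t st. exec prog (input_state n m p s) t st \<and>
          optimal_assignment n m p s (output_assignment st) \<and>
          t \<le> C * p_max n p ^ (a * num_types n p) * n ^ b)"
proof (rule exI[of _ schedule_program], rule exI[of _ "500000 * 1000 ^ 6"], rule exI[of _ 108],
    rule exI[of _ 24], intro allI impI)
  fix n m :: nat and p s :: "nat \<Rightarrow> nat"
  assume "uniform_instance n m p s"
  then interpret scheduling n m p s by unfold_locales
  obtain t st where e: "exec schedule_program (input_state n m p s) t st"
    and o: "optimal_assignment n m p s (output_assignment st)" and t: "t \<le> 500000 * U ^ 6"
    using run_schedule_program unfolding run_def by blast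
  \<comment> \<open>The sixth power turns the exponents 18 and 4 of \<open>U_poly\<close> into 108
    and 24.\<close>
  have "U ^ 6 \<le> (1000 * pm ^ (18 * card V) * n ^ 4) ^ 6" by (intro power_mono U_poly) simp
  also have "\<dots> = 1000 ^ 6 * pm ^ (108 * card V) * n ^ 24"
    by (simp add: power_mult_distrib ac_simps flip: power_mult)
  finally have "t \<le> 500000 * (1000 ^ 6 * pm ^ (108 * card V) * n ^ 24)" using t by linarith
  then have "t \<le> (500000 * 1000 ^ 6) * p_max n p ^ (108 * num_types n p) * n ^ 24"
    by (simp only: mult.assoc pm_def num_types_def V_def)
  then show "\<exists>t st. exec schedule_program (input_state n m p s) t st \<and>
      optimal_assignment n m p s (output_assignment st) \<and>
      t \<le> (500000 * 1000 ^ 6) * p_max n p ^ (108 * num_types n p) * n ^ 24"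
    using e o by blast
qed

end
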